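(* Let $X$ be a Banach space and let $n$ be an integer with $2<n<\dim X$ (where $\dim X=\infty$ is allowed). Then there exists a directionally porous set $P\subset X$ which is not $\Gamma_n$-null.
   Context: Banach spaces are real; $B(x,r)$ denotes the open ball with centre $x$ and radius $r$. A set $P\subset X$ is directionally porous if there exists $0<\rho<1$ such that for all $x\in P$ there exists $v\in X$ with $\|v\|=1$ such that for every $\delta>0$ there exists $t\in\mathbb{R}$ with $0<|t|<\delta$ and $B(x+tv,\rho|t|)\cap P=\varnothing$. A $C^1$ surface of dimension $n$ in $X$ is a $C^1$ map $f\colon[0,1]^n\to X$. The space $\Gamma_n(X)$ of all such surfaces is equipped with the norm $\|f\|_{C^1}=\max(\|f\|_\infty,\|\partial f/\partial x_1\|_\infty,\ldots,\|\partial f/\partial x_n\|_\infty)$, where $\|\cdot\|_\infty$ is the supremum norm. A subset of a metric space is residual if its complement is meager (of first category). A set $N\subset X$ is $\Gamma_n$-null if $\mathcal{H}^n(f([0,1]^n)\cap N)=0$ for residually many $f\in\Gamma_n(X)$, where $\mathcal{H}^n$ is $n$-dimensional Hausdorff measure; that is, the set of $f\in\Gamma_n(X)$ with this property is residual in $\Gamma_n(X)$. *)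

theory Defs
  imports "HOL-Analysis.Analysis" "HOL-Library.Extended_Nat"
begin

definition directionally_porous :: "'a::real_normed_vector set \<Rightarrow> bool" where
  "directionally_porous P \<longleftrightarrow>
     (\<exists>\<rho>::real. 0 < \<rho> \<and> \<rho> < 1 \<and>
       (\<forall>x\<in>P. \<exists>v. norm v = 1 \<and>
         (\<forall>\<delta>>0. \<exists>t::real. 0 < \<bar>t\<bar> \<and> \<bar>t\<bar> < \<delta> \<and>
            ball (x + t *\<^sub>R v) (\<rho> * \<bar>t\<bar>) \<inter> P = {})))"

text \<open>The library's \<^const>\<open>dim\<close> is \<open>0\<close> on infinite-dimensional spaces, hence the
  extended dimension.\<close>

definition vdim :: "'a::real_vector itself \<Rightarrow> enat" where
  "vdim _ = (if \<exists>B::'a set. finite B \<and> span B = UNIV then enat (dim (UNIV :: 'a set)) else \<infinity>)"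

text \<open>Hausdorff measure without a normalising factor, which does not affect null sets.
  The diameter of an unbounded set is a dummy value, so only bounded covering sets
  are admitted; the case distinction for empty covering sets matters only for \<open>n = 0\<close>.\<close>

definition hausdorff_premeasure :: "nat \<Rightarrow> real \<Rightarrow> 'a::metric_space set \<Rightarrow> ennreal" where
  "hausdorff_premeasure n \<delta> A =
     (INF E \<in> {E :: nat \<Rightarrow> 'a set. A \<subseteq> (\<Union>i. E i) \<and> (\<forall>i. bounded (E i) \<and> diameter (E i) \<le> \<delta>)}.
        \<Sum>i. if E i = {} then 0 else ennreal (diameter (E i) ^ n))"

definition hausdorff_measure :: "nat \<Rightarrow> 'a::metric_space set \<Rightarrow> ennreal" where
  "hausdorff_measure n A = (SUP \<delta> \<in> {0<..}. hausdorff_premeasure n \<delta> A)"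

definition nowhere_dense_in :: "'a topology \<Rightarrow> 'a set \<Rightarrow> bool" where
  "nowhere_dense_in T A \<longleftrightarrow> A \<subseteq> topspace T \<and> T interior_of (T closure_of A) = {}"

definition meager_in :: "'a topology \<Rightarrow> 'a set \<Rightarrow> bool" where
  "meager_in T A \<longleftrightarrow> (\<exists>\<D>. countable \<D> \<and> (\<forall>D\<in>\<D>. nowhere_dense_in T D) \<and> A = \<Union>\<D>)"

definition residual_in :: "'a topology \<Rightarrow> 'a set \<Rightarrow> bool" where
  "residual_in T A \<longleftrightarrow> A \<subseteq> topspace T \<and> meager_in T (topspace T - A)"

definition unit_cube :: "(real ^ 'n) set" where
  "unit_cube = {x. \<forall>i. 0 \<le> x $ i \<and> x $ i \<le> 1}"

definition C1_on :: "(real ^ 'n) set \<Rightarrow> (real ^ 'n \<Rightarrow> 'a::real_normed_vector) \<Rightarrow> bool" where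
  "C1_on S f \<longleftrightarrow>
     (\<exists>f' :: real ^ 'n \<Rightarrow> (real ^ 'n) \<Rightarrow>\<^sub>L 'a.
        (\<forall>x\<in>S. (f has_derivative blinfun_apply (f' x)) (at x within S)) \<and> continuous_on S f')"

text \<open>Surfaces are maps on the cube only; as elements of a function type they are
  normalised to be \<^const>\<open>undefined\<close> outside it.\<close>

definition surfaces :: "(real ^ 'n \<Rightarrow> 'a::real_normed_vector) set" where
  "surfaces = {f \<in> extensional unit_cube. C1_on unit_cube f}"

text \<open>Partial derivatives are taken inside the cube, hence one-sided on its faces.\<close>

definition partial :: "'n \<Rightarrow> (real ^ 'n \<Rightarrow> 'a::real_normed_vector) \<Rightarrow> real ^ 'n \<Rightarrow> 'a" where
  "partial i f x =
     vector_derivative (\<lambda>t. f (x + t *\<^sub>R axis i 1)) (at 0 within {t. x + t *\<^sub>R axis i 1 \<in> unit_cube})"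

definition sup_norm :: "(real ^ 'n \<Rightarrow> 'a::real_normed_vector) \<Rightarrow> real" where
  "sup_norm f = (SUP x\<in>unit_cube. norm (f x))"

definition C1_norm :: "(real ^ 'n \<Rightarrow> 'a::real_normed_vector) \<Rightarrow> real" where
  "C1_norm f = Max (insert (sup_norm f) (range (\<lambda>i. sup_norm (partial i f))))"

text \<open>The value off \<^const>\<open>surfaces\<close> is a dummy; the locale \<^locale>\<open>Metric_space\<close> asks for
  nonnegativity on the whole type.\<close>

definition C1_dist ::
    "(real ^ 'n \<Rightarrow> 'a::real_normed_vector) \<Rightarrow> (real ^ 'n \<Rightarrow> 'a) \<Rightarrow> real" where
  "C1_dist f g = (if f \<in> surfaces \<and> g \<in> surfaces then C1_norm (\<lambda>x. f x - g x) else 0)"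

lemma zero_in_unit_cube: "(0 :: real ^ 'n) \<in> unit_cube"
  by (simp add: unit_cube_def)

lemma compact_unit_cube: "compact (unit_cube :: (real ^ 'n) set)"
proof -
  have "(unit_cube :: (real ^ 'n) set) = cbox 0 (\<chi> i. 1)"
    by (auto simp: unit_cube_def mem_box_cart)
  then show ?thesis by (metis compact_cbox)
qed

lemma partial_eq:
  fixes f :: "real ^ 'n \<Rightarrow> 'a::real_normed_vector"
  assumes f: "(f has_derivative D) (at x within unit_cube)" and x: "x \<in> unit_cube"
  shows "partial i f x = D (axis i 1)"
proof -
  define T where "T = {t::real. x + t *\<^sub>R axis i 1 \<in> (unit_cube :: (real ^ 'n) set)}"
  have xi: "0 \<le> x $ i" "x $ i \<le> 1" using x by (auto simp: unit_cube_def)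
  have T: "T = {- x $ i .. 1 - x $ i}"
  proof (intro set_eqI iffI)
    fix t assume "t \<in> T"
    then have "0 \<le> (x + t *\<^sub>R axis i 1) $ i \<and> (x + t *\<^sub>R axis i 1) $ i \<le> 1"
      unfolding T_def unit_cube_def by blast
    then show "t \<in> {- x $ i .. 1 - x $ i}" by (auto simp: axis_def)
  next
    fix t assume "t \<in> {- x $ i .. 1 - x $ i}"
    then show "t \<in> T" using x by (auto simp: T_def unit_cube_def axis_def)
  qed
  have nb: "at 0 within T \<noteq> bot"
    using xi by (auto simp: T trivial_limit_within islimpt_Icc)
  have g: "((\<lambda>t. x + t *\<^sub>R axis i 1) has_derivative (\<lambda>t. t *\<^sub>R axis i 1)) (at 0 within T)"
    by (auto intro!: derivative_eq_intros)
  have "((\<lambda>t. f (x + t *\<^sub>R axis i 1)) has_derivative (\<lambda>t. D (t *\<^sub>R axis i 1))) (at 0 within T)"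
  proof (rule has_derivative_in_compose[OF g])
    have "(\<lambda>t. x + t *\<^sub>R axis i 1) ` T \<subseteq> (unit_cube :: (real ^ 'n) set)" by (auto simp: T_def)
    then show "(f has_derivative D) (at (x + 0 *\<^sub>R axis i 1) within (\<lambda>t. x + t *\<^sub>R axis i 1) ` T)"
      using f by (auto intro: has_derivative_subset)
  qed
  then have "((\<lambda>t. f (x + t *\<^sub>R axis i 1)) has_vector_derivative D (axis i 1)) (at 0 within T)"
    using linear_scale[OF has_derivative_linear[OF f]] by (simp add: has_vector_derivative_def)
  then show ?thesis
    unfolding partial_def T_def[symmetric] by (rule vector_derivative_within[OF nb])
qed

lemma C1_on_diff:
  fixes f g :: "real ^ 'n \<Rightarrow> 'a::real_normed_vector"
  shows "C1_on S f \<Longrightarrow> C1_on S g \<Longrightarrow> C1_on S (\<lambda>x. f x - g x)"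
  unfolding C1_on_def
proof (elim exE conjE)
  fix f' g' :: "real ^ 'n \<Rightarrow> (real ^ 'n) \<Rightarrow>\<^sub>L 'a"
  assume "\<forall>x\<in>S. (f has_derivative blinfun_apply (f' x)) (at x within S)" "continuous_on S f'"
    and "\<forall>x\<in>S. (g has_derivative blinfun_apply (g' x)) (at x within S)" "continuous_on S g'"
  then show "\<exists>h'. (\<forall>x\<in>S. ((\<lambda>x. f x - g x) has_derivative blinfun_apply (h' x)) (at x within S))
      \<and> continuous_on S h'"
    by (intro exI[of _ "\<lambda>x. f' x - g' x"])
      (auto intro!: continuous_intros has_derivative_diff simp: minus_blinfun.rep_eq)
qed

lemma C1_on_partial:
  assumes "C1_on unit_cube f"
  shows "continuous_on unit_cube (partial i f)"
proof -
  obtain f' where f': "\<forall>x\<in>unit_cube. (f has_derivative blinfun_apply (f' x)) (at x within unit_cube)"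
    "continuous_on unit_cube f'"
    using assms by (auto simp: C1_on_def)
  have "continuous_on unit_cube (\<lambda>x. blinfun_apply (f' x) (axis i 1))"
    using f'(2) by (intro continuous_intros)
  then show ?thesis
    by (rule continuous_on_cong[THEN iffD1, rotated -1]) (use f'(1) in \<open>auto simp: partial_eq\<close>)
qed

lemma C1_on_continuous: "C1_on S f \<Longrightarrow> continuous_on S f"
  unfolding C1_on_def by (meson has_derivative_continuous_on)

lemma partial_diff:
  assumes "C1_on unit_cube f" "C1_on unit_cube g" "x \<in> unit_cube"
  shows "partial i (\<lambda>x. f x - g x) x = partial i f x - partial i g x"
proof -
  obtain f' where f': "(f has_derivative f') (at x within unit_cube)"
    using assms by (auto simp: C1_on_def)
  obtain g' where g': "(g has_derivative g') (at x within unit_cube)"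
    using assms by (auto simp: C1_on_def)
  show ?thesis
    using partial_eq[OF f' assms(3), of i] partial_eq[OF g' assms(3), of i]
      partial_eq[OF has_derivative_diff[OF f' g'] assms(3), of i] by simp
qed

lemma sup_norm_upper:
  assumes "continuous_on unit_cube f" "x \<in> unit_cube"
  shows "norm (f x) \<le> sup_norm f"
proof -
  have "compact ((\<lambda>x. norm (f x)) ` unit_cube)"
    using assms by (intro compact_continuous_image compact_unit_cube continuous_intros)
  then show ?thesis unfolding sup_norm_def
    using assms by (intro cSUP_upper bounded_imp_bdd_above compact_imp_bounded) auto
qed

lemma sup_norm_least: "(\<And>x. x \<in> unit_cube \<Longrightarrow> norm (f x) \<le> c) \<Longrightarrow> sup_norm f \<le> c"
  unfolding sup_norm_def using zero_in_unit_cube by (intro cSUP_least) auto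

lemma sup_norm_le_C1_norm: "sup_norm f \<le> C1_norm f" "sup_norm (partial i f) \<le> C1_norm f"
  unfolding C1_norm_def by (rule Max_ge; simp)+

lemma C1_norm_least:
  "sup_norm f \<le> c \<Longrightarrow> (\<And>i. sup_norm (partial i f) \<le> c) \<Longrightarrow> C1_norm f \<le> c"
  unfolding C1_norm_def by auto

lemma C1_norm_nonneg:
  assumes "C1_on unit_cube f"
  shows "0 \<le> C1_norm f"
proof -
  have "0 \<le> norm (f 0)" by simp
  also have "\<dots> \<le> sup_norm f"
    using assms by (intro sup_norm_upper zero_in_unit_cube C1_on_continuous)
  also have "\<dots> \<le> C1_norm f" by (rule sup_norm_le_C1_norm)
  finally show ?thesis .
qed

lemma C1_norm_diff_commute_le:
  assumes f: "C1_on unit_cube f" and g: "C1_on unit_cube g"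
  shows "C1_norm (\<lambda>x. f x - g x) \<le> C1_norm (\<lambda>x. g x - f x)"
proof (rule C1_norm_least)
  let ?h = "\<lambda>x. g x - f x"
  have h: "C1_on unit_cube ?h" using f g by (intro C1_on_diff)
  show "sup_norm (\<lambda>x. f x - g x) \<le> C1_norm ?h"
  proof (rule sup_norm_least)
    fix x :: "real ^ 'a" assume x: "x \<in> unit_cube"
    show "norm (f x - g x) \<le> C1_norm ?h"
      using sup_norm_upper[OF C1_on_continuous[OF h] x] sup_norm_le_C1_norm(1)[of ?h]
      by (simp add: norm_minus_commute)
  qed
  show "sup_norm (partial i (\<lambda>x. f x - g x)) \<le> C1_norm ?h" for i
  proof (rule sup_norm_least)
    fix x :: "real ^ 'a" assume x: "x \<in> unit_cube"
    show "norm (partial i (\<lambda>x. f x - g x) x) \<le> C1_norm ?h"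
      using sup_norm_upper[OF C1_on_partial[OF h] x, of i] sup_norm_le_C1_norm(2)[of i ?h]
      by (simp add: norm_minus_commute partial_diff[OF f g x] partial_diff[OF g f x])
  qed
qed

lemma C1_norm_diff_triangle:
  assumes f: "C1_on unit_cube f" and g: "C1_on unit_cube g" and h: "C1_on unit_cube h"
  shows "C1_norm (\<lambda>x. f x - h x) \<le> C1_norm (\<lambda>x. f x - g x) + C1_norm (\<lambda>x. g x - h x)"
    (is "_ \<le> C1_norm ?p + C1_norm ?q")
proof (rule C1_norm_least)
  have p: "C1_on unit_cube ?p" and q: "C1_on unit_cube ?q" using f g h by (auto intro: C1_on_diff)
  show "sup_norm (\<lambda>x. f x - h x) \<le> C1_norm ?p + C1_norm ?q"
  proof (rule sup_norm_least)
    fix x :: "real ^ 'a" assume x: "x \<in> unit_cube"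
    have "norm (f x - h x) \<le> norm (?p x) + norm (?q x)" using norm_triangle_ineq[of "?p x" "?q x"] by simp
    then show "norm (f x - h x) \<le> C1_norm ?p + C1_norm ?q"
      using sup_norm_upper[OF C1_on_continuous[OF p] x] sup_norm_le_C1_norm(1)[of ?p]
        sup_norm_upper[OF C1_on_continuous[OF q] x] sup_norm_le_C1_norm(1)[of ?q] by linarith
  qed
  show "sup_norm (partial i (\<lambda>x. f x - h x)) \<le> C1_norm ?p + C1_norm ?q" for i
  proof (rule sup_norm_least)
    fix x :: "real ^ 'a" assume x: "x \<in> unit_cube"
    have "norm (partial i (\<lambda>x. f x - h x) x) \<le> norm (partial i ?p x) + norm (partial i ?q x)"
      using norm_triangle_ineq[of "partial i ?p x" "partial i ?q x"]
      by (simp add: partial_diff[OF f g x] partial_diff[OF g h x] partial_diff[OF f h x])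
    then show "norm (partial i (\<lambda>x. f x - h x) x) \<le> C1_norm ?p + C1_norm ?q"
      using sup_norm_upper[OF C1_on_partial[OF p] x, of i] sup_norm_le_C1_norm(2)[of i ?p]
        sup_norm_upper[OF C1_on_partial[OF q] x, of i] sup_norm_le_C1_norm(2)[of i ?q] by linarith
  qed
qed

lemma C1_norm_diff_eq_0:
  assumes f: "f \<in> surfaces" and g: "g \<in> surfaces"
  shows "C1_norm (\<lambda>x. f x - g x) = 0 \<longleftrightarrow> f = g"
proof
  assume 0: "C1_norm (\<lambda>x. f x - g x) = 0"
  have h: "C1_on unit_cube (\<lambda>x. f x - g x)"
    using f g by (intro C1_on_diff) (auto simp: surfaces_def)
  have "f x = g x" if "x \<in> unit_cube" for x
    using sup_norm_upper[OF C1_on_continuous[OF h] that] sup_norm_le_C1_norm(1)[of "\<lambda>x. f x - g x"] 0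
      norm_ge_zero[of "f x - g x"]
    by (metis norm_le_zero_iff order_trans right_minus_eq)
  then show "f = g" using f g by (auto simp: surfaces_def intro: extensionalityI)
next
  assume fg: "f = g"
  have C: "C1_on unit_cube f" using f by (simp add: surfaces_def)
  have "partial i (\<lambda>x. f x - g x) x = 0" if "x \<in> unit_cube" for i x
    using partial_diff[OF C C that, of i] fg by simp
  then have "C1_norm (\<lambda>x. f x - g x) \<le> 0"
    by (intro C1_norm_least sup_norm_least) (auto simp: fg)
  with C1_norm_nonneg[OF C1_on_diff[OF C C]] fg show "C1_norm (\<lambda>x. f x - g x) = 0" by simp
qed

lemma Metric_space_surfaces:
  "Metric_space (surfaces :: (real ^ 'n \<Rightarrow> 'a::real_normed_vector) set) C1_dist"
proof
  fix f g h :: "real ^ 'n \<Rightarrow> 'a"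
  show "0 \<le> C1_dist f g"
    by (auto simp: C1_dist_def surfaces_def intro!: C1_norm_nonneg C1_on_diff)
  show "C1_dist f g = C1_dist g f"
    by (auto simp: C1_dist_def surfaces_def intro!: antisym C1_norm_diff_commute_le)
  show "f \<in> surfaces \<Longrightarrow> g \<in> surfaces \<Longrightarrow> C1_dist f g = 0 \<longleftrightarrow> f = g"
    by (simp add: C1_dist_def C1_norm_diff_eq_0)
  show "f \<in> surfaces \<Longrightarrow> g \<in> surfaces \<Longrightarrow> h \<in> surfaces \<Longrightarrow> C1_dist f h \<le> C1_dist f g + C1_dist g h"
    by (auto simp: C1_dist_def surfaces_def intro!: C1_norm_diff_triangle)
qed

definition surface_topology :: "(real ^ 'n \<Rightarrow> 'a::real_normed_vector) topology" where
  "surface_topology = Metric_space.mtopology surfaces C1_dist"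

text \<open>The dimension \<open>n\<close> of the surfaces is the cardinality of the index type \<open>'n\<close>.\<close>

definition Gamma_null :: "'n::finite itself \<Rightarrow> 'a::real_normed_vector set \<Rightarrow> bool" where
  "Gamma_null _ N \<longleftrightarrow>
     residual_in (surface_topology :: (real ^ 'n \<Rightarrow> 'a) topology)
       {f \<in> surfaces. hausdorff_measure CARD('n) (f ` unit_cube \<inter> N) = 0}"

end

theory Submission
  imports Defs
begin

text \<open>A continuous linear surjection onto \<open>\<real>\<^sup>n \<times> \<real>\<close> reduces everything to graphs of Lipschitz
  functions \<open>h\<close> with small constant over a cube in \<open>\<real>\<^sup>n\<close>. Let \<open>f\<^sub>i\<close> be a sequence of affine functions,
  dense among those with small slope. Just above the graph of \<open>f\<^sub>i\<close>, at many scales \<open>r\<close> of a level \<open>i\<close>,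
  lie holes of size \<open>r\<close>, at height about \<open>5r/2\<close> and horizontal distance \<open>Nr\<close> from each other,
  where \<open>N\<close> depends on \<open>i\<close> only. The set \<open>P\<close> consists of the points outside all holes that for
  infinitely many \<open>i\<close> lie almost on the graph of \<open>f\<^sub>i\<close> and directly below a hole of level \<open>i\<close>.
  It is porous in the vertical direction. A generic surface agrees up to tiny errors
  with suitable \<open>f\<^sub>i\<close> on most small cubes, for arbitrarily large \<open>i\<close>, so almost all of its points
  are below holes infinitely often.

  What remains is to bound the measure of the points of a graph that are inside holes, for all
  \<open>h\<close> simultaneously. If \<open>g = h - f\<^sub>i\<close> hits a hole of size \<open>r\<close>, then either \<open>g\<close> has values comparable
  to \<open>r\<close> on a large part of the surrounding cell of size \<open>Nr\<close>, and such cells account for a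
  proportion \<open>O(N\<^sup>-\<^sup>n)\<close> only, or, as the capacity of a cube of size \<open>r\<close> is of order \<open>r\<^sup>n\<^sup>-\<^sup>2\<close> for
  \<open>n > 2\<close>, the gradient of the truncation of \<open>g\<close> to values comparable to \<open>r\<close> has energy at least of
  order \<open>r\<^sup>n\<close> there. Truncations at different levels \<open>i\<close>, after averaging at the smallest scale of the
  level, have almost orthogonal gradients, because the finer one has an amplitude far below
  the scale of the coarser one. The gradient of \<open>f\<^sub>i\<close> is constant, so its integral against the
  gradient of a compactly supported function is \<open>0\<close>, and each of these energies is at most a
  correlation with the gradient of \<open>h\<close>. By Bessel's inequality the energies of all levels together are bounded by that of
  \<open>h\<close>, which is small.\<close>

subsection \<open>Difference quotients and averages over cubes\<close>

text \<open>The obstacle is that the holes of a level cannot be charged by their area. In order that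
  almost every point is below a hole of level \<open>i\<close>, the number \<open>m i\<close> of
  scales must be at least of the order of \<open>i * 2 ^ (q i * n)\<close>, and then the bases of
  all these holes cover almost everything. Two facts save the estimate. Holes of different scales
  lie at different heights, so over a given point a surface is at the height of at most one scale,
  and the volume terms of a whole level cost no more than those of one scale. And entering holes
  otherwise costs energy, of which the surface has only a fixed amount for all levels.

  Gradients are replaced by difference quotients: they make sense for all Lipschitz functions and
  need no differentiation almost everywhere. All radii are powers of two, so the quotients of every
  scale and level are averages of quotients of one common small step, and all levels can be tested
  against the same function.

  The order of choices is: the slope bound \<epsilon>, then \<open>q0\<close>, then for each level
  \<open>q i\<close>, then \<open>m i\<close>, and last \<open>p i\<close>, which separates the
  level from the earlier ones.\<close>

definition hcube :: "real ^ 'n \<Rightarrow> real \<Rightarrow> (real ^ 'n) set" where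
  "hcube z s = {x. \<forall>j. z $ j \<le> x $ j \<and> x $ j < z $ j + s}"

lemma hcube_borel [measurable]: "hcube z s \<in> sets borel"
proof -
  have "hcube z s = (\<Inter>j. {x. z $ j \<le> x $ j} \<inter> {x. x $ j < z $ j + s})"
    by (auto simp: hcube_def)
  also have "\<dots> \<in> sets borel"
    by (intro sets.finite_INT sets.Int borel_closed borel_open closed_Collect_le open_Collect_less continuous_intros) auto
  finally show ?thesis .
qed

lemma hcube_subset_cbox: "hcube z s \<subseteq> cbox z (z + (\<chi> j. s))"
  by (auto simp: hcube_def mem_box_cart less_imp_le)

lemma box_subset_hcube: "box z (z + (\<chi> j. s)) \<subseteq> hcube z s"
  by (auto simp: hcube_def mem_box_cart less_imp_le)

lemma bounded_hcube: "bounded (hcube z s)"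
  using bounded_subset[OF bounded_cbox hcube_subset_cbox] .

lemma hcube_fmeasurable: "hcube z u \<in> fmeasurable lborel"
  by (rule fmeasurableI2[OF fmeasurable_cbox hcube_subset_cbox]) simp

lemma measure_cbox_cube:
  fixes z :: "real ^ 'n"
  assumes "0 \<le> s"
  shows "measure lborel (cbox z (z + (\<chi> j. s))) = s ^ CARD('n)"
  using assms by (subst content_cbox_cart) (auto simp: interval_ne_empty_cart)

lemma measure_hcube:
  fixes z :: "real ^ 'n"
  assumes "0 \<le> s"
  shows "measure lborel (hcube z s) = s ^ CARD('n)"
proof (rule antisym)
  show "measure lborel (hcube z s) \<le> s ^ CARD('n)"
    unfolding measure_cbox_cube[OF assms, symmetric, of z]
    by (intro measure_mono_fmeasurable hcube_subset_cbox) auto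
  have "measure lborel (box z (z + (\<chi> j. s))) = measure lborel (cbox z (z + (\<chi> j. s)))"
    by (metis measure_lborel_box_eq measure_lborel_cbox_eq)
  moreover have "measure lborel (box z (z + (\<chi> j. s))) \<le> measure lborel (hcube z s)"
  proof (intro measure_mono_fmeasurable box_subset_hcube)
    show "hcube z s \<in> fmeasurable lborel" by (rule hcube_fmeasurable)
  qed auto
  ultimately show "s ^ CARD('n) \<le> measure lborel (hcube z s)"
    using measure_cbox_cube[OF assms, of z] by simp
qed

lemma integrable_cont_on_bounded:
  fixes f :: "'b::euclidean_space \<Rightarrow> real"
  assumes f: "continuous_on UNIV f" and C: "C \<in> sets borel" "bounded C"
  shows "integrable lborel (\<lambda>x. indicator C x * f x)"
proof -
  obtain a where a: "C \<subseteq> cbox (-a) a" using bounded_subset_cbox_symmetric[OF C(2)] by blast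
  have "integrable lborel (\<lambda>x. indicator (cbox (-a) a) x *\<^sub>R f x)"
    by (rule borel_integrable_compact) (auto intro: continuous_on_subset[OF f])
  then have "integrable lborel (\<lambda>x. indicator C x *\<^sub>R (indicator (cbox (-a) a) x *\<^sub>R f x))"
    using C by (intro integrable_mult_indicator[of C lborel "\<lambda>x. indicator (cbox (-a) a) x *\<^sub>R f x"]) auto
  moreover have "(\<lambda>x. indicator C x *\<^sub>R (indicator (cbox (-a) a) x *\<^sub>R f x)) = (\<lambda>x. indicator C x * f x)"
    using a by (auto simp: indicator_def fun_eq_iff)
  ultimately show ?thesis by simp
qed

lemma integral_lborel_shift:
  fixes f :: "'b::euclidean_space \<Rightarrow> real"
  assumes [measurable]: "f \<in> borel_measurable borel"
  shows "(\<integral>x. f (x + c) \<partial>lborel) = (\<integral>x. f x \<partial>lborel)"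
proof -
  have "(\<integral>x. f x \<partial>lborel) = (\<integral>x. f x \<partial>distr lborel borel ((+) c))"
    by (simp add: lborel_distr_plus)
  also have "\<dots> = (\<integral>x. f (c + x) \<partial>lborel)" by (rule integral_distr) auto
  finally show ?thesis by (simp add: add.commute)
qed

lemma integrable_lborel_shift:
  fixes f :: "'b::euclidean_space \<Rightarrow> real"
  assumes "integrable lborel f"
  shows "integrable lborel (\<lambda>x. f (x + c))"
proof -
  have "integrable (distr lborel borel ((+) c)) f"
    using assms by (simp add: lborel_distr_plus)
  then have "integrable lborel (\<lambda>x. f (c + x))"
    using assms by (subst (asm) integrable_distr_eq) auto
  then show ?thesis by (simp add: add.commute)
qed

definition dq :: "real \<Rightarrow> 'n \<Rightarrow> (real ^ 'n \<Rightarrow> real) \<Rightarrow> real ^ 'n \<Rightarrow> real" where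
  "dq l j f x = (f (x + l *\<^sub>R axis j 1) - f x) / l"

lemma continuous_on_shift:
  fixes f :: "'b::real_normed_vector \<Rightarrow> real"
  assumes "continuous_on UNIV f" shows "continuous_on UNIV (\<lambda>x. f (x + c))"
  by (rule continuous_on_compose2[OF assms]) (auto intro!: continuous_intros)

lemma continuous_on_dq: "continuous_on UNIV f \<Longrightarrow> continuous_on UNIV (dq l j f)"
  unfolding dq_def by (cases "l = 0") (auto intro!: continuous_intros continuous_on_shift)

lemma dq_telescope:
  assumes "l \<noteq> 0"
  shows "f (x + (real m * l) *\<^sub>R axis c 1) - f x = l * (\<Sum>t<m. dq l c f (x + (real t * l) *\<^sub>R axis c 1))"
proof (induction m)
  case (Suc m)
  have "x + (real (Suc m) * l) *\<^sub>R axis c 1 = (x + (real m * l) *\<^sub>R axis c 1) + l *\<^sub>R axis c 1"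
    by (simp add: algebra_simps)
  then have "f (x + (real (Suc m) * l) *\<^sub>R axis c 1) - f (x + (real m * l) *\<^sub>R axis c 1)
     = l * dq l c f (x + (real m * l) *\<^sub>R axis c 1)"
    using assms by (simp only: dq_def) (simp add: field_simps)
  then show ?case using Suc by (simp add: algebra_simps)
qed simp

text \<open>The shift by \<open>w\<close> is split into \<open>m\<close> shifts by \<open>l\<close>.
  The \<open>t\<close>-th of them integrates a quotient over a translate of \<open>C\<close>, which
  stays in \<open>C'\<close>, and the \<open>m\<close> factors \<open>l\<close> add up to
  \<open>w\<close>. This is an \<open>L^1\<close> Poincare inequality in one direction.\<close>

lemma shift_diff_bound:
  fixes V :: "real ^ 'n \<Rightarrow> real"
  assumes V: "continuous_on UNIV V" and l: "0 < l" and w: "w = real m * l"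
    and C: "C \<in> sets borel" "bounded C" and C': "C' \<in> sets borel" "bounded C'"
    and sub: "\<And>x t. x \<in> C \<Longrightarrow> t < m \<Longrightarrow> x + (real t * l) *\<^sub>R axis c 1 \<in> C'"
  shows "\<bar>\<integral>x. indicator C x * (V (x + w *\<^sub>R axis c 1) - V x) \<partial>lborel\<bar>
      \<le> w * (\<integral>x. indicator C' x * \<bar>dq l c V x\<bar> \<partial>lborel)"
proof -
  let ?e = "\<lambda>t. (real t * l) *\<^sub>R axis c (1::real) :: real ^ 'n"
  define F where "F = (\<lambda>x. indicator C' x * \<bar>dq l c V x\<bar>)"
  have cF: "continuous_on UNIV (\<lambda>x. \<bar>dq l c V x\<bar>)" by (intro continuous_intros continuous_on_dq V)
  have iF: "integrable lborel F" unfolding F_def by (rule integrable_cont_on_bounded[OF cF C'])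
  have "\<bar>\<integral>x. indicator C x * (V (x + w *\<^sub>R axis c 1) - V x) \<partial>lborel\<bar>
     \<le> (\<integral>x. \<bar>indicator C x * (V (x + w *\<^sub>R axis c 1) - V x)\<bar> \<partial>lborel)"
    by (rule integral_abs_bound)
  also have "\<dots> \<le> (\<integral>x. l * (\<Sum>t<m. F (x + ?e t)) \<partial>lborel)"
  proof (rule integral_mono)
    show "integrable lborel (\<lambda>x. \<bar>indicator C x * (V (x + w *\<^sub>R axis c 1) - V x)\<bar>)"
      by (intro integrable_abs integrable_cont_on_bounded C continuous_intros V continuous_on_shift)
    show "integrable lborel (\<lambda>x. l * (\<Sum>t<m. F (x + ?e t)))"
      by (intro integrable_mult_right Bochner_Integration.integrable_sum integrable_lborel_shift iF)
    fix x :: "real ^ 'n"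
    show "\<bar>indicator C x * (V (x + w *\<^sub>R axis c 1) - V x)\<bar> \<le> l * (\<Sum>t<m. F (x + ?e t))"
    proof (cases "x \<in> C")
      case True
      have "\<bar>V (x + w *\<^sub>R axis c 1) - V x\<bar> = l * \<bar>\<Sum>t<m. dq l c V (x + ?e t)\<bar>"
        using dq_telescope[of l V x m c] l w by (simp add: abs_mult)
      also have "\<dots> \<le> l * (\<Sum>t<m. \<bar>dq l c V (x + ?e t)\<bar>)"
        using l by (intro mult_left_mono sum_abs) auto
      also have "(\<Sum>t<m. \<bar>dq l c V (x + ?e t)\<bar>) = (\<Sum>t<m. F (x + ?e t))"
        using sub[OF True] by (intro sum.cong) (auto simp: F_def)
      finally show ?thesis using True by simp
    next
      case False
      then show ?thesis using l by (auto simp: F_def intro!: mult_nonneg_nonneg sum_nonneg)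
    qed
  qed
  also have "\<dots> = l * (\<Sum>t<m. (\<integral>x. F (x + ?e t) \<partial>lborel))"
    by (simp add: integrable_lborel_shift iF)
  also have "\<dots> = l * (\<Sum>t<m. (\<integral>x. F x \<partial>lborel))"
    using iF by (simp add: integral_lborel_shift)
  also have "\<dots> = w * (\<integral>x. F x \<partial>lborel)" using w by simp
  finally show ?thesis by (simp add: F_def)
qed

text \<open>The lower corners of the \<open>2 ^ n\<close> subcubes of side \<open>w\<close> of
  \<open>hcube z (2 * w)\<close> are the points \<open>z + svec w S\<close>.\<close>

definition svec :: "real \<Rightarrow> 'n set \<Rightarrow> real ^ 'n" where
  "svec w S = (\<chi> j. if j \<in> S then w else 0)"

lemma svec_insert: "c \<notin> S \<Longrightarrow> svec w (insert c S) = svec w S + w *\<^sub>R axis c 1"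
  by (auto simp: svec_def vec_eq_iff axis_def)

text \<open>The coordinates in \<open>S\<close> are moved one after the other. A cube already moved
  by \<open>svec w S\<close> can still move by less than \<open>w\<close> in a direction
  \<open>c \<notin> S\<close> without leaving the doubled cube.\<close>

lemma subset_shift_bound:
  fixes V :: "real ^ 'n \<Rightarrow> real"
  assumes V: "continuous_on UNIV V" and l: "0 < l" and w: "w = real m * l" and S: "finite S"
  shows "\<bar>\<integral>x. indicator (hcube z w) x * (V (x + svec w S) - V x) \<partial>lborel\<bar>
      \<le> w * (\<Sum>c\<in>S. \<integral>x. indicator (hcube z (2 * w)) x * \<bar>dq l c V x\<bar> \<partial>lborel)"
  using S
proof induction
  case empty
  then show ?case by (simp add: svec_def zero_vec_def[symmetric])
next
  case (insert c S)
  let ?C = "hcube z w" and ?C' = "hcube z (2 * w)"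
  let ?D = "hcube (z + svec w S) w"
  have int: "integrable lborel (\<lambda>x. indicator ?C x * (V (x + a) - V (x + b)))" for a b
    by (intro integrable_cont_on_bounded hcube_borel bounded_hcube continuous_intros continuous_on_shift V)
  have int': "integrable lborel (\<lambda>x. indicator ?C x * (V (x + a) - V x))" for a
    using int[of a 0] by simp
  have w0: "0 \<le> w" using w l by simp
  have "(\<integral>x. indicator ?C x * (V (x + svec w (insert c S)) - V x) \<partial>lborel)
     = (\<integral>x. indicator ?C x * (V (x + svec w (insert c S)) - V (x + svec w S)) 
          + indicator ?C x * (V (x + svec w S) - V x) \<partial>lborel)"
    by (rule arg_cong[where f = "integral\<^sup>L lborel"]) (simp add: fun_eq_iff right_diff_distrib)
  also have "\<dots> = (\<integral>x. indicator ?C x * (V (x + svec w (insert c S)) - V (x + svec w S)) \<partial>lborel)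
     + (\<integral>x. indicator ?C x * (V (x + svec w S) - V x) \<partial>lborel)"
    by (rule Bochner_Integration.integral_add[OF int int'])
  also have "(\<integral>x. indicator ?C x * (V (x + svec w (insert c S)) - V (x + svec w S)) \<partial>lborel)
     = (\<integral>x. indicator ?D (x + svec w S) * (V ((x + svec w S) + w *\<^sub>R axis c 1) - V (x + svec w S)) \<partial>lborel)"
    using insert.hyps by (intro Bochner_Integration.integral_cong)
      (auto simp: svec_insert hcube_def indicator_def algebra_simps)
  also have "\<dots> = (\<integral>x. indicator ?D x * (V (x + w *\<^sub>R axis c 1) - V x) \<partial>lborel)"
  proof (rule integral_lborel_shift)
    have "continuous_on UNIV (\<lambda>x. V (x + w *\<^sub>R axis c 1) - V x)"
      by (intro continuous_intros continuous_on_shift V)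
    from integrable_cont_on_bounded[OF this hcube_borel bounded_hcube]
    show "(\<lambda>x. indicator ?D x * (V (x + w *\<^sub>R axis c 1) - V x)) \<in> borel_measurable borel"
      by (auto dest: borel_measurable_integrable)
  qed
  finally have eq: "(\<integral>x. indicator ?C x * (V (x + svec w (insert c S)) - V x) \<partial>lborel)
     = (\<integral>x. indicator ?D x * (V (x + w *\<^sub>R axis c 1) - V x) \<partial>lborel)
     + (\<integral>x. indicator ?C x * (V (x + svec w S) - V x) \<partial>lborel)" .
  have "\<bar>\<integral>x. indicator ?D x * (V (x + w *\<^sub>R axis c 1) - V x) \<partial>lborel\<bar>
     \<le> w * (\<integral>x. indicator ?C' x * \<bar>dq l c V x\<bar> \<partial>lborel)"
  proof (rule shift_diff_bound[OF V l w hcube_borel bounded_hcube hcube_borel bounded_hcube])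
    fix x :: "real ^ 'n" and t assume x: "x \<in> ?D" and t: "t < m"
    have "real t * l < w" using t w l by simp
    have "0 \<le> real t * l" using l by simp
    show "x + (real t * l) *\<^sub>R axis c 1 \<in> ?C'"
      unfolding hcube_def
    proof (intro CollectI allI)
      fix j
      have xj: "z $ j + svec w S $ j \<le> x $ j" "x $ j < z $ j + svec w S $ j + w"
        using x by (auto simp: hcube_def)
      have "svec w S $ j = (if j \<in> S then w else 0)" by (simp add: svec_def)
      moreover have "(x + (real t * l) *\<^sub>R axis c 1) $ j = x $ j + (if j = c then real t * l else 0)"
        by (simp add: axis_def)
      ultimately show "z $ j \<le> (x + (real t * l) *\<^sub>R axis c 1) $ j
          \<and> (x + (real t * l) *\<^sub>R axis c 1) $ j < z $ j + 2 * w"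
        using xj insert.hyps(2) w0 \<open>real t * l < w\<close> \<open>0 \<le> real t * l\<close> by (auto split: if_splits)
    qed
  qed
  then show ?case
    using insert.IH insert.hyps w0 unfolding eq by (simp add: distrib_left)
qed

text \<open>Half-open cubes tile exactly: the only subcube that can contain \<open>x\<close> belongs
  to the set \<open>T\<close> of the coordinates in which \<open>x\<close> lies in the upper
  half.\<close>

lemma hcube_split:
  fixes x :: "real ^ 'n"
  assumes "0 \<le> w"
  shows "indicator (hcube z (2 * w)) x = (\<Sum>S\<in>UNIV. indicator (hcube (z + svec w S) w) x :: real)"
proof -
  define T where "T = {j. z $ j + w \<le> x $ j}"
  have "indicator (hcube (z + svec w S) w) x = (if S = T then indicator (hcube z (2 * w)) x else 0 :: real)" for S
  proof (cases "S = T")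
    case True
    have "(z + svec w T) $ j \<le> x $ j \<and> x $ j < (z + svec w T) $ j + w
        \<longleftrightarrow> z $ j \<le> x $ j \<and> x $ j < z $ j + 2 * w" for j
      using assms by (auto simp: svec_def T_def)
    then have "x \<in> hcube (z + svec w T) w \<longleftrightarrow> x \<in> hcube z (2 * w)"
      by (simp add: hcube_def)
    then show ?thesis using True by (simp add: indicator_def)
  next
    case False
    then obtain j where j: "j \<in> S \<longleftrightarrow> j \<notin> T" by blast
    have "\<not> ((z + svec w S) $ j \<le> x $ j \<and> x $ j < (z + svec w S) $ j + w)"
      using j assms by (auto simp: svec_def T_def)
    then have "x \<notin> hcube (z + svec w S) w" by (auto simp: hcube_def)
    then show ?thesis using False by simp
  qed
  then show ?thesis by (simp)
qed

text \<open>The doubled cube consists of \<open>2 ^ n\<close> subcubes, and each of them is compared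
  with the one at the corner \<open>z\<close> by a shift.\<close>

lemma doubling_bound:
  fixes V :: "real ^ 'n \<Rightarrow> real"
  assumes V: "continuous_on UNIV V" and l: "0 < l" and w: "w = real m * l"
  shows "\<bar>(\<integral>x. indicator (hcube z (2 * w)) x * V x \<partial>lborel) - 2 ^ CARD('n) * (\<integral>x. indicator (hcube z w) x * V x \<partial>lborel)\<bar>
      \<le> 2 ^ CARD('n) * w * (\<Sum>c\<in>UNIV. \<integral>x. indicator (hcube z (2 * w)) x * \<bar>dq l c V x\<bar> \<partial>lborel)"
proof -
  let ?C = "hcube z w" and ?C' = "hcube z (2 * w)"
  let ?E = "\<Sum>c\<in>UNIV. \<integral>x. indicator ?C' x * \<bar>dq l c V x\<bar> \<partial>lborel"
  have w0: "0 \<le> w" using w l by simp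
  have card: "card (UNIV :: 'n set set) = 2 ^ CARD('n)"
    by (metis Pow_UNIV card_Pow finite)
  have int: "integrable lborel (\<lambda>x. indicator (hcube u v) x * V (x + a))" for u v a
    by (intro integrable_cont_on_bounded hcube_borel bounded_hcube continuous_on_shift V)
  have int0: "integrable lborel (\<lambda>x. indicator (hcube u v) x * V x)" for u v
    using int[of u v 0] by simp
  have "(\<integral>x. indicator ?C' x * V x \<partial>lborel)
      = (\<integral>x. (\<Sum>S\<in>UNIV. indicator (hcube (z + svec w S) w) x * V x) \<partial>lborel)"
    by (simp add: hcube_split[OF w0] sum_distrib_right)
  also have "\<dots> = (\<Sum>S\<in>UNIV. \<integral>x. indicator (hcube (z + svec w S) w) x * V x \<partial>lborel)"
    by (rule Bochner_Integration.integral_sum) (rule int0)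
  also have "\<dots> = (\<Sum>S\<in>UNIV. \<integral>x. indicator ?C x * V (x + svec w S) \<partial>lborel)"
  proof (rule sum.cong[OF refl])
    fix S :: "'n set"
    have "(\<integral>x. indicator (hcube (z + svec w S) w) x * V x \<partial>lborel)
      = (\<integral>x. indicator (hcube (z + svec w S) w) (x + svec w S) * V (x + svec w S) \<partial>lborel)"
      by (rule integral_lborel_shift[symmetric]) (use int0 in \<open>auto dest: borel_measurable_integrable\<close>)
    also have "\<dots> = (\<integral>x. indicator ?C x * V (x + svec w S) \<partial>lborel)"
      by (intro Bochner_Integration.integral_cong) (auto simp: hcube_def indicator_def algebra_simps)
    finally show "(\<integral>x. indicator (hcube (z + svec w S) w) x * V x \<partial>lborel)
      = (\<integral>x. indicator ?C x * V (x + svec w S) \<partial>lborel)" .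
  qed
  also have "\<dots> = (\<Sum>S\<in>UNIV. (\<integral>x. indicator ?C x * (V (x + svec w S) - V x) \<partial>lborel) + (\<integral>x. indicator ?C x * V x \<partial>lborel))"
    by (intro sum.cong refl) (simp add: right_diff_distrib int int0)
  also have "\<dots> = (\<Sum>S\<in>UNIV. (\<integral>x. indicator ?C x * (V (x + svec w S) - V x) \<partial>lborel)) + 2 ^ CARD('n) * (\<integral>x. indicator ?C x * V x \<partial>lborel)"
    by (simp add: sum.distrib card)
  finally have "\<bar>(\<integral>x. indicator ?C' x * V x \<partial>lborel) - 2 ^ CARD('n) * (\<integral>x. indicator ?C x * V x \<partial>lborel)\<bar>
    = \<bar>\<Sum>S\<in>UNIV. (\<integral>x. indicator ?C x * (V (x + svec w S) - V x) \<partial>lborel)\<bar>" by simp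
  also have "\<dots> \<le> (\<Sum>S\<in>(UNIV::'n set set). \<bar>\<integral>x. indicator ?C x * (V (x + svec w S) - V x) \<partial>lborel\<bar>)"
    by (rule sum_abs)
  also have "\<dots> \<le> (\<Sum>S\<in>(UNIV::'n set set). w * ?E)"
  proof (rule sum_mono)
    fix S :: "'n set"
    have "\<bar>\<integral>x. indicator ?C x * (V (x + svec w S) - V x) \<partial>lborel\<bar>
        \<le> w * (\<Sum>c\<in>S. \<integral>x. indicator ?C' x * \<bar>dq l c V x\<bar> \<partial>lborel)"
      by (rule subset_shift_bound[OF V l w]) simp
    also have "\<dots> \<le> w * ?E"
      using w0 by (intro mult_left_mono sum_mono2) auto
    finally show "\<bar>\<integral>x. indicator ?C x * (V (x + svec w S) - V x) \<partial>lborel\<bar> \<le> w * ?E" .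
  qed
  also have "\<dots> = 2 ^ CARD('n) * w * ?E" by (simp add: card)
  finally show ?thesis .
qed

subsection \<open>Capacity of small cubes\<close>

text \<open>Cauchy-Schwarz against the indicator of \<open>C\<close>, from expanding the integral of
  the square of \<open>m * f - I\<close>, where \<open>m\<close> is the measure of \<open>C\<close>
  and \<open>I\<close> the integral of \<open>f\<close>. One factor \<open>m\<close> is then
  cancelled, so null sets are treated apart.\<close>

lemma integral_sq_le:
  fixes f :: "'b::euclidean_space \<Rightarrow> real"
  assumes f: "continuous_on UNIV f" and C: "C \<in> sets borel" "bounded C"
  shows "(\<integral>x. indicator C x * f x \<partial>lborel)\<^sup>2 \<le> measure lborel C * (\<integral>x. indicator C x * (f x)\<^sup>2 \<partial>lborel)"
proof -
  let ?m = "measure lborel C" and ?I = "\<integral>x. indicator C x * f x \<partial>lborel"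
    and ?J = "\<integral>x. indicator C x * (f x)\<^sup>2 \<partial>lborel"
  have i1: "integrable lborel (\<lambda>x. indicator C x * f x)"
    by (rule integrable_cont_on_bounded[OF f C])
  have i2: "integrable lborel (\<lambda>x. indicator C x * (f x)\<^sup>2)"
    by (intro integrable_cont_on_bounded C continuous_intros f)
  have i3: "integrable lborel (\<lambda>x. indicator C x * (1::real))"
    by (intro integrable_cont_on_bounded C continuous_intros)
  have I3: "(\<integral>x. indicator C x * (1::real) \<partial>lborel) = ?m" using C by simp
  have key: "0 \<le> ?m\<^sup>2 * ?J - ?m * ?I\<^sup>2"
  proof -
    have "0 \<le> (\<integral>x. indicator C x * (?m * f x - ?I)\<^sup>2 \<partial>lborel)"
      by (intro integral_nonneg_AE) auto
    also have "\<dots> = (\<integral>x. ?m\<^sup>2 * (indicator C x * (f x)\<^sup>2) - (2 * ?m * ?I) * (indicator C x * f x)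
         + ?I\<^sup>2 * (indicator C x * 1) \<partial>lborel)"
      by (rule arg_cong[where f = "integral\<^sup>L lborel"]) (auto simp: fun_eq_iff power2_eq_square algebra_simps)
    also have "\<dots> = ?m\<^sup>2 * ?J - (2 * ?m * ?I) * ?I + ?I\<^sup>2 * ?m"
      using i1 i2 i3 I3 by simp
    finally show ?thesis by (simp add: power2_eq_square algebra_simps)
  qed
  show ?thesis
  proof (cases "?m = 0")
    case True
    have "AE x in lborel. x \<notin> C"
    proof -
      have "emeasure lborel C = 0"
        using True C emeasure_bounded_finite[OF C(2)] by (auto simp: measure_def enn2real_eq_0_iff)
      then show ?thesis using C by (auto intro!: AE_not_in simp: null_sets_def)
    qed
    then have "?I = 0" by (intro integral_eq_zero_AE) (auto elim!: eventually_mono)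
    then show ?thesis using True by simp
  next
    case False
    then have "0 < ?m" using measure_nonneg[of lborel C] by linarith
    moreover have "0 \<le> ?m * (?m * ?J - ?I\<^sup>2)" using key by (simp add: power2_eq_square algebra_simps)
    ultimately show ?thesis by (simp add: zero_le_mult_iff)
  qed
qed

text \<open>\<open>doubling_bound\<close> is squared by Cauchy-Schwarz, once over the directions
  (factor \<open>n\<close>) and once over the cube (factor \<open>(2 * w) ^ n\<close>). The energy
  is taken over any larger set \<open>C\<close>, so that a single energy serves all scales in
  \<open>capacity_bound\<close>.\<close>

lemma doubling_step:
  fixes V :: "real ^ 'n \<Rightarrow> real" and m :: nat
  defines "n \<equiv> CARD('n)"
  assumes V: "continuous_on UNIV V" and l: "0 < l" and w: "w = real m * l" and m: "0 < m"
    and sub: "hcube z (2 * w) \<subseteq> C" and C: "C \<in> sets borel" "bounded C"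
    and n: "3 \<le> n"
  defines "a \<equiv> \<lambda>u. (\<integral>x. indicator (hcube z u) x * V x \<partial>lborel) / u ^ n"
  shows "(a (2 * w) - a w)\<^sup>2 \<le> real n * 2 ^ n * w\<^sup>2 / w ^ n * (\<Sum>c\<in>UNIV. \<integral>x. indicator C x * (dq l c V x)\<^sup>2 \<partial>lborel)"
proof -
  let ?C' = "hcube z (2 * w)"
  let ?D = "\<lambda>c. \<integral>x. indicator ?C' x * \<bar>dq l c V x\<bar> \<partial>lborel"
  let ?E = "\<lambda>c. \<integral>x. indicator C x * (dq l c V x)\<^sup>2 \<partial>lborel"
  have w0: "0 < w" using w l m by simp
  have wn: "0 < w ^ n" using w0 by simp
  have D: "(?D c)\<^sup>2 \<le> (2 * w) ^ n * ?E c" for c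
  proof -
    have "(?D c)\<^sup>2 \<le> measure lborel ?C' * (\<integral>x. indicator ?C' x * (\<bar>dq l c V x\<bar>)\<^sup>2 \<partial>lborel)"
      by (intro integral_sq_le hcube_borel bounded_hcube continuous_intros continuous_on_dq V)
    also have "\<dots> \<le> (2 * w) ^ n * ?E c"
    proof (rule mult_mono)
      show "measure lborel ?C' \<le> (2 * w) ^ n" using measure_hcube[of "2 * w" z] w0 by (simp add: n_def)
      show "(\<integral>x. indicator ?C' x * (\<bar>dq l c V x\<bar>)\<^sup>2 \<partial>lborel) \<le> ?E c"
        using sub by (intro integral_mono integrable_cont_on_bounded hcube_borel bounded_hcube C continuous_intros continuous_on_dq V)
          (auto simp: indicator_def)
    qed (use w0 in \<open>auto intro!: integral_nonneg_AE\<close>)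
    finally show ?thesis .
  qed
  have "\<bar>a (2 * w) - a w\<bar> * (2 ^ n * w ^ n)
     = \<bar>(\<integral>x. indicator ?C' x * V x \<partial>lborel) - 2 ^ n * (\<integral>x. indicator (hcube z w) x * V x \<partial>lborel)\<bar>"
  proof -
    have "(a (2 * w) - a w) * (2 ^ n * w ^ n) = (\<integral>x. indicator ?C' x * V x \<partial>lborel) - 2 ^ n * (\<integral>x. indicator (hcube z w) x * V x \<partial>lborel)"
      using w0 by (simp add: a_def power_mult_distrib field_simps)
    then have "\<bar>(a (2 * w) - a w) * (2 ^ n * w ^ n)\<bar> = \<bar>(\<integral>x. indicator ?C' x * V x \<partial>lborel) - 2 ^ n * (\<integral>x. indicator (hcube z w) x * V x \<partial>lborel)\<bar>"
      by simp
    then show ?thesis using wn by (simp add: abs_mult)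
  qed
  also have "\<dots> \<le> 2 ^ n * w * (\<Sum>c\<in>UNIV. ?D c)"
    unfolding n_def by (rule doubling_bound[OF V l w])
  finally have "\<bar>a (2 * w) - a w\<bar> \<le> w / w ^ n * (\<Sum>c\<in>UNIV. ?D c)"
    using wn by (simp add: field_simps)
  then have "(a (2 * w) - a w)\<^sup>2 \<le> (w / w ^ n * (\<Sum>c\<in>UNIV. ?D c))\<^sup>2"
    by (rule abs_le_square_iff[THEN iffD1, OF order_trans[OF _ abs_ge_self]])
  also have "\<dots> = (w / w ^ n)\<^sup>2 * (\<Sum>c\<in>UNIV. ?D c)\<^sup>2" by (rule power_mult_distrib)
  also have "\<dots> \<le> (w / w ^ n)\<^sup>2 * ((\<Sum>c\<in>UNIV. (?D c)\<^sup>2) * real n)"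
    unfolding n_def by (intro mult_left_mono sum_squared_le_sum_of_squares) auto
  also have "\<dots> \<le> (w / w ^ n)\<^sup>2 * ((\<Sum>c\<in>UNIV. (2 * w) ^ n * ?E c) * real n)"
    by (intro mult_left_mono mult_right_mono sum_mono D) auto
  also have "\<dots> = real n * 2 ^ n * w\<^sup>2 / w ^ n * (\<Sum>c\<in>UNIV. ?E c)"
    using wn by (simp add: sum_distrib_left[symmetric] power_divide power2_eq_square power_mult_distrib field_simps)
  finally show ?thesis .
qed

lemma sum_sqrt_half_le: "(\<Sum>j<q. sqrt (1/2) ^ j) \<le> 4"
proof -
  have s: "sqrt (1/2) \<le> 3/4" by (rule real_le_lsqrt) (auto simp: power2_eq_square)
  have "(\<Sum>j<q. sqrt (1/2) ^ j) \<le> (\<Sum>j<q. (3/4::real) ^ j)"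
    by (intro sum_mono power_mono s) auto
  also have "\<dots> = (1 - (3/4) ^ q) / (1 - 3/4)" by (subst sum_gp_strict) auto
  also have "\<dots> \<le> 4" by simp
  finally show ?thesis .
qed

text \<open>The averages of \<open>V\<close> over the cubes of side \<open>2\<^sup>j r\<close> change by at most a multiple of
  \<open>(2\<^sup>j r)\<^sup>1\<^sup>-\<^sup>n\<^sup>/\<^sup>2\<close> times the root of the energy; these bounds form a convergent geometric series
  exactly when \<open>n > 2\<close>.\<close>

lemma capacity_bound:
  fixes V :: "real ^ 'n \<Rightarrow> real" and m q :: nat
  defines "n \<equiv> CARD('n)"
  assumes n: "3 \<le> n" and V: "continuous_on UNIV V" and l: "0 < l" and r: "r = real m * l" and m: "0 < m"
    and v: "0 \<le> v" and in_: "\<And>x. x \<in> hcube z r \<Longrightarrow> V x = v"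
    and out: "(\<integral>x. indicator (hcube z (2 ^ q * r)) x * V x \<partial>lborel) \<le> v / 2 * (2 ^ q * r) ^ n"
  shows "v\<^sup>2 * r ^ n \<le> 64 * real n * 2 ^ n * r\<^sup>2 *
     (\<Sum>c\<in>UNIV. \<integral>x. indicator (hcube z (2 ^ q * r)) x * (dq l c V x)\<^sup>2 \<partial>lborel)"
proof -
  define a where "a = (\<lambda>u. (\<integral>x. indicator (hcube z u) x * V x \<partial>lborel) / u ^ n)"
  define E where "E = (\<Sum>c\<in>UNIV. \<integral>x. indicator (hcube z (2 ^ q * r)) x * (dq l c V x)\<^sup>2 \<partial>lborel)"
  define B where "B = real n * 2 ^ n * r\<^sup>2 / r ^ n * E"
  have r0: "0 < r" using r l m by simp
  have E0: "0 \<le> E" unfolding E_def by (intro sum_nonneg integral_nonneg_AE) auto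
  have B0: "0 \<le> B" using E0 r0 by (simp add: B_def)
  have a0: "a r = v"
  proof -
    have "(\<integral>x. indicator (hcube z r) x * V x \<partial>lborel) = (\<integral>x. indicator (hcube z r) x * v \<partial>lborel)"
      using in_ by (intro Bochner_Integration.integral_cong) (auto simp: indicator_def)
    also have "\<dots> = r ^ n * v" using r0 by (simp add: measure_hcube n_def)
    finally show ?thesis using r0 by (simp add: a_def)
  qed
  have aq: "a (2 ^ q * r) \<le> v / 2" using out r0 by (simp add: a_def divide_le_eq)
  have step: "\<bar>a (2 * (2 ^ j * r)) - a (2 ^ j * r)\<bar> \<le> sqrt B * sqrt (1/2) ^ j" if j: "j < q" for j
  proof -
    let ?w = "2 ^ j * r"
    have w0: "0 < ?w" using r0 by simp
    have "2 * 2 ^ j \<le> (2::real) ^ q" using j by (metis Suc_leI one_le_numeral power_Suc power_increasing)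
    then have sub: "hcube z (2 * ?w) \<subseteq> hcube z (2 ^ q * r)"
      using r0 mult_right_mono[of "2 * 2 ^ j" "2 ^ q" r] unfolding hcube_def
      by (auto simp: mult.assoc intro: less_le_trans)
    have "(a (2 * ?w) - a ?w)\<^sup>2 \<le> real n * 2 ^ n * ?w\<^sup>2 / ?w ^ n * E"
      unfolding E_def a_def n_def
      by (rule doubling_step[where m = "2 ^ j * m"]) (use V l m r n sub in \<open>auto simp: n_def bounded_hcube\<close>)
    also have "\<dots> = B * ((2 ^ j)\<^sup>2 / (2 ^ j) ^ n)"
      using r0 by (simp add: B_def power_mult_distrib field_simps)
    \<comment> \<open>For \<open>n >= 3\<close> the bound for the cube of side
      \<open>2 ^ j * r\<close> decays like \<open>2 ^ -j\<close>; for \<open>n = 2\<close> it would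
      not decay.\<close>
    also have "\<dots> \<le> B * (1 / 2 ^ j)"
    proof (rule mult_left_mono[OF _ B0])
      have "(2 ^ j) ^ 3 \<le> ((2::real) ^ j) ^ n" using n by (intro power_increasing) auto
      then show "(2 ^ j)\<^sup>2 / (2 ^ j) ^ n \<le> 1 / (2::real) ^ j"
        by (simp add: divide_le_eq le_divide_eq power2_eq_square power3_eq_cube)
    qed
    also have "\<dots> = (sqrt B * sqrt (1/2) ^ j)\<^sup>2"
    proof -
      have "(sqrt (1/2) ^ j)\<^sup>2 = ((sqrt (1/2))\<^sup>2) ^ j" by (metis power_mult mult.commute)
      also have "\<dots> = 1 / 2 ^ j" by (simp add: power_divide)
      finally show ?thesis using B0 by (simp add: power_mult_distrib)
    qed
    finally have "\<bar>a (2 * ?w) - a ?w\<bar> \<le> \<bar>sqrt B * sqrt (1/2) ^ j\<bar>"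
      by (simp only: abs_le_square_iff)
    then show ?thesis using B0 by simp
  qed
  have "a r - a (2 ^ q' * r) \<le> (\<Sum>j<q'. sqrt B * sqrt (1/2) ^ j)" if "q' \<le> q" for q'
    using that
  proof (induction q')
    case (Suc q')
    have "2 ^ Suc q' * r = 2 * (2 ^ q' * r)" by simp
    then show ?case using Suc step[of q'] by (simp only:) (simp add: abs_le_iff)
  qed simp
  \<comment> \<open>The average falls from \<open>v\<close> to at most \<open>v / 2\<close> in steps
    that add up to at most \<open>4 * sqrt B\<close>. Hence \<open>v <= 8 * sqrt B\<close>, which is
    the origin of the factor \<open>64\<close>.\<close>
  from this[of q] have "v / 2 \<le> sqrt B * (\<Sum>j<q. sqrt (1/2) ^ j)"
    using a0 aq by (simp add: sum_distrib_left)
  also have "\<dots> \<le> sqrt B * 4" using B0 by (intro mult_left_mono sum_sqrt_half_le) auto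
  finally have "v \<le> 8 * sqrt B" by simp
  then have "v\<^sup>2 \<le> (8 * sqrt B)\<^sup>2" using v by (rule power_mono)
  also have "\<dots> = 64 * B" using B0 by (simp add: power_mult_distrib)
  finally have "v\<^sup>2 * r ^ n \<le> 64 * B * r ^ n" using r0 by (intro mult_right_mono) auto
  also have "\<dots> = 64 * real n * 2 ^ n * r\<^sup>2 * E" using r0 by (simp add: B_def field_simps)
  finally show ?thesis by (simp add: E_def)
qed

subsection \<open>Almost orthogonality of scales\<close>

definition supp_in :: "real \<Rightarrow> (real ^ 'n \<Rightarrow> real) \<Rightarrow> bool" where
  "supp_in b f \<longleftrightarrow> continuous_on UNIV f \<and> (\<forall>x. (\<exists>j. b < \<bar>x $ j\<bar>) \<longrightarrow> f x = 0)"

definition sbox :: "real \<Rightarrow> (real ^ 'n) set" where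
  "sbox b = cbox (\<chi> j. - b) (\<chi> j. b)"

lemma mem_sbox: "x \<in> sbox b \<longleftrightarrow> (\<forall>j. \<bar>x $ j\<bar> \<le> b)"
  by (auto simp: sbox_def mem_box_cart abs_le_iff minus_le_iff)

lemma sbox_borel: "sbox b \<in> sets borel" and bounded_sbox: "bounded (sbox b)"
  by (auto simp: sbox_def)

lemma measure_sbox: "0 \<le> b \<Longrightarrow> measure lborel (sbox b :: (real ^ 'n) set) = (2 * b) ^ CARD('n)"
  unfolding sbox_def by (subst content_cbox_cart) (auto simp: interval_ne_empty_cart)

lemma supp_in_cont: "supp_in b f \<Longrightarrow> continuous_on UNIV f"
  by (simp add: supp_in_def)

lemma supp_in_indicator:
  assumes "supp_in b f" shows "f x = indicator (sbox b) x * f x"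
proof (cases "x \<in> sbox b")
  case False
  then obtain j where "b < \<bar>x $ j\<bar>" by (auto simp: mem_sbox not_le)
  then show ?thesis using assms by (auto simp: supp_in_def)
qed simp

lemma supp_in_integrable:
  assumes "supp_in b f" shows "integrable lborel f"
proof -
  have "(\<lambda>x. indicator (sbox b) x * f x) = f"
    using supp_in_indicator[OF assms] by auto
  then show ?thesis
    using integrable_cont_on_bounded[OF supp_in_cont[OF assms] sbox_borel[of b] bounded_sbox[of b]] by simp
qed

lemma supp_in_mult:
  assumes "supp_in b f" "continuous_on UNIV g"
  shows "supp_in b (\<lambda>x. f x * g x)"
  using assms by (auto simp: supp_in_def intro!: continuous_intros)

lemma supp_in_cmult: "supp_in b f \<Longrightarrow> supp_in b (\<lambda>x. c * f x)"
  by (auto simp: supp_in_def intro!: continuous_intros)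

lemma supp_in_mono: "supp_in b f \<Longrightarrow> b \<le> c \<Longrightarrow> supp_in c f"
  unfolding supp_in_def by (meson order.strict_trans1)

lemma supp_in_sum: "(\<And>i. i \<in> A \<Longrightarrow> supp_in b (f i)) \<Longrightarrow> supp_in b (\<lambda>x. \<Sum>i\<in>A. f i x)"
  unfolding supp_in_def by (intro conjI continuous_intros allI impI sum.neutral ballI) blast+

lemma supp_in_diff: "supp_in b f \<Longrightarrow> supp_in b g \<Longrightarrow> supp_in b (\<lambda>x. f x - g x)"
  unfolding supp_in_def by (auto intro!: continuous_intros)

lemma supp_in_shift:
  fixes f :: "real ^ 'n \<Rightarrow> real"
  assumes f: "supp_in b f" and t: "\<bar>t\<bar> \<le> c"
  shows "supp_in (b + c) (\<lambda>x. f (x + t *\<^sub>R axis j 1))"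
  unfolding supp_in_def
proof (intro conjI allI impI)
  show "continuous_on UNIV (\<lambda>x. f (x + t *\<^sub>R axis j 1))"
    by (intro continuous_on_shift supp_in_cont[OF f])
  fix x :: "real ^ 'n" assume "\<exists>i. b + c < \<bar>x $ i\<bar>"
  then obtain i where i: "b + c < \<bar>x $ i\<bar>" by blast
  have "\<bar>x $ i\<bar> \<le> \<bar>(x + t *\<^sub>R axis j 1) $ i\<bar> + c" using t by (auto simp: axis_def)
  with i have "b < \<bar>(x + t *\<^sub>R axis j 1) $ i\<bar>" by linarith
  then show "f (x + t *\<^sub>R axis j 1) = 0" using f unfolding supp_in_def by blast
qed

lemma supp_in_dq:
  fixes f :: "real ^ 'n \<Rightarrow> real"
  assumes f: "supp_in b f" and l: "\<bar>l\<bar> \<le> c"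
  shows "supp_in (b + c) (dq l j f)"
proof -
  have "supp_in (b + c) (\<lambda>x. (1 / l) * (f (x + l *\<^sub>R axis j 1) - f x))"
    using l by (intro supp_in_cmult supp_in_diff supp_in_shift f supp_in_mono[OF f]) auto
  moreover have "dq l j f = (\<lambda>x. (1 / l) * (f (x + l *\<^sub>R axis j 1) - f x))"
    by (simp add: dq_def fun_eq_iff)
  ultimately show ?thesis by simp
qed

lemma integral_dq_eq_0:
  assumes f: "supp_in b f" shows "(\<integral>x. dq l j f x \<partial>lborel) = 0"
proof -
  have i: "integrable lborel f" by (rule supp_in_integrable[OF f])
  have "(\<integral>x. dq l j f x \<partial>lborel) = ((\<integral>x. f (x + l *\<^sub>R axis j 1) \<partial>lborel) - (\<integral>x. f x \<partial>lborel)) / l"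
    unfolding dq_def by (simp add: i integrable_lborel_shift)
  then show ?thesis using i by (simp add: integral_lborel_shift)
qed

lemma integral_mult_shift:
  fixes f g :: "real ^ 'n \<Rightarrow> real"
  assumes "continuous_on UNIV f" "continuous_on UNIV g"
  shows "(\<integral>x. f x * g (x + a) \<partial>lborel) = (\<integral>x. f (x - a) * g x \<partial>lborel)"
proof -
  have "continuous_on UNIV (\<lambda>x. f (x - a) * g x)"
    using assms continuous_on_shift[OF assms(1), of "- a"] by (auto intro!: continuous_intros)
  then have "(\<lambda>x. f (x - a) * g x) \<in> borel_measurable borel"
    by (rule borel_measurable_continuous_onI)
  from integral_lborel_shift[OF this, of a] show ?thesis by simp
qed

text \<open>The adjoint of averaging forwards. A quotient of step \<open>Q * lam\<close> is the
  average of \<open>Q\<close> quotients of step \<open>lam\<close> (\<open>dq_eq_average\<close>);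
  moving that average to the other factor of an integral leaves the same function
  \<open>dq lam j h\<close> for all levels.\<close>

definition smear :: "real \<Rightarrow> nat \<Rightarrow> 'n \<Rightarrow> (real ^ 'n \<Rightarrow> real) \<Rightarrow> real ^ 'n \<Rightarrow> real" where
  "smear lam Q j f x = (\<Sum>t<Q. f (x - (real t * lam) *\<^sub>R axis j 1)) / real Q"

lemma abs_average_le:
  fixes f :: "nat \<Rightarrow> real" shows "\<bar>(\<Sum>t<Q. f t) / real Q\<bar> \<le> (\<Sum>t<Q. \<bar>f t\<bar>) / real Q"
  by (simp add: abs_divide divide_right_mono sum_abs)

lemma supp_in_smear:
  fixes f :: "real ^ 'n \<Rightarrow> real"
  assumes f: "supp_in b f" and lam: "0 \<le> lam" and c: "real Q * lam \<le> c"
  shows "supp_in (b + c) (smear lam Q j f)"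
proof -
  have "supp_in (b + c) (\<lambda>x. (1 / real Q) * (\<Sum>t<Q. f (x + (- (real t * lam)) *\<^sub>R axis j 1)))"
  proof (intro supp_in_cmult supp_in_sum supp_in_shift f)
    fix t assume "t \<in> {..<Q}"
    then have "real t * lam \<le> real Q * lam" using lam by (intro mult_right_mono) auto
    then show "\<bar>- (real t * lam)\<bar> \<le> c" using c lam by simp
  qed
  then show ?thesis by (simp add: smear_def[abs_def])
qed

lemma integral_smear_mult:
  fixes f g :: "real ^ 'n \<Rightarrow> real"
  assumes f: "supp_in b f" and g: "continuous_on UNIV g"
  shows "(\<integral>x. smear lam Q j f x * g x \<partial>lborel)
     = (\<Sum>t<Q. \<integral>x. f x * g (x + (real t * lam) *\<^sub>R axis j 1) \<partial>lborel) / real Q"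
proof -
  have i: "integrable lborel (\<lambda>x. f (x - (real t * lam) *\<^sub>R axis j 1) * g x)" for t
    using supp_in_integrable[OF supp_in_mult[OF supp_in_shift[OF f order_refl, of "- (real t * lam)" j] g]] by simp
  have "(\<integral>x. smear lam Q j f x * g x \<partial>lborel)
     = (\<integral>x. (\<Sum>t<Q. f (x - (real t * lam) *\<^sub>R axis j 1) * g x) / real Q \<partial>lborel)"
    by (simp add: smear_def sum_distrib_right)
  also have "\<dots> = (\<Sum>t<Q. \<integral>x. f (x - (real t * lam) *\<^sub>R axis j 1) * g x \<partial>lborel) / real Q"
    using i by simp
  finally show ?thesis
    by (simp add: integral_mult_shift[OF supp_in_cont[OF f] g])
qed

lemma dq_eq_average:
  assumes "0 < lam" "0 < Q"
  shows "dq (real Q * lam) j h x = (\<Sum>t<Q. dq lam j h (x + (real t * lam) *\<^sub>R axis j 1)) / real Q"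
  using dq_telescope[of lam h x Q j] assms by (simp add: dq_def[of "real Q * lam"])

lemma integral_dq_mult_eq_smear:
  fixes f h :: "real ^ 'n \<Rightarrow> real"
  assumes f: "supp_in b f" and h: "continuous_on UNIV h" and "0 < lam" "0 < Q"
  shows "(\<integral>x. f x * dq (real Q * lam) j h x \<partial>lborel) = (\<integral>x. smear lam Q j f x * dq lam j h x \<partial>lborel)"
proof -
  have i: "integrable lborel (\<lambda>x. f x * dq lam j h (x + (real t * lam) *\<^sub>R axis j 1))" for t
    by (rule supp_in_integrable[OF supp_in_mult[OF f continuous_on_shift[OF continuous_on_dq[OF h]]]])
  have "(\<integral>x. f x * dq (real Q * lam) j h x \<partial>lborel)
     = (\<integral>x. (\<Sum>t<Q. f x * dq lam j h (x + (real t * lam) *\<^sub>R axis j 1)) / real Q \<partial>lborel)"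
    by (simp add: dq_eq_average assms sum_distrib_left)
  also have "\<dots> = (\<Sum>t<Q. \<integral>x. f x * dq lam j h (x + (real t * lam) *\<^sub>R axis j 1) \<partial>lborel) / real Q"
    using i by simp
  also have "\<dots> = (\<integral>x. smear lam Q j f x * dq lam j h x \<partial>lborel)"
    by (rule integral_smear_mult[OF f continuous_on_dq[OF h], symmetric])
  finally show ?thesis .
qed

text \<open>Convexity of the square and translation invariance of the integral.\<close>

lemma integral_smear_sq_le:
  fixes f :: "real ^ 'n \<Rightarrow> real"
  assumes f: "supp_in b f" and lam: "0 \<le> lam"
  shows "(\<integral>x. (smear lam Q j f x)\<^sup>2 \<partial>lborel) \<le> (\<integral>x. (f x)\<^sup>2 \<partial>lborel)"
proof (cases "Q = 0")
  case True
  then show ?thesis by (simp add: smear_def)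
next
  case False
  have f2: "supp_in b (\<lambda>x. (f x)\<^sup>2)" using supp_in_mult[OF f supp_in_cont[OF f]] by (simp add: power2_eq_square)
  have i: "integrable lborel (\<lambda>x. (f (x - a))\<^sup>2)" for a
    using integrable_lborel_shift[OF supp_in_integrable[OF f2], of "-a"] by simp
  have s: "(\<integral>x. (f (x - a))\<^sup>2 \<partial>lborel) = (\<integral>x. (f x)\<^sup>2 \<partial>lborel)" for a
    using integral_lborel_shift[of "\<lambda>x. (f x)\<^sup>2" "-a"] supp_in_integrable[OF f2] by simp
  have "(\<integral>x. (smear lam Q j f x)\<^sup>2 \<partial>lborel) \<le> (\<integral>x. (\<Sum>t<Q. (f (x - (real t * lam) *\<^sub>R axis j 1))\<^sup>2) / real Q \<partial>lborel)"
  proof (rule integral_mono)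
    have sm: "supp_in (b + real Q * lam) (smear lam Q j f)"
      by (rule supp_in_smear[OF f lam]) simp
    show "integrable lborel (\<lambda>x. (smear lam Q j f x)\<^sup>2)"
      using supp_in_integrable[OF supp_in_mult[OF sm supp_in_cont[OF sm]]] by (simp add: power2_eq_square)
    show "integrable lborel (\<lambda>x. (\<Sum>t<Q. (f (x - (real t * lam) *\<^sub>R axis j 1))\<^sup>2) / real Q)"
      using i by simp
    fix x
    have "(\<Sum>t<Q. f (x - (real t * lam) *\<^sub>R axis j 1))\<^sup>2 \<le> (\<Sum>t<Q. (f (x - (real t * lam) *\<^sub>R axis j 1))\<^sup>2) * real Q"
      using sum_squared_le_sum_of_squares[of "\<lambda>t. f (x - (real t * lam) *\<^sub>R axis j 1)" "{..<Q}"] by simp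
    then show "(smear lam Q j f x)\<^sup>2 \<le> (\<Sum>t<Q. (f (x - (real t * lam) *\<^sub>R axis j 1))\<^sup>2) / real Q"
      using False by (simp add: smear_def power_divide power2_eq_square divide_le_eq field_simps)
  qed
  also have "\<dots> = (\<integral>x. (f x)\<^sup>2 \<partial>lborel)" using i s False by simp
  finally show ?thesis .
qed

text \<open>Discrete integration by parts: the amplitude of the fine function is compared with the
  scale on which the coarse one varies.\<close>

lemma smear_cross_bound:
  fixes F G :: "real ^ 'n \<Rightarrow> real"
  assumes F: "supp_in b F" and G: "supp_in b G" and b: "0 \<le> b" and lam: "0 < lam"
    and l: "0 < l" and l': "0 < l'" and Q: "0 < Q" and Q': "0 < Q'"
    and FL: "\<And>x t. \<bar>F (x + t *\<^sub>R axis j 1) - F x\<bar> \<le> K * \<bar>t\<bar>"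
    and GR: "\<And>x. \<bar>G x\<bar> \<le> R"
  shows "\<bar>\<integral>x. smear lam Q j (dq l j F) x * smear lam Q' j (dq l' j G) x \<partial>lborel\<bar> \<le> 2 * K / l * R * (2 * b) ^ CARD('n)"
proof -
  let ?e = "axis j (1::real) :: real ^ 'n"
  define \<psi> where "\<psi> = smear lam Q j (dq l j F)"
  have R0: "0 \<le> R" using GR[of 0] by linarith
  have K0: "0 \<le> K" using FL[of 0 1] by simp
  \<comment> \<open>A quotient of step \<open>l\<close> of a function with constant \<open>K\<close>
    along the axis has constant \<open>2 * K / l\<close> along it, and averaging keeps this
    constant.\<close>
  have \<phi>L: "\<bar>dq l j F (x + s *\<^sub>R ?e) - dq l j F x\<bar> \<le> 2 * K / l * \<bar>s\<bar>" for x s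
  proof -
    have "dq l j F (x + s *\<^sub>R ?e) - dq l j F x
      = ((F ((x + l *\<^sub>R ?e) + s *\<^sub>R ?e) - F (x + l *\<^sub>R ?e)) - (F (x + s *\<^sub>R ?e) - F x)) / l"
      by (simp add: dq_def diff_divide_distrib add.assoc add.commute add.left_commute)
    then have "\<bar>dq l j F (x + s *\<^sub>R ?e) - dq l j F x\<bar> * l
       = \<bar>(F ((x + l *\<^sub>R ?e) + s *\<^sub>R ?e) - F (x + l *\<^sub>R ?e)) - (F (x + s *\<^sub>R ?e) - F x)\<bar>"
      using l by (simp add: abs_divide)
    also have "\<dots> \<le> K * \<bar>s\<bar> + K * \<bar>s\<bar>"
      using FL[of "x + l *\<^sub>R ?e" s] FL[of x s] by linarith
    finally show ?thesis using l by (simp add: field_simps)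
  qed
  have \<psi>L: "\<bar>\<psi> (x + s *\<^sub>R ?e) - \<psi> x\<bar> \<le> 2 * K / l * \<bar>s\<bar>" for x s
  proof -
    have "\<psi> (x + s *\<^sub>R ?e) - \<psi> x
      = (\<Sum>t<Q. dq l j F ((x - (real t * lam) *\<^sub>R ?e) + s *\<^sub>R ?e) - dq l j F (x - (real t * lam) *\<^sub>R ?e)) / real Q"
      by (simp add: \<psi>_def smear_def sum_subtractf diff_divide_distrib algebra_simps)
    then have "\<bar>\<psi> (x + s *\<^sub>R ?e) - \<psi> x\<bar>
      = \<bar>(\<Sum>t<Q. dq l j F ((x - (real t * lam) *\<^sub>R ?e) + s *\<^sub>R ?e) - dq l j F (x - (real t * lam) *\<^sub>R ?e)) / real Q\<bar>"
      by (rule arg_cong)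
    also have "\<dots> \<le> (\<Sum>t<Q. \<bar>dq l j F ((x - (real t * lam) *\<^sub>R ?e) + s *\<^sub>R ?e) - dq l j F (x - (real t * lam) *\<^sub>R ?e)\<bar>) / real Q"
      by (rule abs_average_le)
    also have "\<dots> \<le> (\<Sum>t<Q. 2 * K / l * \<bar>s\<bar>) / real Q"
      by (intro divide_right_mono sum_mono \<phi>L) auto
    also have "\<dots> = 2 * K / l * \<bar>s\<bar>" using Q by simp
    finally show ?thesis .
  qed
  have dF: "supp_in (b + l) (dq l j F)" using l by (intro supp_in_dq F) simp
  have \<psi>s: "supp_in (b + l + real Q * lam) \<psi>" unfolding \<psi>_def
    using lam by (intro supp_in_smear dF) auto
  have \<psi>c: "continuous_on UNIV \<psi>" by (rule supp_in_cont[OF \<psi>s])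
  have dG: "supp_in (b + l') (dq l' j G)" using l' by (intro supp_in_dq G) simp
  \<comment> \<open>The difference is moved from \<open>G\<close> to the smeared factor. Its
    constant along the axis bounds the quotient, and of \<open>G\<close> only the bound
    \<open>R\<close> and the support are used.\<close>
  have one: "\<bar>\<integral>x. dq l' j G x * \<psi> (x + a) \<partial>lborel\<bar> \<le> 2 * K / l * R * (2 * b) ^ CARD('n)" for a
  proof -
    define \<chi>' where "\<chi>' = (\<lambda>x. \<psi> (x + a))"
    have c: "continuous_on UNIV \<chi>'" unfolding \<chi>'_def by (rule continuous_on_shift[OF \<psi>c])
    have c': "continuous_on UNIV (\<lambda>x. \<chi>' (x - b))" for b
      using continuous_on_shift[OF c, of "-b"] by simp
    have G1: "integrable lborel (\<lambda>x. G (x + a) * \<chi>' x)" for a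
    proof -
      have "integrable lborel (\<lambda>x. G x * \<chi>' (x - a))"
        by (rule supp_in_integrable[OF supp_in_mult[OF G c']])
      from integrable_lborel_shift[OF this, of a] show ?thesis by simp
    qed
    have G2: "integrable lborel (\<lambda>x. G x * \<chi>' (x - a))" for a
      by (rule supp_in_integrable[OF supp_in_mult[OF G c']])
    have G3: "integrable lborel (\<lambda>x. G x * \<chi>' x)" using G1[of 0] by simp
    have "(\<integral>x. dq l' j G x * \<chi>' x \<partial>lborel) = (\<integral>x. (G (x + l' *\<^sub>R ?e) * \<chi>' x - G x * \<chi>' x) / l' \<partial>lborel)"
      by (simp add: dq_def algebra_simps)
    also have "\<dots> = ((\<integral>x. G (x + l' *\<^sub>R ?e) * \<chi>' x \<partial>lborel) - (\<integral>x. G x * \<chi>' x \<partial>lborel)) / l'"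
      using G1 G3 by simp
    also have "(\<integral>x. G (x + l' *\<^sub>R ?e) * \<chi>' x \<partial>lborel) = (\<integral>x. G x * \<chi>' (x - l' *\<^sub>R ?e) \<partial>lborel)"
      using integral_mult_shift[OF c supp_in_cont[OF G], of "l' *\<^sub>R ?e"] by (simp add: mult.commute)
    also have "((\<integral>x. G x * \<chi>' (x - l' *\<^sub>R ?e) \<partial>lborel) - (\<integral>x. G x * \<chi>' x \<partial>lborel)) / l'
       = (\<integral>x. G x * ((\<chi>' (x - l' *\<^sub>R ?e) - \<chi>' x) / l') \<partial>lborel)"
      using G2 G3 by (simp add: right_diff_distrib diff_divide_distrib)
    finally have "\<bar>\<integral>x. dq l' j G x * \<chi>' x \<partial>lborel\<bar> = \<bar>\<integral>x. G x * ((\<chi>' (x - l' *\<^sub>R ?e) - \<chi>' x) / l') \<partial>lborel\<bar>" by simp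
    also have "\<dots> \<le> (\<integral>x. \<bar>G x * ((\<chi>' (x - l' *\<^sub>R ?e) - \<chi>' x) / l')\<bar> \<partial>lborel)"
      by (rule integral_abs_bound)
    also have "\<dots> \<le> (\<integral>x. indicator (sbox b :: (real ^ 'n) set) x * (2 * K / l * R) \<partial>lborel)"
    proof (rule integral_mono)
      show "integrable lborel (\<lambda>x. \<bar>G x * ((\<chi>' (x - l' *\<^sub>R ?e) - \<chi>' x) / l')\<bar>)"
        using G2 G3 by (intro integrable_abs) (simp add: right_diff_distrib diff_divide_distrib)
      show "integrable lborel (\<lambda>x. indicator (sbox b :: (real ^ 'n) set) x * (2 * K / l * R))"
        by (intro integrable_cont_on_bounded sbox_borel bounded_sbox continuous_intros)
      fix x :: "real ^ 'n"
      have "\<chi>' (x - l' *\<^sub>R ?e) - \<chi>' x = \<psi> ((x + a) + (- l') *\<^sub>R ?e) - \<psi> (x + a)"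
        by (simp add: \<chi>'_def algebra_simps)
      then have "\<bar>\<chi>' (x - l' *\<^sub>R ?e) - \<chi>' x\<bar> \<le> 2 * K / l * l'"
        using \<psi>L[of "x + a" "- l'"] l' by simp
      then have 1: "\<bar>(\<chi>' (x - l' *\<^sub>R ?e) - \<chi>' x) / l'\<bar> \<le> 2 * K / l"
        using l' by (simp add: abs_divide divide_le_eq)
      have "\<bar>G x * ((\<chi>' (x - l' *\<^sub>R ?e) - \<chi>' x) / l')\<bar> \<le> \<bar>G x\<bar> * (2 * K / l)"
        unfolding abs_mult by (intro mult_left_mono 1) auto
      also have "\<dots> \<le> indicator (sbox b) x * (2 * K / l * R)"
      proof (cases "x \<in> sbox b")
        case True
        have "\<bar>G x\<bar> * (2 * K / l) \<le> R * (2 * K / l)" using GR K0 l by (intro mult_right_mono) auto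
        then show ?thesis using True by (simp add: mult.commute)
      next
        case False
        then show ?thesis using supp_in_indicator[OF G, of x] by simp
      qed
      finally show "\<bar>G x * ((\<chi>' (x - l' *\<^sub>R ?e) - \<chi>' x) / l')\<bar> \<le> indicator (sbox b) x * (2 * K / l * R)" .
    qed
    also have "\<dots> = 2 * K / l * R * (2 * b) ^ CARD('n)"
      using measure_sbox[OF b, where 'n = 'n] by simp
    finally show ?thesis by (simp add: \<chi>'_def)
  qed
  have "(\<integral>x. \<psi> x * smear lam Q' j (dq l' j G) x \<partial>lborel)
     = (\<Sum>t<Q'. \<integral>x. dq l' j G x * \<psi> (x + (real t * lam) *\<^sub>R axis j 1) \<partial>lborel) / real Q'"
    using integral_smear_mult[OF dG \<psi>c, of lam Q' j] by (simp add: mult.commute)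
  then have "\<bar>\<integral>x. \<psi> x * smear lam Q' j (dq l' j G) x \<partial>lborel\<bar>
     = \<bar>(\<Sum>t<Q'. \<integral>x. dq l' j G x * \<psi> (x + (real t * lam) *\<^sub>R axis j 1) \<partial>lborel) / real Q'\<bar>"
    by (rule arg_cong)
  also have "\<dots> \<le> (\<Sum>t<Q'. \<bar>\<integral>x. dq l' j G x * \<psi> (x + (real t * lam) *\<^sub>R axis j 1) \<partial>lborel\<bar>) / real Q'"
    by (rule abs_average_le)
  also have "\<dots> \<le> (\<Sum>t<Q'. 2 * K / l * R * (2 * b) ^ CARD('n)) / real Q'"
    by (intro divide_right_mono sum_mono one) auto
  also have "\<dots> = 2 * K / l * R * (2 * b) ^ CARD('n)" using Q' by simp
  finally show ?thesis by (simp add: \<psi>_def)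
qed

lemma sum_symmetric_le:
  fixes a :: "nat \<Rightarrow> nat \<Rightarrow> real"
  assumes "\<And>i k. a i k = a k i"
  shows "(\<Sum>i<I. \<Sum>k<I. a i k) \<le> (\<Sum>i<I. a i i) + 2 * (\<Sum>k<I. \<Sum>i<k. \<bar>a i k\<bar>)"
proof (induction I)
  case (Suc I)
  have "(\<Sum>i<Suc I. \<Sum>k<Suc I. a i k) = (\<Sum>i<I. \<Sum>k<I. a i k) + (\<Sum>i<I. a i I) + (\<Sum>k<I. a I k) + a I I"
    by (simp add: sum.distrib)
  also have "(\<Sum>k<I. a I k) = (\<Sum>i<I. a i I)" using assms by (intro sum.cong) auto
  also have "(\<Sum>i<I. a i I) \<le> (\<Sum>i<I. \<bar>a i I\<bar>)" by (intro sum_mono) auto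
  finally show ?case using Suc by simp
qed simp

text \<open>The square of \<open>u - S\<close> is expanded, where \<open>u\<close> is the quotient
  of \<open>h\<close> with the common step and \<open>S\<close> the sum of the smeared quotients of
  the \<open>G i\<close>. The mixed term is at least twice the sum of the energies by the assumption
  on \<open>J\<close>, the diagonal of the square of \<open>S\<close> is at most that sum once, and
  its off-diagonal part is small by \<open>smear_cross_bound\<close>.\<close>

lemma bessel_bound:
  fixes G :: "nat \<Rightarrow> real ^ 'n \<Rightarrow> real" and h :: "real ^ 'n \<Rightarrow> real"
  assumes lam: "0 < lam" and l: "\<And>i. i < I \<Longrightarrow> l i = real (Q i) * lam \<and> 0 < Q i \<and> l i \<le> 1"
    and G: "\<And>i. i < I \<Longrightarrow> supp_in b (G i)" and b: "0 \<le> b"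
    and GL: "\<And>i j x t. i < I \<Longrightarrow> \<bar>G i (x + t *\<^sub>R axis j 1) - G i x\<bar> \<le> K * \<bar>t\<bar>"
    and GR: "\<And>i x. i < I \<Longrightarrow> \<bar>G i x\<bar> \<le> R i"
    and h: "continuous_on UNIV h" and hL: "\<And>j x t. \<bar>h (x + t *\<^sub>R axis j 1) - h x\<bar> \<le> H * \<bar>t\<bar>"
  defines "J \<equiv> \<lambda>i. \<Sum>j\<in>UNIV. \<integral>x. (dq (l i) j (G i) x)\<^sup>2 \<partial>lborel"
  assumes J: "\<And>i. i < I \<Longrightarrow> J i \<le> (\<Sum>j\<in>UNIV. \<integral>x. dq (l i) j (G i) x * dq (l i) j h x \<partial>lborel)"
  shows "(\<Sum>i<I. J i) \<le> real CARD('n) * (H\<^sup>2 * (2 * (b + 2)) ^ CARD('n)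
      + 2 * (\<Sum>k<I. \<Sum>i<k. 2 * K / l i * R k * (2 * b) ^ CARD('n)))"
proof -
  let ?N = "real CARD('n)"
  let ?c = "\<lambda>k i. 2 * K / l i * R k * (2 * b) ^ CARD('n)"
  define \<psi> where "\<psi> = (\<lambda>i j. smear lam (Q i) j (dq (l i) j (G i)))"
  define u where "u = (\<lambda>j. dq lam j h)"
  define p where "p = (\<lambda>i j. \<integral>x. \<psi> i j x * u j x \<partial>lborel)"
  have l0: "0 < l i" if "i < I" for i using l[OF that] lam by simp
  have dG: "supp_in (b + 1) (dq (l i) j (G i))" if "i < I" for i j
    using l[OF that] l0[OF that] by (intro supp_in_dq G that) simp
  \<comment> \<open>One unit for the quotient, whose step is at most 1, and one for the averaging,
    over a distance of at most \<open>l i <= 1\<close>.\<close>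
  have \<psi>: "supp_in (b + 2) (\<psi> i j)" if "i < I" for i j
  proof -
    have "supp_in (b + 1 + 1) (\<psi> i j)" unfolding \<psi>_def
      using l[OF that] lam by (intro supp_in_smear dG that) auto
    then show ?thesis by (simp add: add.assoc)
  qed
  have u: "continuous_on UNIV (u j)" for j unfolding u_def by (rule continuous_on_dq[OF h])
  have p: "(\<integral>x. dq (l i) j (G i) x * dq (l i) j h x \<partial>lborel) = p i j" if "i < I" for i j
    using integral_dq_mult_eq_smear[OF dG[OF that] h lam, of "Q i" j j] l[OF that]
    by (simp add: p_def \<psi>_def u_def)
  have main: "2 * (\<Sum>i<I. p i j) \<le> H\<^sup>2 * (2 * (b + 2)) ^ CARD('n)
      + (\<Sum>i<I. \<integral>x. (dq (l i) j (G i) x)\<^sup>2 \<partial>lborel) + 2 * (\<Sum>k<I. \<Sum>i<k. ?c k i)" for j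
  proof -
    let ?B = "sbox (b + 2) :: (real ^ 'n) set"
    let ?a = "\<lambda>i k. \<integral>x. \<psi> i j x * \<psi> k j x \<partial>lborel"
    define S where "S = (\<lambda>x. \<Sum>i<I. \<psi> i j x)"
    have S: "supp_in (b + 2) S" unfolding S_def by (intro supp_in_sum \<psi>) auto
    have i1: "integrable lborel (\<lambda>x. indicator ?B x * (u j x)\<^sup>2)"
      by (intro integrable_cont_on_bounded sbox_borel bounded_sbox continuous_intros u)
    have i2: "integrable lborel (\<lambda>x. S x * u j x)" by (rule supp_in_integrable[OF supp_in_mult[OF S u]])
    have i3: "integrable lborel (\<lambda>x. S x * S x)" by (rule supp_in_integrable[OF supp_in_mult[OF S supp_in_cont[OF S]]])
    \<comment> \<open>The support of \<open>h\<close> need not be bounded, so the square is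
      integrated only over the box that contains the support of \<open>S\<close>.\<close>
    have "0 \<le> (\<integral>x. indicator ?B x * (u j x - S x)\<^sup>2 \<partial>lborel)"
      by (intro integral_nonneg_AE) auto
    also have "\<dots> = (\<integral>x. indicator ?B x * (u j x)\<^sup>2 - 2 * (S x * u j x) + S x * S x \<partial>lborel)"
    proof (rule arg_cong[where f = "integral\<^sup>L lborel"], rule ext)
      fix x show "indicator ?B x * (u j x - S x)\<^sup>2 = indicator ?B x * (u j x)\<^sup>2 - 2 * (S x * u j x) + S x * S x"
        using supp_in_indicator[OF S, of x] by (cases "x \<in> ?B") (auto simp: power2_eq_square algebra_simps)
    qed
    also have "\<dots> = (\<integral>x. indicator ?B x * (u j x)\<^sup>2 \<partial>lborel) - 2 * (\<integral>x. S x * u j x \<partial>lborel) + (\<integral>x. S x * S x \<partial>lborel)"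
      using i1 i2 i3 by simp
    also have "(\<integral>x. S x * u j x \<partial>lborel) = (\<Sum>i<I. p i j)"
      unfolding S_def p_def sum_distrib_right
      by (intro Bochner_Integration.integral_sum supp_in_integrable[OF supp_in_mult[OF \<psi> u]]) auto
    also have "(\<integral>x. S x * S x \<partial>lborel) = (\<Sum>i<I. \<Sum>k<I. ?a i k)"
    proof -
      have i: "integrable lborel (\<lambda>x. \<psi> i j x * \<psi> k j x)" if "i < I" "k < I" for i k
        by (rule supp_in_integrable[OF supp_in_mult[OF \<psi>[OF that(1)] supp_in_cont[OF \<psi>[OF that(2)]]]])
      have "(\<integral>x. S x * S x \<partial>lborel) = (\<integral>x. (\<Sum>i<I. \<Sum>k<I. \<psi> i j x * \<psi> k j x) \<partial>lborel)"
        by (simp add: S_def sum_product)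
      also have "\<dots> = (\<Sum>i<I. \<integral>x. (\<Sum>k<I. \<psi> i j x * \<psi> k j x) \<partial>lborel)"
        by (intro Bochner_Integration.integral_sum Bochner_Integration.integrable_sum i) auto
      also have "\<dots> = (\<Sum>i<I. \<Sum>k<I. ?a i k)"
        by (intro sum.cong refl Bochner_Integration.integral_sum i) auto
      finally show ?thesis .
    qed
    finally have "2 * (\<Sum>i<I. p i j) \<le> (\<integral>x. indicator ?B x * (u j x)\<^sup>2 \<partial>lborel) + (\<Sum>i<I. \<Sum>k<I. ?a i k)" by simp
    also have "(\<integral>x. indicator ?B x * (u j x)\<^sup>2 \<partial>lborel) \<le> (\<integral>x. indicator ?B x * H\<^sup>2 \<partial>lborel)"
    proof (rule integral_mono[OF i1])
      show "integrable lborel (\<lambda>x. indicator ?B x * H\<^sup>2)"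
        by (intro integrable_cont_on_bounded sbox_borel bounded_sbox continuous_intros)
      fix x
      have "\<bar>u j x\<bar> \<le> H" using hL[of x lam j] lam by (simp add: u_def dq_def abs_divide divide_le_eq)
      then have "(u j x)\<^sup>2 \<le> H\<^sup>2" by (metis abs_ge_zero power2_abs power_mono)
      then show "indicator ?B x * (u j x)\<^sup>2 \<le> indicator ?B x * H\<^sup>2" by (intro mult_left_mono) auto
    qed
    also have "(\<integral>x. indicator ?B x * H\<^sup>2 \<partial>lborel) = H\<^sup>2 * (2 * (b + 2)) ^ CARD('n)"
      using measure_sbox[of "b + 2", where 'n = 'n] b by simp
    also have "(\<Sum>i<I. \<Sum>k<I. ?a i k) \<le> (\<Sum>i<I. ?a i i) + 2 * (\<Sum>k<I. \<Sum>i<k. \<bar>?a i k\<bar>)"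
      by (rule sum_symmetric_le) (simp add: mult.commute)
    also have "(\<Sum>i<I. ?a i i) \<le> (\<Sum>i<I. \<integral>x. (dq (l i) j (G i) x)\<^sup>2 \<partial>lborel)"
    proof (rule sum_mono)
      fix i assume "i \<in> {..<I}"
      then have "i < I" by simp
      from integral_smear_sq_le[OF dG[OF this, of j] less_imp_le[OF lam], of "Q i" j]
      show "?a i i \<le> (\<integral>x. (dq (l i) j (G i) x)\<^sup>2 \<partial>lborel)" by (simp add: \<psi>_def power2_eq_square)
    qed
    also have "(\<Sum>k<I. \<Sum>i<k. \<bar>?a i k\<bar>) \<le> (\<Sum>k<I. \<Sum>i<k. ?c k i)"
    proof (intro sum_mono)
      fix k i assume "k \<in> {..<I}" "i \<in> {..<k}"
      then have ik: "i < I" "k < I" by auto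
      show "\<bar>?a i k\<bar> \<le> ?c k i" unfolding \<psi>_def
        using l[OF ik(1)] l[OF ik(2)]
        by (intro smear_cross_bound G ik b lam l0 GL GR) auto
    qed
    finally show ?thesis by simp
  qed
  \<comment> \<open>The energies come back on the right through the diagonal terms, but only once,
    against twice on the left.\<close>
  have "2 * (\<Sum>i<I. J i) \<le> 2 * (\<Sum>i<I. \<Sum>j\<in>UNIV. p i j)"
    using J p by (intro mult_left_mono sum_mono) auto
  also have "\<dots> = (\<Sum>j\<in>UNIV. 2 * (\<Sum>i<I. p i j))"
    by (subst sum.swap) (simp add: sum_distrib_left)
  also have "\<dots> \<le> (\<Sum>j\<in>(UNIV::'n set). H\<^sup>2 * (2 * (b + 2)) ^ CARD('n)
      + (\<Sum>i<I. \<integral>x. (dq (l i) j (G i) x)\<^sup>2 \<partial>lborel) + 2 * (\<Sum>k<I. \<Sum>i<k. ?c k i))"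
    by (intro sum_mono main)
  also have "\<dots> = ?N * (H\<^sup>2 * (2 * (b + 2)) ^ CARD('n)) + (\<Sum>i<I. J i) + ?N * (2 * (\<Sum>k<I. \<Sum>i<k. ?c k i))"
    unfolding J_def sum.distrib by (subst (2) sum.swap) simp
  finally show ?thesis by (simp add: algebra_simps)
qed

subsection \<open>Holes of one scale\<close>

definition clip :: "real \<Rightarrow> real \<Rightarrow> real \<Rightarrow> real" where
  "clip a b t = max a (min b t)"

text \<open>The function \<open>trap r\<close> is supported on \<open>[r, 4 r]\<close> and constant on the heights that \<open>g\<close> can
  take next to a hole of size \<open>r\<close>. For radii decreasing by factors of at least \<open>4\<close> the supports do not overlap.\<close>

definition trap :: "real \<Rightarrow> real \<Rightarrow> real" where
  "trap r t = max 0 (min (r / 2) (min (t - r) (4 * r - t)))"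

text \<open>As \<open>trap r\<close> vanishes at both ends of \<open>[r, 4 * r]\<close> and beyond,
  it is a function of the truncated value, of slope at most 1.\<close>

lemma trap_diff_le:
  assumes "0 \<le> r"
  shows "\<bar>trap r t - trap r t'\<bar> \<le> \<bar>clip r (4 * r) t - clip r (4 * r) t'\<bar>"
  using assms unfolding trap_def clip_def by (auto simp: max_def min_def abs_if)

lemma clip_mono: "t \<le> t' \<Longrightarrow> clip a b t \<le> clip a b t'"
  by (auto simp: clip_def)

text \<open>The intervals \<open>[r k, 4 * r k]\<close> do not overlap, so the parts of the way from
  \<open>t\<close> to \<open>t'\<close> that lie inside them add up to at most the part inside
  \<open>[0, 4 * r 0]\<close>.\<close>

lemma sum_clip_le:
  assumes "\<And>k. 0 \<le> r k" "\<And>k. 4 * r (Suc k) \<le> r k"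
  shows "(\<Sum>k<m. \<bar>clip (r k) (4 * r k) t - clip (r k) (4 * r k) t'\<bar>)
     \<le> \<bar>clip 0 (4 * r 0) t - clip 0 (4 * r 0) t'\<bar>"
proof -
  have main: "(\<Sum>k<m. \<bar>clip (r k) (4 * r k) t - clip (r k) (4 * r k) t'\<bar>)
     \<le> clip 0 (4 * r 0) t' - clip 0 (4 * r 0) t"
    if "t \<le> t'" "\<And>k. 0 \<le> r k" "\<And>k. 4 * r (Suc k) \<le> r k" for t t' and r :: "nat \<Rightarrow> real"
    using that(2,3)
  proof (induction m arbitrary: r)
    case 0
    then show ?case using clip_mono[OF that(1)] by simp
  next
    case (Suc m)
    have "(\<Sum>k<Suc m. \<bar>clip (r k) (4 * r k) t - clip (r k) (4 * r k) t'\<bar>)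
      = \<bar>clip (r 0) (4 * r 0) t - clip (r 0) (4 * r 0) t'\<bar>
        + (\<Sum>k<m. \<bar>clip (r (Suc k)) (4 * r (Suc k)) t - clip (r (Suc k)) (4 * r (Suc k)) t'\<bar>)"
      by (rule sum.lessThan_Suc_shift)
    also have "\<dots> \<le> \<bar>clip (r 0) (4 * r 0) t - clip (r 0) (4 * r 0) t'\<bar>
        + (clip 0 (4 * r (Suc 0)) t' - clip 0 (4 * r (Suc 0)) t)"
      using Suc.IH[of "\<lambda>k. r (Suc k)"] Suc.prems by simp
    also have "\<bar>clip (r 0) (4 * r 0) t - clip (r 0) (4 * r 0) t'\<bar>
        = clip (r 0) (4 * r 0) t' - clip (r 0) (4 * r 0) t"
      using clip_mono[OF that(1), of "r 0" "4 * r 0"] by simp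
    also have "clip 0 (4 * r (Suc 0)) t' - clip 0 (4 * r (Suc 0)) t \<le> clip 0 (r 0) t' - clip 0 (r 0) t"
      using that(1) Suc.prems(1)[of 0] Suc.prems(1)[of "Suc 0"] Suc.prems(2)[of 0]
      by (auto simp: clip_def max_def min_def)
    also have "clip (r 0) (4 * r 0) t' - clip (r 0) (4 * r 0) t + (clip 0 (r 0) t' - clip 0 (r 0) t)
        = clip 0 (4 * r 0) t' - clip 0 (4 * r 0) t"
      using Suc.prems(1)[of 0] by (auto simp: clip_def max_def min_def)
    finally show ?case by simp
  qed
  show ?thesis
  proof (cases "t \<le> t'")
    case True
    with main[of t t' r, OF True assms] clip_mono[OF True, of 0 "4 * r 0"] show ?thesis by (simp add: abs_minus_commute)
  next
    case False
    then have t: "t' \<le> t" by simp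
    with main[of t' t r, OF t assms] clip_mono[OF t, of 0 "4 * r 0"] show ?thesis by (simp add: abs_minus_commute)
  qed
qed

lemma sum_squares_le_square_sum:
  fixes f :: "'b \<Rightarrow> real"
  assumes "finite A" "\<And>x. x \<in> A \<Longrightarrow> 0 \<le> f x"
  shows "(\<Sum>x\<in>A. (f x)\<^sup>2) \<le> (\<Sum>x\<in>A. f x)\<^sup>2"
  using assms
proof (induction A)
  case (insert a A)
  then have "0 \<le> f a * (\<Sum>x\<in>A. f x)" by (intro mult_nonneg_nonneg sum_nonneg) auto
  then show ?case using insert by (simp add: power2_eq_square algebra_simps)
qed simp

text \<open>At each height at most one term is nonzero, and \<open>2 / r\<close> normalises the
  plateau of \<open>trap r\<close> to 1. Consequently the volume terms of all scales of a level
  together cost no more than the area of the unit cube.\<close>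

lemma sum_trap_le:
  assumes r: "\<And>k. 0 < r k" "\<And>k. 4 * r (Suc k) \<le> r k"
  shows "(\<Sum>k<m. 2 / r k * trap (r k) t) \<le> 1"
proof -
  have dec: "4 * r k' \<le> r k" if "k < k'" for k k'
    using that
  proof (induction k')
    case (Suc k')
    show ?case
    proof (cases "k = k'")
      case False
      then have "4 * r k' \<le> r k" using Suc by simp
      moreover have "r (Suc k') \<le> r k'" using r(1)[of "Suc k'"] r(2)[of k'] by linarith
      ultimately show ?thesis by linarith
    qed (use r in simp)
  qed simp
  have le: "2 / r k * trap (r k) t \<le> 1" for k
    using r(1)[of k] by (auto simp: trap_def max_def min_def field_simps)
  have pos: "r k < t \<and> t < 4 * r k" if "trap (r k) t \<noteq> 0" for k
    using that r(1)[of k] by (auto simp: trap_def max_def min_def split: if_splits)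
  show ?thesis
  proof (cases "\<exists>k<m. trap (r k) t \<noteq> 0")
    case True
    then obtain k where k: "k < m" "trap (r k) t \<noteq> 0" by blast
    have "trap (r k') t = 0" if "k' \<noteq> k" for k'
    proof (rule ccontr)
      assume "trap (r k') t \<noteq> 0"
      from pos[OF this] pos[OF k(2)] have "r k < 4 * r k'" "r k' < 4 * r k" by linarith+
      then show False using dec[of k k'] dec[of k' k] that by (meson leD linorder_neqE_nat)
    qed
    then have "(\<Sum>k<m. 2 / r k * trap (r k) t) = 2 / r k * trap (r k) t"
      using k by (subst sum.remove[of _ k]) (auto intro!: sum.neutral)
    then show ?thesis using le by simp
  next
    case False
    then show ?thesis by (simp add: sum.neutral)
  qed
qed

lemma trap_nonneg: "0 \<le> trap r t" by (simp add: trap_def)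

section \<open>Grids of half-open cubes\<close>

definition gridpt :: "real \<Rightarrow> ('n \<Rightarrow> nat) \<Rightarrow> real ^ 'n" where
  "gridpt s c = (\<chi> j. s * real (c j))"

lemma grid_eq_PiE: "{c :: 'n::finite \<Rightarrow> nat. \<forall>j. c j < M} = PiE UNIV (\<lambda>_. {..<M})"
  by (auto simp: PiE_def)

lemma finite_grid: "finite {c :: 'n::finite \<Rightarrow> nat. \<forall>j. c j < M}"
  by (simp add: grid_eq_PiE finite_PiE)

lemma card_grid: "card {c :: 'n::finite \<Rightarrow> nat. \<forall>j. c j < M} = M ^ CARD('n)"
  by (simp add: grid_eq_PiE card_PiE)

lemma sum_grid_indicator_le:
  fixes x :: "real ^ 'n"
  assumes s: "0 < s" "s * real M = 1"
  shows "(\<Sum>c | \<forall>j. c j < M. indicator (hcube (gridpt s c) s) x) \<le> (indicator (hcube 0 1) x :: real)"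
proof -
  let ?I = "{c :: 'n \<Rightarrow> nat. \<forall>j. c j < M}"
  define c0 where "c0 = (\<lambda>j. nat \<lfloor>x $ j / s\<rfloor>)"
  have un: "c = c0 \<and> x \<in> hcube 0 1" if c: "c \<in> ?I" "x \<in> hcube (gridpt s c) s" for c
  proof -
    have b: "s * real (c j) \<le> x $ j" "x $ j < s * real (c j) + s" for j
      using c by (auto simp: hcube_def gridpt_def)
    have "\<lfloor>x $ j / s\<rfloor> = int (c j)" for j
      using b[of j] s by (intro floor_unique) (auto simp: field_simps)
    then have "c = c0" by (auto simp: c0_def fun_eq_iff)
    moreover have "0 \<le> x $ j \<and> x $ j < 1" for j
    proof -
      have "c j < M" using c by simp
      then have "real (c j) + 1 \<le> real M" by linarith
      then have "s * (real (c j) + 1) \<le> s * real M" using s by (intro mult_left_mono) auto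
      moreover have "0 \<le> s * real (c j)" using s by simp
      moreover have "s * (real (c j) + 1) = s * real (c j) + s" by (simp add: algebra_simps)
      ultimately show ?thesis using b[of j] s by linarith
    qed
    ultimately show ?thesis by (simp add: hcube_def)
  qed
  have "(\<Sum>c\<in>?I. indicator (hcube (gridpt s c) s) x) \<le> (\<Sum>c\<in>?I. if c = c0 then indicator (hcube 0 1) x else 0 :: real)"
  proof (rule sum_mono)
    fix c assume "c \<in> ?I"
    then show "indicator (hcube (gridpt s c) s) x \<le> (if c = c0 then indicator (hcube 0 1) x else 0 :: real)"
      using un[of c] by (cases "x \<in> hcube (gridpt s c) s") auto
  qed
  also have "\<dots> \<le> indicator (hcube 0 1) x" by (simp add: finite_grid)
  finally show ?thesis .
qed

lemma sum_grid_integral_le: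
  fixes F :: "real ^ 'n \<Rightarrow> real"
  assumes s: "0 < s" "s * real M = 1" and F: "continuous_on UNIV F" "\<And>x. 0 \<le> F x" 
  shows "(\<Sum>c | \<forall>j. c j < M. \<integral>x. indicator (hcube (gridpt s c) s) x * F x \<partial>lborel)
     \<le> (\<integral>x. indicator (hcube 0 1) x * F x \<partial>lborel)"
proof -
  have i: "integrable lborel (\<lambda>x. indicator (hcube z u) x * F x)" for z u
    by (rule integrable_cont_on_bounded[OF F(1) hcube_borel bounded_hcube])
  have "(\<Sum>c | \<forall>j. c j < M. \<integral>x. indicator (hcube (gridpt s c) s) x * F x \<partial>lborel)
     = (\<integral>x. (\<Sum>c | \<forall>j. c j < M. indicator (hcube (gridpt s c) s) x * F x) \<partial>lborel)"
    using i by simp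
  also have "\<dots> \<le> (\<integral>x. indicator (hcube 0 1) x * F x \<partial>lborel)"
  proof (rule integral_mono)
    fix x :: "real ^ 'n"
    show "(\<Sum>c | \<forall>j. c j < M. indicator (hcube (gridpt s c) s) x * F x) \<le> indicator (hcube 0 1) x * F x"
      unfolding sum_distrib_right[symmetric]
      by (intro mult_right_mono sum_grid_indicator_le s F)
  qed (use i in auto)
  finally show ?thesis .
qed

text \<open>With the 1-norm an affine function whose coefficients are bounded by \<epsilon> has
  constant \<epsilon>, and so has a function with slope at most \<epsilon> along each axis; no
  dimensional factor appears.\<close>

definition l1_lipschitz :: "real \<Rightarrow> (real ^ 'n \<Rightarrow> real) \<Rightarrow> bool" where
  "l1_lipschitz K g \<longleftrightarrow> (\<forall>x y. \<bar>g x - g y\<bar> \<le> K * (\<Sum>j\<in>UNIV. \<bar>x $ j - y $ j\<bar>))"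

lemma l1_lipschitz_axis:
  assumes "l1_lipschitz K g"
  shows "\<bar>g (x + t *\<^sub>R axis j 1) - g x\<bar> \<le> K * \<bar>t\<bar>"
proof -
  have "\<bar>g (x + t *\<^sub>R axis j 1) - g x\<bar> \<le> K * (\<Sum>i\<in>UNIV. \<bar>(x + t *\<^sub>R axis j 1) $ i - x $ i\<bar>)"
    using assms by (simp only: l1_lipschitz_def)
  also have "(\<Sum>i\<in>UNIV. \<bar>(x + t *\<^sub>R axis j 1) $ i - x $ i\<bar>) = (\<Sum>i\<in>UNIV. if i = j then \<bar>t\<bar> else 0)"
    by (intro sum.cong) (auto simp: axis_def)
  finally show ?thesis by simp
qed

lemma l1_lipschitz_continuous:
  fixes g :: "real ^ 'n \<Rightarrow> real"
  assumes "l1_lipschitz K g"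
  shows "continuous_on UNIV g"
proof -
  have "\<bar>g x - g y\<bar> \<le> (\<bar>K\<bar> * real CARD('n)) * norm (x - y)" for x y
  proof -
    have "\<bar>g x - g y\<bar> \<le> K * (\<Sum>j\<in>UNIV. \<bar>x $ j - y $ j\<bar>)" using assms by (simp add: l1_lipschitz_def)
    also have "\<dots> \<le> \<bar>K\<bar> * (\<Sum>j\<in>UNIV. \<bar>x $ j - y $ j\<bar>)" by (intro mult_right_mono sum_nonneg) auto
    also have "\<dots> \<le> \<bar>K\<bar> * (\<Sum>j\<in>(UNIV::'n set). norm (x - y))"
      using component_le_norm_cart[of "x - y"] by (intro mult_left_mono sum_mono) auto
    finally show ?thesis by simp
  qed
  then have "(\<bar>K\<bar> * real CARD('n))-lipschitz_on UNIV g"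
    by (intro lipschitz_onI) (auto simp: dist_norm)
  then show ?thesis by (rule lipschitz_on_continuous_on)
qed

lemma hit_cell_bound:
  fixes g :: "real ^ 'n \<Rightarrow> real" and q M :: nat
  defines "n \<equiv> CARD('n)"
  assumes n: "3 \<le> n" and g: "l1_lipschitz K g" and K: "K * (6 * real n) \<le> 1" "0 \<le> K"
    and l: "0 < l" "0 < M" "r = real M * l"
    and y: "\<And>j. z $ j < y $ j \<and> y $ j < z $ j + 3 * r" "2 * r < g y" "g y < 3 * r"
  shows "r ^ n \<le> 256 * real n * 2 ^ n *
       (\<Sum>c\<in>UNIV. \<integral>x. indicator (hcube z (2 ^ q * r)) x * (dq l c (\<lambda>x. trap r (g x)) x)\<^sup>2 \<partial>lborel)
     + 2 / (2 ^ q) ^ n * (\<integral>x. indicator (hcube z (2 ^ q * r)) x * (2 / r * trap r (g x)) \<partial>lborel)"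
    (is "_ \<le> _ * ?E + _ * ?T")
proof -
  define V where "V = (\<lambda>x. trap r (g x))"
  have r0: "0 < r" using l by simp
  have Vc: "continuous_on UNIV V" unfolding V_def trap_def
    by (intro continuous_intros l1_lipschitz_continuous[OF g])
  have in_: "V x = r / 2" if x: "x \<in> hcube z r" for x
  proof -
    have "\<bar>g x - g y\<bar> \<le> K * (\<Sum>j\<in>UNIV. \<bar>x $ j - y $ j\<bar>)" using g by (simp add: l1_lipschitz_def)
    also have "\<dots> \<le> K * (\<Sum>j\<in>(UNIV::'n set). 3 * r)"
    proof (intro mult_left_mono sum_mono K)
      fix j show "\<bar>x $ j - y $ j\<bar> \<le> 3 * r" 
      proof -
        have "z $ j \<le> x $ j" "x $ j < z $ j + r" using x by (auto simp: hcube_def)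
        then show ?thesis using y(1)[of j] r0 by linarith
      qed
    qed
    \<comment> \<open>The coordinates of \<open>x\<close> and \<open>y\<close> differ by at most
      \<open>3 * r\<close>, so \<open>g\<close> changes by at most
      \<open>3 * n * K * r <= r / 2\<close>. From \<open>(2 * r, 3 * r)\<close> it therefore stays
      within the plateau \<open>[3 / 2 * r, 7 / 2 * r]\<close> of \<open>trap r\<close>.\<close>
    also have "\<dots> = (K * (6 * real n)) * (r / 2)" by (simp add: n_def)
    also have "\<dots> \<le> 1 * (r / 2)" using r0 K by (intro mult_right_mono) auto
    finally have "\<bar>g x - g y\<bar> \<le> 1 * (r / 2)" .
    then have "3 / 2 * r \<le> g x" "g x \<le> 7 / 2 * r" using y(2,3) by linarith+
    then show ?thesis using r0 by (auto simp: V_def trap_def max_def min_def)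
  qed
  have E0: "0 \<le> ?E" by (intro sum_nonneg integral_nonneg_AE) auto
  have T0: "0 \<le> ?T" using r0 by (intro integral_nonneg_AE) (auto simp: trap_nonneg)
  have T: "?T = 2 / r * (\<integral>x. indicator (hcube z (2 ^ q * r)) x * V x \<partial>lborel)"
    unfolding V_def by (simp add: mult.left_commute)
  show ?thesis
  \<comment> \<open>The threshold is half the plateau value \<open>r / 2\<close>. Below it
    \<open>capacity_bound\<close> applies with \<open>v = r / 2\<close>, which turns
    \<open>64\<close> into \<open>256\<close>; above it the hole is charged to the volume term of
    the cell.\<close>
  proof (cases "(\<integral>x. indicator (hcube z (2 ^ q * r)) x * V x \<partial>lborel) \<le> (r / 2) / 2 * (2 ^ q * r) ^ n")
    case True
    have "(r / 2)\<^sup>2 * r ^ n \<le> 64 * real n * 2 ^ n * r\<^sup>2 * ?E"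
      using capacity_bound[where 'n = 'n and V = V and l = l and r = r and m = M and v = "r / 2" and z = z and q = q]
        n Vc l r0 in_ True unfolding n_def V_def by simp
    then have "r\<^sup>2 * r ^ n \<le> r\<^sup>2 * (256 * real n * 2 ^ n * ?E)" by (simp add: power_divide field_simps)
    then have "r ^ n \<le> 256 * real n * 2 ^ n * ?E" using r0 by simp
    moreover have "0 \<le> 2 / (2 ^ q) ^ n * ?T" using T0 by (intro mult_nonneg_nonneg) auto
    ultimately show ?thesis by linarith
  next
    case False
    then have "(2 ^ q * r) ^ n \<le> 4 / r * (\<integral>x. indicator (hcube z (2 ^ q * r)) x * V x \<partial>lborel)"
      using r0 by (simp add: field_simps)
    also have "\<dots> = 2 * ?T" unfolding T by simp
    finally have f: "(2 ^ q * r) ^ n \<le> 2 * ?T" .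
    have "r ^ n = (2 ^ q * r) ^ n / (2 ^ q) ^ n" by (simp add: power_mult_distrib)
    also have "\<dots> \<le> 2 * ?T / (2 ^ q) ^ n" by (rule divide_right_mono[OF f]) simp
    finally have "r ^ n \<le> 2 / (2 ^ q) ^ n * ?T" by (simp only: times_divide_eq_left)
    moreover have "0 \<le> 256 * real n * 2 ^ n * ?E" using E0 by (intro mult_nonneg_nonneg) auto
    ultimately show ?thesis by linarith
  qed
qed

text \<open>A hole is an open box of base side \<open>3 * r\<close> at a grid point of mesh
  \<open>s\<close>, between the heights \<open>2 * r\<close> and \<open>3 * r\<close> above the
  affine function. With \<open>g\<close> the height above that function, these are the base points
  whose graph points lie in holes. Natural numbers \<open>c j\<close> suffice over the unit
  cube.\<close>

definition holes :: "real \<Rightarrow> real \<Rightarrow> (real ^ 'n \<Rightarrow> real) \<Rightarrow> (real ^ 'n) set" where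
  "holes s r g = {y. (\<exists>c. \<forall>j. s * real (c j) < y $ j \<and> y $ j < s * real (c j) + 3 * r) \<and> 2 * r < g y \<and> g y < 3 * r}"

lemma open_holes:
  assumes "continuous_on UNIV g" shows "open (holes s r g)"
proof -
  have "holes s r g = (\<Union>c. \<Inter>j. {y. s * real (c j) < y $ j} \<inter> {y. y $ j < s * real (c j) + 3 * r}) \<inter> {y. 2 * r < g y} \<inter> {y. g y < 3 * r}"
    by (auto simp: holes_def)
  also have "open \<dots>"
    by (intro open_Int open_UN ballI open_INT open_Collect_less continuous_intros assms) auto
  finally show ?thesis .
qed

text \<open>A hit cell loses at most the base of its hole, of measure \<open>(3 * r) ^ n\<close>,
  and this is charged by \<open>hit_cell_bound\<close>. The cells are disjoint, so the charges add
  up to integrals. The condition on \<open>M'\<close> makes the cells fit exactly into the unit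
  cube.\<close>

lemma loss_scale:
  fixes g :: "real ^ 'n \<Rightarrow> real" and q M :: nat
  defines "n \<equiv> CARD('n)"
  assumes n: "3 \<le> n" and g: "l1_lipschitz K g" and K: "K * (6 * real n) \<le> 1" "0 \<le> K"
    and l: "0 < l" "0 < M" "r = real M * l" and M': "2 ^ q * r * real M' = 1"
    and supp: "supp_in b (\<lambda>x. trap r (g x))"
  shows "measure lborel (hcube 0 1 \<inter> holes (2 ^ q * r) r g) \<le> 3 ^ n * (256 * real n * 2 ^ n *
       (\<Sum>c\<in>UNIV. \<integral>x. (dq l c (\<lambda>x. trap r (g x)) x)\<^sup>2 \<partial>lborel)
     + 2 / (2 ^ q) ^ n * (\<integral>x. indicator (hcube 0 1) x * (2 / r * trap r (g x)) \<partial>lborel))"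
proof -
  let ?s = "2 ^ q * r"
  define V where "V = (\<lambda>x. trap r (g x))"
  define Ix where "Ix = {c :: 'n \<Rightarrow> nat. \<forall>j. c j < M'}"
  define Hit where "Hit = {c \<in> Ix. \<exists>y. (\<forall>j. gridpt ?s c $ j < y $ j \<and> y $ j < gridpt ?s c $ j + 3 * r) \<and> 2 * r < g y \<and> g y < 3 * r}"
  define A where "A = (\<lambda>c. 256 * real n * 2 ^ n *
       (\<Sum>j\<in>UNIV. \<integral>x. indicator (hcube (gridpt ?s c) ?s) x * (dq l j V x)\<^sup>2 \<partial>lborel)
     + 2 / (2 ^ q) ^ n * (\<integral>x. indicator (hcube (gridpt ?s c) ?s) x * (2 / r * V x) \<partial>lborel))"
  have r0: "0 < r" using l by simp
  have s0: "0 < ?s" using r0 by simp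
  have Vc: "continuous_on UNIV V" using supp by (simp add: supp_in_def V_def)
  have V0: "0 \<le> V x" for x by (simp add: V_def trap_nonneg)
  have fin: "finite Ix" unfolding Ix_def by (rule finite_grid)
  have finH: "finite Hit" unfolding Hit_def using fin by simp
  have sub: "hcube 0 1 \<inter> holes ?s r g \<subseteq> (\<Union>c\<in>Hit. hcube (gridpt ?s c) (3 * r))"
  proof
    fix y assume y: "y \<in> hcube 0 1 \<inter> holes ?s r g"
    then obtain c where c: "\<And>j. ?s * real (c j) < y $ j \<and> y $ j < ?s * real (c j) + 3 * r"
      and gy: "2 * r < g y" "g y < 3 * r" by (auto simp: holes_def)
    have "c j < M'" for j
    proof -
      have "?s * real (c j) < 1" using c[of j] y by (auto simp: hcube_def intro: less_trans)
      then have "?s * real (c j) < ?s * real M'" using M' by simp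
      then have "real (c j) < real M'" using s0 by (simp only: mult_less_cancel_left_pos)
      then show ?thesis by simp
    qed
    then have "c \<in> Hit" using c gy by (auto simp: Hit_def Ix_def gridpt_def)
    moreover have "y \<in> hcube (gridpt ?s c) (3 * r)" using c by (auto simp: hcube_def gridpt_def less_imp_le)
    ultimately show "y \<in> (\<Union>c\<in>Hit. hcube (gridpt ?s c) (3 * r))" by blast
  qed
  note fm = hcube_fmeasurable
  have "measure lborel (hcube 0 1 \<inter> holes ?s r g) \<le> measure lborel (\<Union>c\<in>Hit. hcube (gridpt ?s c) (3 * r))"
  proof (rule measure_mono_fmeasurable[OF sub])
    show "hcube 0 1 \<inter> holes ?s r g \<in> sets lborel"
      using open_holes[OF l1_lipschitz_continuous[OF g]] by (auto intro!: sets.Int)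
    show "(\<Union>c\<in>Hit. hcube (gridpt ?s c) (3 * r)) \<in> fmeasurable lborel"
      using finH fm by (intro fmeasurable.finite_UN) auto
  qed
  also have "\<dots> \<le> (\<Sum>c\<in>Hit. measure lborel (hcube (gridpt ?s c) (3 * r)))"
    using finH fm by (intro measure_UNION_le) (auto intro: fmeasurableD)
  also have "\<dots> = (\<Sum>c\<in>Hit. 3 ^ n * r ^ n)"
    using r0 by (simp add: measure_hcube n_def power_mult_distrib)
  also have "\<dots> \<le> (\<Sum>c\<in>Hit. 3 ^ n * A c)"
  proof (intro sum_mono mult_left_mono)
    fix c assume "c \<in> Hit"
    then obtain y where y: "\<And>j. gridpt ?s c $ j < y $ j \<and> y $ j < gridpt ?s c $ j + 3 * r" "2 * r < g y" "g y < 3 * r"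
      unfolding Hit_def by blast
    show "r ^ n \<le> A c"
      unfolding A_def V_def n_def
      by (rule hit_cell_bound[OF n[unfolded n_def] g K(1)[unfolded n_def] K(2) l y])
  qed simp
  also have "\<dots> \<le> (\<Sum>c\<in>Ix. 3 ^ n * A c)"
    using r0 by (intro sum_mono2 fin mult_nonneg_nonneg)
      (auto simp: Hit_def A_def V0 intro!: add_nonneg_nonneg sum_nonneg mult_nonneg_nonneg integral_nonneg_AE)
  also have "\<dots> = 3 ^ n * (256 * real n * 2 ^ n *
       (\<Sum>j\<in>UNIV. \<Sum>c\<in>Ix. \<integral>x. indicator (hcube (gridpt ?s c) ?s) x * (dq l j V x)\<^sup>2 \<partial>lborel)
     + 2 / (2 ^ q) ^ n * (\<Sum>c\<in>Ix. \<integral>x. indicator (hcube (gridpt ?s c) ?s) x * (2 / r * V x) \<partial>lborel))"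
    unfolding A_def by (subst sum.swap) (simp add: sum_distrib_left sum.distrib distrib_left)
  also have "\<dots> \<le> 3 ^ n * (256 * real n * 2 ^ n * (\<Sum>j\<in>UNIV. \<integral>x. (dq l j V x)\<^sup>2 \<partial>lborel)
     + 2 / (2 ^ q) ^ n * (\<integral>x. indicator (hcube 0 1) x * (2 / r * V x) \<partial>lborel))"
  proof (intro mult_left_mono add_mono sum_mono)
    fix j
    have "(\<Sum>c\<in>Ix. \<integral>x. indicator (hcube (gridpt ?s c) ?s) x * (dq l j V x)\<^sup>2 \<partial>lborel)
        \<le> (\<integral>x. indicator (hcube 0 1) x * (dq l j V x)\<^sup>2 \<partial>lborel)"
      unfolding Ix_def by (intro sum_grid_integral_le s0 M' continuous_intros continuous_on_dq Vc) simp
    also have "\<dots> \<le> (\<integral>x. (dq l j V x)\<^sup>2 \<partial>lborel)"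
    proof (rule integral_mono)
      have d: "supp_in (b + \<bar>l\<bar>) (dq l j V)" using supp unfolding V_def by (intro supp_in_dq) auto
      show "integrable lborel (\<lambda>x. (dq l j V x)\<^sup>2)"
        using supp_in_integrable[OF supp_in_mult[OF d supp_in_cont[OF d]]] by (simp add: power2_eq_square)
      show "integrable lborel (\<lambda>x. indicator (hcube 0 1) x * (dq l j V x)\<^sup>2)"
        by (intro integrable_cont_on_bounded hcube_borel bounded_hcube continuous_intros continuous_on_dq Vc)
    qed (auto simp: indicator_def)
    finally show "(\<Sum>c\<in>Ix. \<integral>x. indicator (hcube (gridpt ?s c) ?s) x * (dq l j V x)\<^sup>2 \<partial>lborel)
        \<le> (\<integral>x. (dq l j V x)\<^sup>2 \<partial>lborel)" .
  next
    show "(\<Sum>c\<in>Ix. \<integral>x. indicator (hcube (gridpt ?s c) ?s) x * (2 / r * V x) \<partial>lborel)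
       \<le> (\<integral>x. indicator (hcube 0 1) x * (2 / r * V x) \<partial>lborel)"
      unfolding Ix_def using r0 by (intro sum_grid_integral_le s0 M' continuous_intros Vc) (auto simp: V0)
  qed auto
  finally show ?thesis by (simp add: V_def)
qed

subsection \<open>Holes of all scales\<close>

text \<open>Within a level, \<open>2\<^sup>q rad p q (k + 1) = rad p q k\<close>: the cells of scale \<open>k + 1\<close> have the size
  of the holes of scale \<open>k\<close>. So the position of a point in the cells of successive scales is
  given by its digits in base \<open>2\<^sup>q\<close>, and it is below a hole of scale \<open>k\<close> if the corresponding
  digits of all its coordinates are \<open>1\<close>.\<close>

definition rad :: "nat \<Rightarrow> nat \<Rightarrow> nat \<Rightarrow> real" where
  "rad p q k = 1 / 2 ^ (p + q * k)"

lemma rad_pos: "0 < rad p q k" by (simp add: rad_def)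

lemma rad_Suc_le:
  assumes "2 \<le> q" shows "4 * rad p q (Suc k) \<le> rad p q k"
proof -
  have "(2::real) ^ 2 \<le> 2 ^ q" using assms by (intro power_increasing) auto
  then show ?thesis by (simp add: rad_def power_add field_simps)
qed

definition level_holes :: "nat \<Rightarrow> nat \<Rightarrow> nat \<Rightarrow> (real ^ 'n \<Rightarrow> real) \<Rightarrow> (real ^ 'n) set" where
  "level_holes p q m g = (\<Union>k<m. holes (2 ^ q * rad p q k) (rad p q k) g)"

lemma open_level_holes: "continuous_on UNIV g \<Longrightarrow> open (level_holes p q m g)"
  unfolding level_holes_def by (intro open_UN ballI open_holes)

lemma clip_eq_0: "0 < r \<Longrightarrow> clip 0 (4 * r) t = 0 \<longleftrightarrow> t \<le> 0"
  by (auto simp: clip_def max_def min_def)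

lemma trap_eq_0: "0 \<le> r \<Longrightarrow> t \<le> 0 \<Longrightarrow> trap r t = 0"
  by (auto simp: trap_def max_def min_def)

text \<open>All radii of the level are integer multiples of the smallest one, \<open>l\<close>, so
  the quotients of all scales may use the same step \<open>l\<close>. Then the squared quotients of
  the traps add up pointwise to at most that of the single truncation \<open>G\<close>.\<close>

lemma loss_level:
  fixes g :: "real ^ 'n \<Rightarrow> real" and p q m :: nat
  defines "n \<equiv> CARD('n)" and "l \<equiv> rad p q (m - 1)" and "G \<equiv> \<lambda>x. clip 0 (4 * rad p q 0) (g x)"
  assumes n: "3 \<le> n" and g: "l1_lipschitz K g" and K: "K * (6 * real n) \<le> 1" "0 \<le> K"
    and q: "2 \<le> q" "q \<le> p" and m: "1 \<le> m" and G: "supp_in b G"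
  shows "measure lborel (hcube 0 1 \<inter> level_holes p q m g) \<le> 3 ^ n * (256 * real n * 2 ^ n *
       (\<Sum>j\<in>UNIV. \<integral>x. (dq l j G x)\<^sup>2 \<partial>lborel) + 2 / (2 ^ q) ^ n)"
proof -
  define r where "r = rad p q"
  have r0: "0 < r k" for k by (simp add: r_def rad_pos)
  have r4: "4 * r (Suc k) \<le> r k" for k unfolding r_def by (rule rad_Suc_le[OF q(1)])
  have gc: "continuous_on UNIV g" by (rule l1_lipschitz_continuous[OF g])
  have Vs: "supp_in b (\<lambda>x. trap (r k) (g x))" for k
    unfolding supp_in_def
  proof (intro conjI allI impI)
    show "continuous_on UNIV (\<lambda>x. trap (r k) (g x))" unfolding trap_def by (intro continuous_intros gc)
    fix x :: "real ^ 'n" assume "\<exists>j. b < \<bar>x $ j\<bar>"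
    then have "G x = 0" using G by (auto simp: supp_in_def)
    then have "g x \<le> 0" using r0[of 0] by (simp add: G_def r_def clip_eq_0)
    then show "trap (r k) (g x) = 0" using r0[of k] by (simp add: trap_eq_0)
  qed
  have l0: "0 < l" by (simp add: l_def rad_pos)
  define V where "V = (\<lambda>k x. trap (r k) (g x))"
  let ?E = "\<lambda>k. \<Sum>j\<in>UNIV. \<integral>x. (dq l j (V k) x)\<^sup>2 \<partial>lborel"
  let ?T = "\<lambda>k. \<integral>x. indicator (hcube (0 :: real ^ 'n) 1) x * (2 / r k * V k x) \<partial>lborel"
  have Vc: "continuous_on UNIV (V k)" for k unfolding V_def by (rule supp_in_cont[OF Vs])
  have sq: "integrable lborel (\<lambda>x. (dq l j F x)\<^sup>2)" if F: "supp_in b F" for F :: "real ^ 'n \<Rightarrow> real" and j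
  proof -
    have d: "supp_in (b + \<bar>l\<bar>) (dq l j F)" using F by (intro supp_in_dq) auto
    show ?thesis using supp_in_integrable[OF supp_in_mult[OF d supp_in_cont[OF d]]] by (simp add: power2_eq_square)
  qed
  have scale: "measure lborel (hcube 0 1 \<inter> holes (2 ^ q * r k) (r k) g)
     \<le> 3 ^ n * (256 * real n * 2 ^ n * ?E k + 2 / (2 ^ q) ^ n * ?T k)" if k: "k < m" for k
  proof -
    \<comment> \<open>The scales are the \<open>k < m\<close>, so the smallest radius belongs to
      \<open>m - 1\<close>.\<close>
    have "p + q * (m - 1) = p + q * k + q * (m - 1 - k)"
      using k by (simp add: diff_mult_distrib2[symmetric] flip: distrib_left)
    then have rk: "r k = real (2 ^ (q * (m - 1 - k))) * l"
      by (simp add: r_def l_def rad_def power_add)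
    have one: "2 ^ q * r k * real (2 ^ (p - q + q * k)) = 1"
    proof -
      have "p + q * k = q + (p - q + q * k)" using q by simp
      then have "(2::real) ^ (p + q * k) = 2 ^ q * 2 ^ (p - q + q * k)" by (metis power_add)
      then show ?thesis by (simp add: r_def rad_def)
    qed
    show ?thesis
      using loss_scale[where 'n = 'n and g = g and q = q and l = l and r = "r k", OF n[unfolded n_def] g K[unfolded n_def] l0 _ rk one Vs[of k]]
      unfolding V_def n_def by simp
  qed
  have "measure lborel (hcube 0 1 \<inter> level_holes p q m g)
     = measure lborel (\<Union>k<m. hcube 0 1 \<inter> holes (2 ^ q * r k) (r k) g)"
    unfolding level_holes_def r_def by (simp only: Int_UN_distrib)
  also have "\<dots> \<le> (\<Sum>k<m. measure lborel (hcube 0 1 \<inter> holes (2 ^ q * r k) (r k) g))"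
  proof (rule measure_UNION_le)
    fix k 
    have "hcube 0 1 \<inter> holes (2 ^ q * r k) (r k) g \<in> fmeasurable lborel"
      using open_holes[OF gc] hcube_fmeasurable by (intro fmeasurableI2[OF hcube_fmeasurable, of _ 0 1]) (auto intro!: sets.Int)
    then show "hcube 0 1 \<inter> holes (2 ^ q * r k) (r k) g \<in> sets lborel" by (rule fmeasurableD)
  qed simp
  also have "\<dots> \<le> (\<Sum>k<m. 3 ^ n * (256 * real n * 2 ^ n * ?E k + 2 / (2 ^ q) ^ n * ?T k))"
    by (intro sum_mono scale) auto
  also have "\<dots> = 3 ^ n * (256 * real n * 2 ^ n * (\<Sum>k<m. ?E k) + 2 / (2 ^ q) ^ n * (\<Sum>k<m. ?T k))"
    by (simp only: sum_distrib_left sum.distrib distrib_left)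
  also have "\<dots> \<le> 3 ^ n * (256 * real n * 2 ^ n * (\<Sum>j\<in>UNIV. \<integral>x. (dq l j G x)\<^sup>2 \<partial>lborel) + 2 / (2 ^ q) ^ n * 1)"
  proof (intro mult_left_mono add_mono)
    have "(\<Sum>k<m. ?E k) = (\<Sum>j\<in>UNIV. \<integral>x. (\<Sum>k<m. (dq l j (V k) x)\<^sup>2) \<partial>lborel)"
      using sq[OF Vs] by (subst sum.swap) (simp add: V_def)
    also have "\<dots> \<le> (\<Sum>j\<in>UNIV. \<integral>x. (dq l j G x)\<^sup>2 \<partial>lborel)"
    proof (intro sum_mono integral_mono)
      fix j show "integrable lborel (\<lambda>x. \<Sum>k<m. (dq l j (V k) x)\<^sup>2)"
        using sq[OF Vs] by (simp add: V_def)
      show "integrable lborel (\<lambda>x. (dq l j G x)\<^sup>2)" by (rule sq[OF G])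
      fix x :: "real ^ 'n"
      let ?x = "x + l *\<^sub>R axis j 1"
      let ?c = "\<lambda>k. \<bar>clip (r k) (4 * r k) (g ?x) - clip (r k) (4 * r k) (g x)\<bar>"
      have "(\<Sum>k<m. (dq l j (V k) x)\<^sup>2) = (\<Sum>k<m. (trap (r k) (g ?x) - trap (r k) (g x))\<^sup>2) / l\<^sup>2"
        by (simp add: dq_def V_def power_divide sum_divide_distrib)
      also have "\<dots> \<le> (\<Sum>k<m. (?c k)\<^sup>2) / l\<^sup>2"
        using trap_diff_le[OF less_imp_le[OF r0]]
        by (intro divide_right_mono sum_mono) (auto simp: abs_le_square_iff[symmetric])
      also have "\<dots> \<le> (\<Sum>k<m. ?c k)\<^sup>2 / l\<^sup>2"
        by (intro divide_right_mono sum_squares_le_square_sum) auto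
      also have "\<dots> \<le> \<bar>clip 0 (4 * r 0) (g ?x) - clip 0 (4 * r 0) (g x)\<bar>\<^sup>2 / l\<^sup>2"
        by (intro divide_right_mono power_mono sum_clip_le sum_nonneg r4 less_imp_le[OF r0]) auto
      also have "\<dots> = (dq l j G x)\<^sup>2" by (simp add: dq_def G_def r_def power_divide)
      finally show "(\<Sum>k<m. (dq l j (V k) x)\<^sup>2) \<le> (dq l j G x)\<^sup>2" .
    qed
    finally show "(\<Sum>k<m. ?E k) \<le> (\<Sum>j\<in>UNIV. \<integral>x. (dq l j G x)\<^sup>2 \<partial>lborel)" .
    have i: "integrable lborel (\<lambda>x. indicator (hcube (0 :: real ^ 'n) 1) x * (2 / r k * V k x))" for k
      by (intro integrable_cont_on_bounded hcube_borel bounded_hcube continuous_intros Vc)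
    have "(\<Sum>k<m. ?T k) = (\<integral>x. indicator (hcube (0 :: real ^ 'n) 1) x * (\<Sum>k<m. 2 / r k * V k x) \<partial>lborel)"
      using i by (simp add: sum_distrib_left)
    also have "\<dots> \<le> (\<integral>x. indicator (hcube (0 :: real ^ 'n) 1) x * 1 \<partial>lborel)"
    proof (rule integral_mono)
      show "integrable lborel (\<lambda>x. indicator (hcube (0 :: real ^ 'n) 1) x * (\<Sum>k<m. 2 / r k * V k x))"
        by (intro integrable_cont_on_bounded hcube_borel bounded_hcube continuous_intros Vc)
      show "integrable lborel (\<lambda>x. indicator (hcube (0 :: real ^ 'n) 1) x * 1 :: real)"
        by (intro integrable_cont_on_bounded hcube_borel bounded_hcube continuous_intros)
      fix x :: "real ^ 'n"
      show "indicator (hcube 0 1) x * (\<Sum>k<m. 2 / r k * V k x) \<le> indicator (hcube 0 1) x * 1"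
        unfolding V_def by (intro mult_left_mono sum_trap_le r0 r4) auto
    qed
    also have "\<dots> = 1" by (simp add: measure_hcube)
    finally show "(\<Sum>k<m. ?T k) \<le> 1" .
  qed auto
  finally show ?thesis by simp
qed

text \<open>Truncation is monotone and does not increase distances. Applied to quotients, this
  bounds the energy of a truncation by its correlation with the untruncated function.\<close>

lemma clip_contraction: "(clip a b t' - clip a b t)\<^sup>2 \<le> (clip a b t' - clip a b t) * (t' - t)"
proof (cases "t \<le> t'")
  case True
  then have "0 \<le> clip a b t' - clip a b t" "clip a b t' - clip a b t \<le> t' - t" by (auto simp: clip_def)
  then show ?thesis by (simp add: power2_eq_square mult_left_mono)
next
  case False
  then have "0 \<le> clip a b t - clip a b t'" "clip a b t - clip a b t' \<le> t - t'" by (auto simp: clip_def)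
  then have "(clip a b t - clip a b t') * (clip a b t - clip a b t') \<le> (clip a b t - clip a b t') * (t - t')"
    by (intro mult_left_mono)
  then show ?thesis by (simp add: power2_eq_square algebra_simps)
qed

lemma abs_clip_diff_le: "\<bar>clip a b t - clip a b t'\<bar> \<le> \<bar>t - t'\<bar>"
  by (auto simp: clip_def)

lemma sum_k_quarter_le: "(\<Sum>k<I. real k * (1 / 4) ^ k) \<le> 2"
proof -
  have "(\<Sum>k<I. real k * (1 / 4) ^ k) \<le> (\<Sum>k<I. (1 / 2 :: real) ^ k)"
  proof (rule sum_mono)
    fix k
    have "real k * (1 / 4) ^ k \<le> 2 ^ k * (1 / 4) ^ k" by (intro mult_right_mono) (auto simp: less_imp_le of_nat_less_two_power)
    also have "\<dots> = (1 / 2) ^ k" by (simp flip: power_mult_distrib)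
    finally show "real k * (1 / 4) ^ k \<le> (1 / 2) ^ k" .
  qed
  also have "\<dots> \<le> 2" by (subst sum_gp_strict) auto
  finally show ?thesis .
qed

text \<open>The bound does not depend on \<open>I\<close>. By \<open>sep\<close> the amplitude of
  level \<open>k\<close> is at most \<open>4 ^ -k / 2 ^ e0\<close> times the step of every earlier
  level, so the cross terms in \<open>bessel_bound\<close> are summable; and since
  \<open>q0 + i <= q i\<close>, the volume terms of the levels are dominated by a geometric
  series.\<close>

lemma loss_total:
  fixes h :: "real ^ 'n \<Rightarrow> real" and p q m :: "nat \<Rightarrow> nat" and a :: "nat \<Rightarrow> real ^ 'n" and \<beta> :: "nat \<Rightarrow> real"
  defines "n \<equiv> CARD('n)" and "g \<equiv> \<lambda>i y. h y - (a i \<bullet> y + \<beta> i)"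
  assumes n: "3 \<le> n" and h: "l1_lipschitz H h" and g: "\<And>i. l1_lipschitz K (g i)"
    and K: "K * (6 * real n) \<le> 1" "0 \<le> K" and b: "0 \<le> b"
    and q: "\<And>i. 2 \<le> q i \<and> q0 + i \<le> q i \<and> q i \<le> p i" and m: "\<And>i. 1 \<le> m i"
    and sep: "\<And>i k. i < k \<Longrightarrow> e0 + 2 + 2 * k + p i + q i * m i \<le> p k"
    and out: "\<And>i x j. b < \<bar>x $ j\<bar> \<Longrightarrow> g i x \<le> 0"
  shows "measure lborel (hcube 0 1 \<inter> (\<Union>i<I. level_holes (p i) (q i) (m i) (g i)))
     \<le> 3 ^ n * (256 * real n * 2 ^ n * (real n * (H\<^sup>2 * (2 * (b + 2)) ^ n + 8 * K / 2 ^ e0 * (2 * b) ^ n)) + 4 / 2 ^ q0)"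
proof -
  define l where "l = (\<lambda>i. rad (p i) (q i) (m i - 1))"
  define R where "R = (\<lambda>i. 4 * rad (p i) (q i) 0)"
  define G where "G = (\<lambda>i x. clip 0 (R i) (g i x))"
  define J where "J = (\<lambda>i. \<Sum>j\<in>UNIV. \<integral>x. (dq (l i) j (G i) x)\<^sup>2 \<partial>lborel)"
  have gc: "continuous_on UNIV (g i)" for i by (rule l1_lipschitz_continuous[OF g])
  have hc: "continuous_on UNIV h" by (rule l1_lipschitz_continuous[OF h])
  have R0: "0 < R i" for i by (simp add: R_def rad_pos)
  have l0: "0 < l i" for i by (simp add: l_def rad_pos)
  have l1: "l i \<le> 1" for i by (simp add: l_def rad_def)
  have Gs: "supp_in b (G i)" for i
    unfolding supp_in_def
  proof (intro conjI allI impI)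
    show "continuous_on UNIV (G i)" unfolding G_def clip_def by (intro continuous_intros gc)
    fix x :: "real ^ 'n" assume "\<exists>j. b < \<bar>x $ j\<bar>"
    then have "g i x \<le> 0" using out by blast
    then show "G i x = 0" by (simp add: G_def R_def clip_eq_0 rad_pos)
  qed
  have GR: "\<bar>G i x\<bar> \<le> R i" for i x using R0[of i] by (auto simp: G_def clip_def)
  have GL: "\<bar>G i (x + t *\<^sub>R axis j 1) - G i x\<bar> \<le> K * \<bar>t\<bar>" for i x t j
    unfolding G_def by (rule order_trans[OF abs_clip_diff_le l1_lipschitz_axis[OF g]])
  have level: "measure lborel (hcube 0 1 \<inter> level_holes (p i) (q i) (m i) (g i))
      \<le> 3 ^ n * (256 * real n * 2 ^ n * J i + 2 / (2 ^ q i) ^ n)" for i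
    using loss_level[where 'n = 'n and K = K and g = "g i" and p = "p i" and q = "q i" and m = "m i" and b = b]
      n g K q[of i] m[of i] Gs[of i]
    unfolding J_def l_def n_def G_def R_def by simp
  \<comment> \<open>All steps \<open>l i\<close> are negative powers of two. \<open>L\<close> is
    just some bound for their exponents, so that \<open>lam\<close> divides each of them.\<close>
  define L where "L = (\<Sum>i<I. p i + q i * m i)"
  define Q where "Q = (\<lambda>i. 2 ^ (L - (p i + q i * (m i - 1))) :: nat)"
  define lam where "lam = 1 / (2::real) ^ L"
  have lam0: "0 < lam" by (simp add: lam_def)
  have Ql: "l i = real (Q i) * lam \<and> 0 < Q i \<and> l i \<le> 1" if "i < I" for i
  proof -
    have "p i + q i * (m i - 1) \<le> p i + q i * m i" by simp
    also have "\<dots> \<le> L" unfolding L_def using that by (intro member_le_sum) auto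
    finally have "L = p i + q i * (m i - 1) + (L - (p i + q i * (m i - 1)))" by simp
    then have "(2::real) ^ L = 2 ^ (p i + q i * (m i - 1)) * 2 ^ (L - (p i + q i * (m i - 1)))" by (metis power_add)
    then show ?thesis using l1[of i] by (simp add: l_def rad_def Q_def lam_def)
  qed
  have Jle: "J i \<le> (\<Sum>j\<in>UNIV. \<integral>x. dq (l i) j (G i) x * dq (l i) j h x \<partial>lborel)" for i
    unfolding J_def
  proof (rule sum_mono)
    fix j
    have d: "supp_in (b + 1) (dq (l i) j (G i))" using l0[of i] l1[of i] by (intro supp_in_dq Gs) simp
    have dqh: "dq (l i) j h x = dq (l i) j (g i) x + a i $ j" for x
      using l0[of i] by (simp add: dq_def g_def inner_add_right inner_axis field_simps)
    have "(\<integral>x. (dq (l i) j (G i) x)\<^sup>2 \<partial>lborel) \<le> (\<integral>x. dq (l i) j (G i) x * dq (l i) j (g i) x \<partial>lborel)"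
    proof (rule integral_mono)
      show "integrable lborel (\<lambda>x. (dq (l i) j (G i) x)\<^sup>2)"
        using supp_in_integrable[OF supp_in_mult[OF d supp_in_cont[OF d]]] by (simp add: power2_eq_square)
      show "integrable lborel (\<lambda>x. dq (l i) j (G i) x * dq (l i) j (g i) x)"
        by (rule supp_in_integrable[OF supp_in_mult[OF d continuous_on_dq[OF gc]]])
      fix x :: "real ^ 'n"
      let ?x = "x + l i *\<^sub>R axis j 1"
      have "(dq (l i) j (G i) x)\<^sup>2 = (G i ?x - G i x)\<^sup>2 / (l i)\<^sup>2" by (simp add: dq_def power_divide)
      also have "\<dots> \<le> ((G i ?x - G i x) * (g i ?x - g i x)) / (l i)\<^sup>2"
        unfolding G_def by (intro divide_right_mono clip_contraction) auto
      also have "\<dots> = dq (l i) j (G i) x * dq (l i) j (g i) x" by (simp add: dq_def power2_eq_square)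
      finally show "(dq (l i) j (G i) x)\<^sup>2 \<le> dq (l i) j (G i) x * dq (l i) j (g i) x" .
    qed
    also have "\<dots> = (\<integral>x. dq (l i) j (G i) x * dq (l i) j (g i) x \<partial>lborel) + (\<integral>x. dq (l i) j (G i) x * a i $ j \<partial>lborel)"
      using integral_dq_eq_0[OF Gs[of i], of "l i" j] by simp
    also have "\<dots> = (\<integral>x. dq (l i) j (G i) x * dq (l i) j h x \<partial>lborel)"
      unfolding dqh distrib_left
      by (rule Bochner_Integration.integral_add[symmetric])
        (intro supp_in_integrable[OF supp_in_mult[OF d]] continuous_on_dq gc continuous_intros)+
    finally show "(\<integral>x. (dq (l i) j (G i) x)\<^sup>2 \<partial>lborel) \<le> (\<integral>x. dq (l i) j (G i) x * dq (l i) j h x \<partial>lborel)" .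
  qed
  have Jsum0: "(\<Sum>i<I. J i) \<le> real n * (H\<^sup>2 * (2 * (b + 2)) ^ n
      + 2 * (\<Sum>k<I. \<Sum>i<k. 2 * K / l i * R k * (2 * b) ^ n))"
    unfolding J_def n_def
    by (rule bessel_bound[where lam = lam and Q = Q])
      (assumption | rule lam0 Ql Gs b GL GR hc l1_lipschitz_axis[OF h] Jle[unfolded J_def])+
  have cross: "(\<Sum>k<I. \<Sum>i<k. 2 * K / l i * R k * (2 * b) ^ n) \<le> 2 * (2 * K / 2 ^ e0 * (2 * b) ^ n)"
  proof -
    have RL: "R k / l i \<le> (1 / 4) ^ k / 2 ^ e0" if "i < k" for i k
    proof -
      have "p i + q i * (m i - 1) + (e0 + 2 + 2 * k) \<le> p k"
      proof -
        have "q i * (m i - 1) \<le> q i * m i" by simp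
        then show ?thesis using sep[OF that] by linarith
      qed
      then have "(2::real) ^ (p i + q i * (m i - 1) + (e0 + 2 + 2 * k)) \<le> 2 ^ p k" by (intro power_increasing) auto
      then have "2 ^ (p i + q i * (m i - 1)) * (2 ^ e0 * 4 * 4 ^ k) \<le> (2::real) ^ p k"
        by (simp add: power_add power_mult)
      then show ?thesis by (simp add: R_def l_def rad_def field_simps)
    qed
    have "(\<Sum>k<I. \<Sum>i<k. 2 * K / l i * R k * (2 * b) ^ n)
       \<le> (\<Sum>k<I. \<Sum>i<k. (2 * K / 2 ^ e0 * (2 * b) ^ n) * (1 / 4) ^ k)"
    proof (intro sum_mono)
      fix k i assume "k \<in> {..<I}" "i \<in> {..<k}"
      then have "R k / l i \<le> (1 / 4) ^ k / 2 ^ e0" using RL by simp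
      then have "(2 * K * (2 * b) ^ n) * (R k / l i) \<le> (2 * K * (2 * b) ^ n) * ((1 / 4) ^ k / 2 ^ e0)"
        using K b by (intro mult_left_mono) auto
      then show "2 * K / l i * R k * (2 * b) ^ n \<le> (2 * K / 2 ^ e0 * (2 * b) ^ n) * (1 / 4) ^ k"
        by (simp add: field_simps)
    qed
    also have "\<dots> = (2 * K / 2 ^ e0 * (2 * b) ^ n) * (\<Sum>k<I. real k * (1 / 4) ^ k)"
      by (simp add: sum_distrib_left mult.left_commute)
    also have "\<dots> \<le> (2 * K / 2 ^ e0 * (2 * b) ^ n) * 2"
      using K b by (intro mult_left_mono sum_k_quarter_le) auto
    finally show ?thesis by simp
  qed
  have "2 * (\<Sum>k<I. \<Sum>i<k. 2 * K / l i * R k * (2 * b) ^ n) \<le> 8 * K / 2 ^ e0 * (2 * b) ^ n"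
    using cross by simp
  then have Jsum: "(\<Sum>i<I. J i) \<le> real n * (H\<^sup>2 * (2 * (b + 2)) ^ n + 8 * K / 2 ^ e0 * (2 * b) ^ n)"
    by (intro order_trans[OF Jsum0] mult_left_mono add_left_mono) auto
  have qsum: "(\<Sum>i<I. 2 / (2 ^ q i) ^ n) \<le> 4 / (2::real) ^ q0"
  proof -
    have "(\<Sum>i<I. 2 / (2 ^ q i) ^ n) \<le> (\<Sum>i<I. (2 / 2 ^ q0) * (1 / 2 :: real) ^ i)"
    proof (rule sum_mono)
      fix i
      have "(2::real) ^ (q0 + i) \<le> 2 ^ q i" using q[of i] by (intro power_increasing) auto
      also have "\<dots> \<le> (2 ^ q i) ^ n" using n by (intro self_le_power) auto
      finally show "2 / (2 ^ q i) ^ n \<le> (2 / 2 ^ q0) * (1 / 2 :: real) ^ i"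
        by (simp add: power_add power_divide field_simps)
    qed
    also have "\<dots> = (2 / 2 ^ q0) * (\<Sum>i<I. (1 / 2) ^ i)" by (simp add: sum_distrib_left)
    also have "\<dots> \<le> (2 / 2 ^ q0) * 2" by (intro mult_left_mono) (auto simp: sum_gp_strict)
    finally show ?thesis by simp
  qed
  have "measure lborel (hcube 0 1 \<inter> (\<Union>i<I. level_holes (p i) (q i) (m i) (g i)))
     = measure lborel (\<Union>i<I. hcube 0 1 \<inter> level_holes (p i) (q i) (m i) (g i))"
    by (simp only: Int_UN_distrib)
  also have "\<dots> \<le> (\<Sum>i<I. measure lborel (hcube 0 1 \<inter> level_holes (p i) (q i) (m i) (g i)))"
    using open_level_holes[OF gc] by (intro measure_UNION_le) (auto intro!: sets.Int)
  also have "\<dots> \<le> (\<Sum>i<I. 3 ^ n * (256 * real n * 2 ^ n * J i + 2 / (2 ^ q i) ^ n))"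
    by (intro sum_mono level)
  also have "\<dots> = 3 ^ n * (256 * real n * 2 ^ n * (\<Sum>i<I. J i) + (\<Sum>i<I. 2 / (2 ^ q i) ^ n))"
    by (simp only: sum_distrib_left sum.distrib distrib_left)
  also have "\<dots> \<le> 3 ^ n * (256 * real n * 2 ^ n * (real n * (H\<^sup>2 * (2 * (b + 2)) ^ n + 8 * K / 2 ^ e0 * (2 * b) ^ n)) + 4 / 2 ^ q0)"
    by (intro mult_left_mono add_mono Jsum qsum) auto
  finally show ?thesis .
qed

subsection \<open>Choice of scales\<close>

text \<open>Of the base of each hole only the middle third \<open>[r, 2 * r)\<close> in every
  coordinate is used, so that there is still room on all sides when a point is lifted into the
  hole.\<close>

definition seen :: "nat \<Rightarrow> nat \<Rightarrow> nat \<Rightarrow> (real ^ 'n) set" where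
  "seen p q m = {y. \<exists>k<m. \<exists>c. \<forall>j. 2 ^ q * rad p q k * real (c j) + rad p q k \<le> y $ j
      \<and> y $ j < 2 ^ q * rad p q k * real (c j) + 2 * rad p q k}"

lemma seen_borel: "(seen p q m :: (real ^ 'n) set) \<in> sets borel"
proof -
  have "(seen p q m :: (real ^ 'n) set)
      = (\<Union>k<m. \<Union>c. hcube (gridpt (2 ^ q * rad p q k) c + (\<chi> j. rad p q k)) (rad p q k))"
    by (auto simp: seen_def hcube_def gridpt_def algebra_simps)
  also have "\<dots> \<in> sets borel" by (intro sets.countable_UN' sets.countable_UN hcube_borel) auto
  finally show ?thesis .
qed

lemma measure_grid_union_le:
  fixes W X :: "(real ^ 'n) set"
  assumes X: "X \<in> sets borel" and W: "W \<in> sets borel" "bounded W" and C: "finite C"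
    and sub: "\<And>x. x \<in> X \<Longrightarrow> \<exists>c\<in>C. x - gridpt s c \<in> W"
  shows "measure lborel X \<le> real (card C) * measure lborel W"
proof -
  let ?T = "\<lambda>c. (+) (gridpt s c) ` W"
  have meq: "?T c = (\<lambda>x. x - gridpt s c) -` W" for c
    by (auto simp: image_iff algebra_simps intro!: bexI[of _ "_ - gridpt s c"])
  have T: "?T c \<in> sets borel" for c
  proof -
    have "(\<lambda>x. x - gridpt s c) \<in> borel_measurable borel"
      by (intro borel_measurable_continuous_onI continuous_intros)
    from measurable_sets[OF this W(1)] show ?thesis unfolding meq by simp
  qed
  have bT: "bounded (?T c)" for c by (rule bounded_translation[OF W(2)])
  have fm: "A \<in> fmeasurable lborel" if "A \<in> sets borel" "bounded A" for A :: "(real ^ 'n) set"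
    using that emeasure_bounded_finite[of A] by (auto intro!: fmeasurableI)
  have "measure lborel X \<le> measure lborel (\<Union>c\<in>C. ?T c)"
  proof (rule measure_mono_fmeasurable)
    show "X \<subseteq> (\<Union>c\<in>C. ?T c)" using sub by (fastforce simp: meq)
    show "(\<Union>c\<in>C. ?T c) \<in> fmeasurable lborel" using C fm[OF T bT] by (intro fmeasurable.finite_UN) auto
  qed (use X in simp)
  also have "\<dots> \<le> (\<Sum>c\<in>C. measure lborel (?T c))" using C T by (intro measure_UNION_le) auto
  also have "\<dots> = (\<Sum>c\<in>C. measure lborel W)"
  proof (rule sum.cong[OF refl])
    fix c
    show "measure lborel (?T c) = measure lborel W"
      using measure_translation[of "gridpt s c" W] T[of c] W(1) by (simp add: measure_completion)
  qed
  finally show ?thesis by simp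
qed

lemma floor_grid:
  fixes x :: real
  assumes "0 < r" "0 \<le> x" "x < r * real N"
  shows "nat \<lfloor>x / r\<rfloor> < N" "r * real (nat \<lfloor>x / r\<rfloor>) \<le> x" "x < r * real (nat \<lfloor>x / r\<rfloor>) + r"
proof -
  define d where "d = nat \<lfloor>x / r\<rfloor>"
  have "0 \<le> \<lfloor>x / r\<rfloor>" using assms by simp
  then have "real d = of_int \<lfloor>x / r\<rfloor>" by (simp add: d_def)
  then have "real d \<le> x / r" "x / r < real d + 1" by linarith+
  then have d: "r * real d \<le> x" "x < r * real d + r" using assms(1) by (auto simp: field_simps)
  then have "r * real d < r * real N" using assms by linarith
  then have "d < N" using assms(1) by simp
  with d show "nat \<lfloor>x / r\<rfloor> < N" "r * real (nat \<lfloor>x / r\<rfloor>) \<le> x" "x < r * real (nat \<lfloor>x / r\<rfloor>) + r"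
    by (auto simp: d_def)
qed

text \<open>\<open>1 / 2 ^ (p - q)\<close> is the mesh of the coarsest scale and a multiple of all
  finer meshes, so it is a common period of the patterns of all scales.\<close>

lemma seen_translate:
  fixes x :: "real ^ 'n"
  assumes q: "q \<le> p" and x: "x - gridpt (1 / 2 ^ (p - q)) c \<in> seen p q m"
  shows "x \<in> seen p q m"
proof -
  let ?s = "1 / (2::real) ^ (p - q)"
  obtain k d where k: "k < m" and d: "\<And>j. 2 ^ q * rad p q k * real (d j) + rad p q k \<le> x $ j - ?s * real (c j)
     \<and> x $ j - ?s * real (c j) < 2 ^ q * rad p q k * real (d j) + 2 * rad p q k"
    using x by (auto simp: seen_def gridpt_def)
  have "p + q * k = q + (p - q) + q * k" using q by simp
  then have "(2::real) ^ (p + q * k) = 2 ^ q * 2 ^ (p - q) * 2 ^ (q * k)" by (metis power_add)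
  then have r2: "2 ^ q * rad p q k * real (2 ^ (q * k) * c j) = ?s * real (c j)" for j
    by (simp add: rad_def)
  have "2 ^ q * rad p q k * real (d j + 2 ^ (q * k) * c j) + rad p q k \<le> x $ j
     \<and> x $ j < 2 ^ q * rad p q k * real (d j + 2 ^ (q * k) * c j) + 2 * rad p q k" for j
    using d[of j] r2[of j] by (simp only: of_nat_add distrib_left) linarith
  then show ?thesis using k unfolding seen_def
    by (intro CollectI exI[of _ k] conjI exI[of _ "\<lambda>j. d j + 2 ^ (q * k) * c j"]) auto
qed

text \<open>Raising \<open>p\<close> by \<open>q\<close> drops the coarsest scale. This is the
  recursion behind \<open>unseen_cell\<close>.\<close>

lemma seen_Suc: "seen (p + q) q m \<subseteq> seen p q (Suc m)"
proof -
  have "rad (p + q) q k = rad p q (Suc k)" for k by (simp add: rad_def algebra_simps)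
  then show ?thesis unfolding seen_def by (auto intro: Suc_mono)
qed

text \<open>The digits at different scales are independent. A cell of the coarsest grid splits into
  \<open>2 ^ (q * n)\<close> subcells of side \<open>1 / 2 ^ p\<close>; one of them is seen at once,
  and each of the others poses the same problem with one scale fewer.\<close>

lemma unseen_cell:
  assumes q: "q \<le> p" and "0 < q"
  shows "measure lborel (hcube 0 (1 / 2 ^ (p - q)) - seen p q m :: (real ^ 'n) set)
     \<le> (1 / 2 ^ (p - q)) ^ CARD('n) * (1 - 1 / (2 ^ q) ^ CARD('n)) ^ m"
  using q(1)
proof (induction m arbitrary: p)
  case 0
  have "(seen p q 0 :: (real ^ 'n) set) = {}" by (simp add: seen_def)
  then show ?case by (simp add: measure_hcube)
next
  case (Suc m)
  let ?n = "CARD('n)" and ?N = "2 ^ q :: nat" and ?r = "1 / (2::real) ^ p"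
  let ?X = "hcube 0 (1 / 2 ^ (p - q)) - seen p q (Suc m) :: (real ^ 'n) set"
  let ?W = "hcube 0 ?r - seen (p + q) q m :: (real ^ 'n) set"
  let ?C = "{c :: 'n \<Rightarrow> nat. \<forall>j. c j < ?N} - {\<lambda>j. 1}"
  have sr: "1 / 2 ^ (p - q) = ?r * real ?N"
  proof -
    have "(2::real) ^ p = 2 ^ q * 2 ^ (p - q)" using Suc.prems by (simp flip: power_add)
    then show ?thesis by simp
  qed
  have r0: "0 < ?r" by simp
  have "\<exists>c\<in>?C. x - gridpt ?r c \<in> ?W" if x: "x \<in> ?X" for x
  proof -
    define c where "c = (\<lambda>j. nat \<lfloor>x $ j / ?r\<rfloor>)"
    have c: "c j < ?N" "?r * real (c j) \<le> x $ j" "x $ j < ?r * real (c j) + ?r" for j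
      using x floor_grid[OF r0, of "x $ j" ?N] unfolding c_def by (auto simp: hcube_def sr)
    \<comment> \<open>The subcell with all digits 1 is the middle third of the base of a hole of
      scale 0.\<close>
    have "c \<noteq> (\<lambda>j. 1)"
    proof
      assume "c = (\<lambda>j. 1)"
      then have "\<forall>j. 2 ^ q * rad p q 0 * real 0 + rad p q 0 \<le> x $ j \<and> x $ j < 2 ^ q * rad p q 0 * real 0 + 2 * rad p q 0"
        using c(2,3) by (simp add: rad_def)
      then have "x \<in> seen p q (Suc m)" unfolding seen_def by (intro CollectI exI[of _ 0] conjI exI[of _ "\<lambda>_. 0"]) auto
      then show False using x by simp
    qed
    moreover have "x - gridpt ?r c \<in> hcube 0 ?r" using c by (simp add: hcube_def gridpt_def algebra_simps)
    moreover have "x - gridpt ?r c \<notin> seen (p + q) q m"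
      using seen_translate[of q "p + q" x c m] seen_Suc[of p q m] x by auto
    ultimately show ?thesis using c(1) by (intro bexI[of _ c]) auto
  qed
  then have "measure lborel ?X \<le> real (card ?C) * measure lborel ?W"
    by (intro measure_grid_union_le) (auto intro!: sets.Diff seen_borel bounded_subset[OF bounded_hcube] simp: finite_grid)
  also have "\<dots> \<le> real (?N ^ ?n - 1) * (?r ^ ?n * (1 - 1 / (2 ^ q) ^ ?n) ^ m)"
  proof -
    have "(1::nat) < 2 ^ q" using \<open>0 < q\<close> by (intro one_less_power) auto
    then have "card ?C = ?N ^ ?n - 1" using card_grid[of ?N, where 'n = 'n] by (simp add: finite_grid card_Diff_singleton)
    moreover have "measure lborel ?W \<le> ?r ^ ?n * (1 - 1 / (2 ^ q) ^ ?n) ^ m" using Suc.IH[of "p + q"] by simp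
    ultimately show ?thesis by (simp add: mult_left_mono)
  qed
  also have "real (?N ^ ?n - 1) = (2 ^ q) ^ ?n * (1 - 1 / (2 ^ q) ^ ?n)"
    by (simp add: of_nat_diff algebra_simps)
  also have "(2 ^ q) ^ ?n * (1 - 1 / (2 ^ q) ^ ?n) * (?r ^ ?n * (1 - 1 / (2 ^ q) ^ ?n) ^ m)
     = (?r * real ?N) ^ ?n * (1 - 1 / (2 ^ q) ^ ?n) ^ Suc m" by (simp only: power_mult_distrib power_Suc of_nat_power of_nat_numeral mult.commute mult.left_commute mult.assoc)
  finally show ?case by (simp only: sr)
qed

lemma unseen_bound:
  assumes q: "q \<le> p" "0 < q"
  shows "measure lborel (hcube 0 1 - seen p q m :: (real ^ 'n) set) \<le> (1 - 1 / (2 ^ q) ^ CARD('n)) ^ m"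
proof -
  let ?n = "CARD('n)" and ?s = "1 / (2::real) ^ (p - q)" and ?M = "2 ^ (p - q) :: nat"
  let ?W = "hcube 0 ?s - seen p q m :: (real ^ 'n) set"
  let ?C = "{c :: 'n \<Rightarrow> nat. \<forall>j. c j < ?M}"
  have s0: "0 < ?s" by simp
  have "\<exists>c\<in>?C. x - gridpt ?s c \<in> ?W" if x: "x \<in> hcube 0 1 - seen p q m" for x
  proof -
    define c where "c = (\<lambda>j. nat \<lfloor>x $ j / ?s\<rfloor>)"
    have c: "c j < ?M" "?s * real (c j) \<le> x $ j" "x $ j < ?s * real (c j) + ?s" for j
      using x floor_grid[OF s0, of "x $ j" ?M] unfolding c_def by (auto simp: hcube_def)
    moreover have "x - gridpt ?s c \<in> hcube 0 ?s" using c by (simp add: hcube_def gridpt_def algebra_simps)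
    moreover have "x - gridpt ?s c \<notin> seen p q m"
      using seen_translate[OF q(1), of x c m] x by auto
    ultimately show ?thesis by (intro bexI[of _ c]) auto
  qed
  then have "measure lborel (hcube 0 1 - seen p q m :: (real ^ 'n) set) \<le> real (card ?C) * measure lborel ?W"
    by (intro measure_grid_union_le) (auto intro!: sets.Diff seen_borel bounded_subset[OF bounded_hcube] simp: finite_grid)
  also have "\<dots> \<le> real (card ?C) * (?s ^ ?n * (1 - 1 / (2 ^ q) ^ ?n) ^ m)"
    by (intro mult_left_mono unseen_cell q) auto
  also have "\<dots> = (1 - 1 / (2 ^ q) ^ ?n) ^ m"
    by (simp add: card_grid power_divide)
  finally show ?thesis .
qed

text \<open>Once \<open>q i\<close> is fixed, \<open>m i\<close> is taken so large that the unseen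
  part of level \<open>i\<close> has measure at most \<open>(1 / 2) ^ i\<close>, and
  \<open>p\<close> is then defined recursively to lie beyond everything used by the previous
  levels.\<close>

lemma scales_exist:
  obtains p q m :: "nat \<Rightarrow> nat" where
    "\<And>i. 2 \<le> q i \<and> q0 + i \<le> q i \<and> q i \<le> p i" "\<And>i. 1 \<le> m i"
    "\<And>i k. i < k \<Longrightarrow> 2 + 2 * k + p i + q i * m i \<le> p k"
    "\<And>i. measure lborel (hcube 0 1 - seen (p i) (q i) (m i) :: (real ^ 'n) set) \<le> (1 / 2) ^ i"
proof -
  define q where "q = (\<lambda>i. q0 + i + 2)"
  have "\<exists>m\<ge>1. (1 - 1 / (2 ^ q i) ^ CARD('n)) ^ m \<le> ((1 / 2) ^ i :: real)" for i
  proof -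
    define \<theta> where "\<theta> = 1 - 1 / ((2::real) ^ q i) ^ CARD('n)"
    have "(1::real) \<le> (2 ^ q i) ^ CARD('n)" by simp
    then have "0 \<le> \<theta>" "\<theta> < 1" by (auto simp: \<theta>_def)
    then have "(\<lambda>m. \<theta> ^ m) \<longlonglongrightarrow> 0" by (intro LIMSEQ_realpow_zero)
    then have "eventually (\<lambda>m. \<theta> ^ m < (1 / 2) ^ i) sequentially" by (rule order_tendstoD) simp
    then obtain m0 where m0: "\<And>m. m0 \<le> m \<Longrightarrow> \<theta> ^ m < (1 / 2) ^ i" by (auto simp: eventually_sequentially)
    from m0[of "Suc m0"] have "\<theta> ^ Suc m0 \<le> (1 / 2) ^ i" by simp
    then show ?thesis unfolding \<theta>_def by (intro exI[of _ "Suc m0"]) simp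
  qed
  then obtain m where m: "\<And>i. 1 \<le> m i" "\<And>i. (1 - 1 / (2 ^ q i) ^ CARD('n)) ^ m i \<le> ((1 / 2) ^ i :: real)" by metis
  define p where "p = rec_nat (q 0) (\<lambda>i pi. pi + q i * m i + 2 + 2 * Suc i + q (Suc i))"
  have p0: "p 0 = q 0" and pS: "p (Suc i) = p i + q i * m i + 2 + 2 * Suc i + q (Suc i)" for i
    by (auto simp: p_def)
  have qp: "q i \<le> p i" for i by (cases i) (auto simp: p0 pS)
  have sep: "2 + 2 * k + p i + q i * m i \<le> p k" if "i < k" for i k
    using that
  proof (induction k)
    case (Suc k)
    show ?case
    proof (cases "i = k")
      case False
      then have "2 + 2 * k + p i + q i * m i \<le> p k" using Suc by simp
      then show ?thesis unfolding pS by linarith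
    qed (simp add: pS)
  qed simp
  show ?thesis
  proof (rule that[of q p m])
    show "2 \<le> q i \<and> q0 + i \<le> q i \<and> q i \<le> p i" for i using qp[of i] by (simp add: q_def)
    show "measure lborel (hcube 0 1 - seen (p i) (q i) (m i) :: (real ^ 'n) set) \<le> (1 / 2) ^ i" for i
      by (rule order_trans[OF unseen_bound[OF qp] m(2)]) (simp add: q_def)
  qed (use m sep in auto)
qed

section \<open>Graphs over the central cube\<close>

definition core :: "(real ^ 'n) set" where
  "core = cbox (\<chi> j. 1 / 4) (\<chi> j. 3 / 4)"

lemma mem_core: "x \<in> core \<longleftrightarrow> (\<forall>j. 1 / 4 \<le> x $ j \<and> x $ j \<le> 3 / 4)"
  by (auto simp: core_def mem_box_cart)

lemma core_subset_hcube: "core \<subseteq> hcube 0 1"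
proof
  fix x :: "real ^ 'a" assume x: "x \<in> core"
  have "0 \<le> x $ j \<and> x $ j < 1" for j
  proof -
    have "1 / 4 \<le> x $ j" "x $ j \<le> 3 / 4" using x by (auto simp: mem_core)
    then show ?thesis by linarith
  qed
  then show "x \<in> hcube 0 1" by (simp add: hcube_def)
qed

lemma measure_core: "measure lborel (core :: (real ^ 'n) set) = (1 / 2) ^ CARD('n)"
  unfolding core_def by (subst content_cbox_cart) (auto simp: interval_ne_empty_cart power_divide)

text \<open>The extension falls off more steeply than the admitted affine functions, so that the
  positive parts of its differences with them have compact support.\<close>

definition core_ext :: "real \<Rightarrow> (real ^ 'n \<Rightarrow> real) \<Rightarrow> real ^ 'n \<Rightarrow> real" where
  "core_ext \<epsilon> h x = h (\<chi> j. clip (1 / 4) (3 / 4) (x $ j)) - 2 * \<epsilon> * (\<Sum>j\<in>UNIV. \<bar>x $ j - clip (1 / 4) (3 / 4) (x $ j)\<bar>)"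

lemma core_ext_core: "x \<in> core \<Longrightarrow> core_ext \<epsilon> h x = h x"
proof -
  assume "x \<in> core"
  then have "clip (1 / 4) (3 / 4) (x $ j) = x $ j" for j by (auto simp: mem_core clip_def)
  then show ?thesis by (simp add: core_ext_def)
qed

text \<open>The coordinatewise projection to \<open>core\<close> does not increase distances, which
  keeps the constant \<epsilon> of \<open>h\<close>, and the penalty term adds
  \<open>2 * \<epsilon>\<close>.\<close>

lemma l1_lipschitz_core_ext:
  assumes h: "\<And>x y. x \<in> core \<Longrightarrow> y \<in> core \<Longrightarrow> \<bar>h x - h y\<bar> \<le> \<epsilon> * (\<Sum>j\<in>UNIV. \<bar>x $ j - y $ j\<bar>)" and e: "0 \<le> \<epsilon>"
  shows "l1_lipschitz (3 * \<epsilon>) (core_ext \<epsilon> h)"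
  unfolding l1_lipschitz_def
proof (intro allI)
  fix x y :: "real ^ 'a"
  let ?c = "clip (1 / 4) (3 / 4)"
  let ?p = "\<lambda>x :: real ^ 'a. (\<chi> j. ?c (x $ j)) :: real ^ 'a"
  let ?S = "\<Sum>j\<in>UNIV. \<bar>x $ j - y $ j\<bar>"
  have c: "?p x \<in> core" for x by (auto simp: mem_core clip_def)
  have "\<bar>h (?p x) - h (?p y)\<bar> \<le> \<epsilon> * (\<Sum>j\<in>UNIV. \<bar>?c (x $ j) - ?c (y $ j)\<bar>)"
    using h[OF c c, of x y] by simp
  also have "\<dots> \<le> \<epsilon> * ?S" by (intro mult_left_mono sum_mono abs_clip_diff_le e)
  finally have 1: "\<bar>h (?p x) - h (?p y)\<bar> \<le> \<epsilon> * ?S" .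
  have "\<bar>(\<Sum>j\<in>UNIV. \<bar>x $ j - ?c (x $ j)\<bar>) - (\<Sum>j\<in>UNIV. \<bar>y $ j - ?c (y $ j)\<bar>)\<bar>
      = \<bar>\<Sum>j\<in>UNIV. \<bar>x $ j - ?c (x $ j)\<bar> - \<bar>y $ j - ?c (y $ j)\<bar>\<bar>" by (simp add: sum_subtractf)
  also have "\<dots> \<le> (\<Sum>j\<in>UNIV. \<bar>\<bar>x $ j - ?c (x $ j)\<bar> - \<bar>y $ j - ?c (y $ j)\<bar>\<bar>)" by (rule sum_abs)
  also have "\<dots> \<le> ?S"
  proof (rule sum_mono)
    fix j show "\<bar>\<bar>x $ j - ?c (x $ j)\<bar> - \<bar>y $ j - ?c (y $ j)\<bar>\<bar> \<le> \<bar>x $ j - y $ j\<bar>"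
      by (auto simp: clip_def max_def min_def abs_if)
  qed
  finally have "2 * \<epsilon> * \<bar>(\<Sum>j\<in>UNIV. \<bar>x $ j - ?c (x $ j)\<bar>) - (\<Sum>j\<in>UNIV. \<bar>y $ j - ?c (y $ j)\<bar>)\<bar> \<le> 2 * \<epsilon> * ?S"
    using e by (intro mult_left_mono) auto
  then have 2: "\<bar>2 * \<epsilon> * (\<Sum>j\<in>UNIV. \<bar>x $ j - ?c (x $ j)\<bar>) - 2 * \<epsilon> * (\<Sum>j\<in>UNIV. \<bar>y $ j - ?c (y $ j)\<bar>)\<bar> \<le> 2 * \<epsilon> * ?S"
    using e by (simp add: abs_mult flip: right_diff_distrib)
  show "\<bar>core_ext \<epsilon> h x - core_ext \<epsilon> h y\<bar> \<le> 3 * \<epsilon> * ?S"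
    using 1 2 unfolding core_ext_def by linarith
qed

lemma l1_lipschitz_affine:
  fixes a :: "real ^ 'n"
  assumes a: "\<And>j. \<bar>a $ j\<bar> \<le> \<epsilon>"
  shows "\<bar>(a \<bullet> x + \<beta>) - (a \<bullet> y + \<beta>)\<bar> \<le> \<epsilon> * (\<Sum>j\<in>UNIV. \<bar>x $ j - y $ j\<bar>)"
proof -
  have "(a \<bullet> x + \<beta>) - (a \<bullet> y + \<beta>) = (\<Sum>j\<in>UNIV. a $ j * (x $ j - y $ j))"
    by (simp add: inner_vec_def sum_subtractf algebra_simps)
  also have "\<bar>\<dots>\<bar> \<le> (\<Sum>j\<in>UNIV. \<bar>a $ j * (x $ j - y $ j)\<bar>)" by (rule sum_abs)
  also have "\<dots> \<le> (\<Sum>j\<in>UNIV. \<epsilon> * \<bar>x $ j - y $ j\<bar>)"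
    unfolding abs_mult by (intro sum_mono mult_right_mono a) auto
  finally show ?thesis by (simp add: sum_distrib_left)
qed

text \<open>With \<open>S\<close> the 1-norm of \<open>x\<close>, the extension is at most
  \<open>\<epsilon> - 2 * \<epsilon> * (S - n)\<close> and the affine function at least
  \<open>- \<epsilon> * S - (n + 2) * \<epsilon>\<close>. The difference is at most
  \<open>\<epsilon> * (3 * n + 3 - S)\<close>, hence the radius \<open>3 * n + 3\<close>.\<close>

lemma core_ext_below_affine:
  fixes a :: "real ^ 'n"
  assumes h: "\<And>x. x \<in> core \<Longrightarrow> \<bar>h x\<bar> \<le> \<epsilon>" and e: "0 \<le> \<epsilon>" and a: "\<And>j. \<bar>a $ j\<bar> \<le> \<epsilon>"
    and \<beta>: "\<bar>\<beta>\<bar> \<le> (real CARD('n) + 2) * \<epsilon>" and x: "3 * real CARD('n) + 3 < \<bar>x $ j\<bar>"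
  shows "core_ext \<epsilon> h x - (a \<bullet> x + \<beta>) \<le> 0"
proof -
  let ?c = "clip (1 / 4) (3 / 4)" and ?n = "real CARD('n)"
  let ?S = "\<Sum>j\<in>UNIV. \<bar>x $ j\<bar>"
  have "(\<chi> j. ?c (x $ j)) \<in> (core :: (real ^ 'n) set)" by (auto simp: mem_core clip_def)
  then have 1: "h (\<chi> j. ?c (x $ j)) \<le> \<epsilon>" using h by (auto simp: abs_le_iff)
  have "?S - ?n = (\<Sum>j\<in>(UNIV::'n set). \<bar>x $ j\<bar> - 1)" by (simp add: sum_subtractf)
  also have "\<dots> \<le> (\<Sum>j\<in>UNIV. \<bar>x $ j - ?c (x $ j)\<bar>)" by (intro sum_mono) (auto simp: clip_def)
  finally have 2: "2 * \<epsilon> * (?S - ?n) \<le> 2 * \<epsilon> * (\<Sum>j\<in>UNIV. \<bar>x $ j - ?c (x $ j)\<bar>)"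
    using e by (intro mult_left_mono) auto
  have 3: "\<bar>a \<bullet> x\<bar> \<le> \<epsilon> * ?S" using l1_lipschitz_affine[of a \<epsilon> x 0 0, OF a] by simp
  have "\<bar>x $ j\<bar> \<le> ?S" by (rule member_le_sum) auto
  then have "\<epsilon> * (3 * ?n + 3) \<le> \<epsilon> * ?S" using x e by (intro mult_left_mono) auto
  then show ?thesis using 1 2 3 \<beta> unfolding core_ext_def by (simp add: algebra_simps)
qed

text \<open>The bound of \<open>loss_total\<close> with \<open>H = 3 * \<epsilon>\<close>,
  \<open>K = 4 * \<epsilon>\<close>, \<open>b = 3 * n + 3\<close> and \<open>e0 = 0\<close>.\<close>

definition loss_const :: "real \<Rightarrow> nat \<Rightarrow> nat \<Rightarrow> real" where
  "loss_const \<epsilon> q0 n = 3 ^ n * (256 * real n * 2 ^ n * (real n * ((3 * \<epsilon>)\<^sup>2 * (2 * (3 * real n + 3 + 2)) ^ n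
      + 8 * (4 * \<epsilon>) / 2 ^ 0 * (2 * (3 * real n + 3)) ^ n)) + 4 / 2 ^ q0)"

text \<open>The energy part tends to 0 with \<epsilon>, the volume part as \<open>q0\<close> grows.
  \<open>(1 / 2) ^ n\<close> is the measure of \<open>core\<close>, so the holes will not exhaust
  it; the second condition is the one on \<open>K\<close> in \<open>hit_cell_bound\<close>.\<close>

lemma loss_const_small:
  obtains \<epsilon> q0 where "0 < \<epsilon>" "4 * \<epsilon> * (6 * real n) \<le> 1" "loss_const \<epsilon> q0 n < (1 / 2) ^ n"
proof -
  have "((\<lambda>\<epsilon>. 3 ^ n * (256 * real n * 2 ^ n * (real n * ((3 * \<epsilon>)\<^sup>2 * (2 * (3 * real n + 3 + 2)) ^ n
      + 8 * (4 * \<epsilon>) / 2 ^ 0 * (2 * (3 * real n + 3)) ^ n)))) \<longlongrightarrow> 0) (at_right 0)"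
    by (rule tendsto_eq_rhs, (rule tendsto_intros | simp)+)
  then have 1: "eventually (\<lambda>\<epsilon>. 3 ^ n * (256 * real n * 2 ^ n * (real n * ((3 * \<epsilon>)\<^sup>2 * (2 * (3 * real n + 3 + 2)) ^ n
      + 8 * (4 * \<epsilon>) / 2 ^ 0 * (2 * (3 * real n + 3)) ^ n))) < (1 / 2) ^ n / 2) (at_right 0)"
    by (rule order_tendstoD) simp
  have "((\<lambda>\<epsilon>. 4 * \<epsilon> * (6 * real n)) \<longlongrightarrow> 0) (at_right 0)"
    by (rule tendsto_eq_rhs, (rule tendsto_intros | simp)+)
  then have 2: "eventually (\<lambda>\<epsilon>. 4 * \<epsilon> * (6 * real n) < 1) (at_right 0)"
    by (rule order_tendstoD) simp
  have 3: "eventually (\<lambda>\<epsilon>. (0::real) < \<epsilon>) (at_right 0)" by (rule eventually_at_right_less)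
  from eventually_conj[OF 1 eventually_conj[OF 2 3]] obtain \<epsilon> where
    e: "3 ^ n * (256 * real n * 2 ^ n * (real n * ((3 * \<epsilon>)\<^sup>2 * (2 * (3 * real n + 3 + 2)) ^ n
      + 8 * (4 * \<epsilon>) / 2 ^ 0 * (2 * (3 * real n + 3)) ^ n))) < (1 / 2) ^ n / 2" "4 * \<epsilon> * (6 * real n) < 1" "0 < \<epsilon>"
    using eventually_happens'[OF trivial_limit_at_right_real] by blast
  have "(\<lambda>q0. 3 ^ n * 4 * (1 / 2 :: real) ^ q0) \<longlonglongrightarrow> 3 ^ n * 4 * 0"
    by (intro tendsto_intros LIMSEQ_realpow_zero) auto
  then have "eventually (\<lambda>q0. 3 ^ n * 4 * (1 / 2 :: real) ^ q0 < (1 / 2) ^ n / 2) sequentially"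
    by (rule order_tendstoD) simp
  then obtain q0 where "3 ^ n * 4 * (1 / 2 :: real) ^ q0 < (1 / 2) ^ n / 2"
    by (auto simp: eventually_sequentially)
  then have "3 ^ n * (4 / 2 ^ q0) < ((1 / 2) ^ n / 2 :: real)" by (simp add: power_divide)
  with e(1) have "loss_const \<epsilon> q0 n < (1 / 2) ^ n" unfolding loss_const_def distrib_left by simp
  then show ?thesis using that[of \<epsilon> q0] e by simp
qed

text \<open>On \<open>core\<close> the extension agrees with \<open>h\<close>, so
  \<open>loss_total\<close> applies to it. As its bound is the same for any number of levels, it
  survives the increasing limit over all of them.\<close>

lemma loss_core:
  fixes h :: "real ^ 'n \<Rightarrow> real" and p q m :: "nat \<Rightarrow> nat" and a :: "nat \<Rightarrow> real ^ 'n" and \<beta> :: "nat \<Rightarrow> real"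
  assumes n: "3 \<le> CARD('n)" and e: "0 < \<epsilon>" "4 * \<epsilon> * (6 * real CARD('n)) \<le> 1"
    and hL: "\<And>x y. x \<in> core \<Longrightarrow> y \<in> core \<Longrightarrow> \<bar>h x - h y\<bar> \<le> \<epsilon> * (\<Sum>j\<in>UNIV. \<bar>x $ j - y $ j\<bar>)"
    and hb: "\<And>x. x \<in> core \<Longrightarrow> \<bar>h x\<bar> \<le> \<epsilon>"
    and a: "\<And>i j. \<bar>a i $ j\<bar> \<le> \<epsilon>" and \<beta>: "\<And>i. \<bar>\<beta> i\<bar> \<le> (real CARD('n) + 2) * \<epsilon>"
    and q: "\<And>i. 2 \<le> q i \<and> q0 + i \<le> q i \<and> q i \<le> p i" and m: "\<And>i. 1 \<le> m i"
    and sep: "\<And>i k. i < k \<Longrightarrow> 2 + 2 * k + p i + q i * m i \<le> p k"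
  shows "\<exists>L\<in>sets lborel. measure lborel L \<le> loss_const \<epsilon> q0 CARD('n) \<and> emeasure lborel L < \<infinity> \<and>
     {y \<in> core. \<exists>i. y \<in> level_holes (p i) (q i) (m i) (\<lambda>y. h y - (a i \<bullet> y + \<beta> i))} \<subseteq> L"
proof -
  let ?h = "core_ext \<epsilon> h"
  define g where "g = (\<lambda>i y. ?h y - (a i \<bullet> y + \<beta> i))"
  define A where "A = (\<lambda>I. hcube 0 1 \<inter> (\<Union>i<I. level_holes (p i) (q i) (m i) (g i)))"
  define L where "L = (\<Union>I. A I)"
  have hl: "l1_lipschitz (3 * \<epsilon>) ?h" using hL e by (intro l1_lipschitz_core_ext) auto
  have gl: "l1_lipschitz (4 * \<epsilon>) (g i)" for i
    unfolding l1_lipschitz_def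
  proof (intro allI)
    fix x y :: "real ^ 'n"
    have 1: "\<bar>?h x - ?h y\<bar> \<le> 3 * \<epsilon> * (\<Sum>j\<in>UNIV. \<bar>x $ j - y $ j\<bar>)" using hl by (simp add: l1_lipschitz_def)
    have "\<bar>g i x - g i y\<bar> \<le> \<bar>?h x - ?h y\<bar> + \<bar>(a i \<bullet> x + \<beta> i) - (a i \<bullet> y + \<beta> i)\<bar>"
      unfolding g_def by linarith
    also have "\<dots> \<le> 3 * \<epsilon> * (\<Sum>j\<in>UNIV. \<bar>x $ j - y $ j\<bar>) + \<epsilon> * (\<Sum>j\<in>UNIV. \<bar>x $ j - y $ j\<bar>)"
      by (intro add_mono 1 l1_lipschitz_affine a)
    finally show "\<bar>g i x - g i y\<bar> \<le> 4 * \<epsilon> * (\<Sum>j\<in>UNIV. \<bar>x $ j - y $ j\<bar>)" by simp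
  qed
  have gc: "continuous_on UNIV (g i)" for i by (rule l1_lipschitz_continuous[OF gl])
  have A: "A I \<in> sets lborel" for I
    unfolding A_def using open_level_holes[OF gc] by (auto intro!: sets.Int)
  have fmA: "A I \<in> fmeasurable lborel" for I
    by (rule fmeasurableI2[OF hcube_fmeasurable[of 0 1]]) (use A in \<open>auto simp: A_def\<close>)
  have Ab: "measure lborel (A I) \<le> loss_const \<epsilon> q0 CARD('n)" for I
    unfolding A_def g_def loss_const_def
  proof (rule loss_total[where K = "4 * \<epsilon>"])
    fix i and x :: "real ^ 'n" and j assume "3 * real CARD('n) + 3 < \<bar>x $ j\<bar>"
    then show "?h x - (a i \<bullet> x + \<beta> i) \<le> 0"
      using hb e a \<beta> by (intro core_ext_below_affine) auto
  qed (use n e q m sep hl gl in \<open>auto simp: g_def\<close>)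
  have L: "L \<in> sets lborel" unfolding L_def using A by auto
  have "L \<subseteq> hcube 0 1" by (auto simp: L_def A_def)
  then have fmL: "L \<in> fmeasurable lborel" using L by (intro fmeasurableI2[OF hcube_fmeasurable]) auto
  have "incseq A" unfolding A_def incseq_def by (auto intro: less_le_trans)
  then have "(\<lambda>I. measure lborel (A I)) \<longlonglongrightarrow> measure lborel L"
    unfolding L_def using A fmL by (intro Lim_measure_incseq) (auto simp: L_def fmeasurable_def)
  then have "measure lborel L \<le> loss_const \<epsilon> q0 CARD('n)"
    by (rule LIMSEQ_le_const2) (use Ab in auto)
  moreover have "{y \<in> core. \<exists>i. y \<in> level_holes (p i) (q i) (m i) (\<lambda>y. h y - (a i \<bullet> y + \<beta> i))} \<subseteq> L"
  proof
    fix y assume "y \<in> {y \<in> core. \<exists>i. y \<in> level_holes (p i) (q i) (m i) (\<lambda>y. h y - (a i \<bullet> y + \<beta> i))}"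
    then obtain i where y: "y \<in> core" "y \<in> level_holes (p i) (q i) (m i) (\<lambda>y. h y - (a i \<bullet> y + \<beta> i))" by blast
    then have "y \<in> level_holes (p i) (q i) (m i) (g i)"
      by (auto simp: level_holes_def holes_def g_def core_ext_core)
    then have "y \<in> A (Suc i)" using y core_subset_hcube by (auto simp: A_def)
    then show "y \<in> L" by (auto simp: L_def)
  qed
  ultimately show ?thesis using L fmL by (intro bexI[of _ L]) (auto simp: fmeasurable_def)
qed

subsection \<open>Bounded functionals and biorthogonal systems\<close>

definition sublinear :: "('a::real_vector \<Rightarrow> real) \<Rightarrow> bool" where
  "sublinear p \<longleftrightarrow> (\<forall>x y. p (x + y) \<le> p x + p y) \<and> (\<forall>c x. 0 \<le> c \<longrightarrow> p (c *\<^sub>R x) = c * p x)"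

lemma sublinear_add: "sublinear p \<Longrightarrow> p (x + y) \<le> p x + p y"
  and sublinear_scale: "sublinear p \<Longrightarrow> 0 \<le> c \<Longrightarrow> p (c *\<^sub>R x) = c * p x"
  by (auto simp: sublinear_def)

lemma sublinear_0: "sublinear p \<Longrightarrow> p 0 = 0"
  using sublinear_scale[of p 0 0] by simp

lemma sublinear_minus: "sublinear p \<Longrightarrow> - p (- x) \<le> p x"
  using sublinear_add[of p x "- x"] sublinear_0[of p] by simp

text \<open>A sublinear functional that is minimal, hence fixed by \<open>flatten_along z\<close> for all \<open>z\<close>, is
  linear. This replaces the usual extension argument for Hahn--Banach.\<close>

definition flatten_along :: "'a::real_vector \<Rightarrow> ('a \<Rightarrow> real) \<Rightarrow> 'a \<Rightarrow> real" where
  "flatten_along z p x = (INF t\<in>{0..}. p (x + t *\<^sub>R z) - t * p z)"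

lemma flatten_along_bdd:
  assumes p: "sublinear p"
  shows "bdd_below ((\<lambda>t. p (x + t *\<^sub>R z) - t * p z) ` {0..})"
proof (rule bdd_belowI2)
  fix t :: real assume "t \<in> {0..}"
  then have "t * p z = p ((x + t *\<^sub>R z) + (- x))" using sublinear_scale[OF p] by simp
  also have "\<dots> \<le> p (x + t *\<^sub>R z) + p (- x)" by (rule sublinear_add[OF p])
  finally show "- p (- x) \<le> p (x + t *\<^sub>R z) - t * p z" by simp
qed

lemma flatten_along_le:
  "sublinear p \<Longrightarrow> 0 \<le> t \<Longrightarrow> flatten_along z p x \<le> p (x + t *\<^sub>R z) - t * p z"
  unfolding flatten_along_def by (intro cINF_lower flatten_along_bdd) auto

lemma flatten_along_ge:
  "(\<And>t. 0 \<le> t \<Longrightarrow> a \<le> p (x + t *\<^sub>R z) - t * p z) \<Longrightarrow> a \<le> flatten_along z p x"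
  unfolding flatten_along_def by (intro cINF_greatest) auto

lemma sublinear_flatten_along:
  assumes p: "sublinear p"
  shows "sublinear (flatten_along z p)"
  unfolding sublinear_def
proof (intro conjI allI impI)
  let ?R = "flatten_along z p"
  fix x y
  have "?R (x + y) - (p (y + s *\<^sub>R z) - s * p z) \<le> ?R x" if s: "0 \<le> s" for s
  proof (rule flatten_along_ge)
    fix t :: real assume t: "0 \<le> t"
    have "?R (x + y) \<le> p ((x + y) + (t + s) *\<^sub>R z) - (t + s) * p z"
      using s t by (intro flatten_along_le p) auto
    also have "(x + y) + (t + s) *\<^sub>R z = (x + t *\<^sub>R z) + (y + s *\<^sub>R z)" by (simp add: algebra_simps)
    also have "p \<dots> \<le> p (x + t *\<^sub>R z) + p (y + s *\<^sub>R z)" by (rule sublinear_add[OF p])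
    finally show "?R (x + y) - (p (y + s *\<^sub>R z) - s * p z) \<le> p (x + t *\<^sub>R z) - t * p z"
      by (simp add: algebra_simps)
  qed
  then have "?R (x + y) - ?R x \<le> ?R y" by (intro flatten_along_ge) (simp add: algebra_simps)
  then show "?R (x + y) \<le> ?R x + ?R y" by simp
next
  let ?R = "flatten_along z p"
  fix c :: real and x assume c: "0 \<le> c"
  have le: "?R (c *\<^sub>R x) \<le> c * ?R x" if c: "0 < c" for c x
  proof -
    have "?R (c *\<^sub>R x) / c \<le> ?R x"
    proof (rule flatten_along_ge)
      fix t :: real assume t: "0 \<le> t"
      have "?R (c *\<^sub>R x) \<le> p (c *\<^sub>R x + (c * t) *\<^sub>R z) - (c * t) * p z"
        using c t by (intro flatten_along_le p) auto
      also have "c *\<^sub>R x + (c * t) *\<^sub>R z = c *\<^sub>R (x + t *\<^sub>R z)" by (simp add: algebra_simps)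
      also have "p \<dots> = c * p (x + t *\<^sub>R z)" using c by (intro sublinear_scale[OF p]) auto
      finally show "?R (c *\<^sub>R x) / c \<le> p (x + t *\<^sub>R z) - t * p z" using c by (simp add: field_simps)
    qed
    then show ?thesis using c by (simp add: field_simps)
  qed
  show "?R (c *\<^sub>R x) = c * ?R x"
  proof (cases "c = 0")
    case True
    have "?R 0 \<le> 0" using flatten_along_le[OF p order_refl, of z 0] sublinear_0[OF p] by simp
    moreover have "0 \<le> ?R 0" using sublinear_scale[OF p] by (intro flatten_along_ge) simp
    ultimately show ?thesis using True by simp
  next
    case False
    then have c: "0 < c" using c by simp
    have "?R x \<le> (1 / c) * ?R (c *\<^sub>R x)" using le[of "1 / c" "c *\<^sub>R x"] c by simp
    with le[OF c, of x] c show ?thesis by (simp add: field_simps)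
  qed
qed

text \<open>The chain condition for Zorn's lemma. The infimum is finite because
  \<open>- p0 (- x)\<close> is a common lower bound, and subadditivity passes to it since of two
  members of a chain one lies below both.\<close>

lemma sublinear_chain_Inf:
  assumes ne: "C \<noteq> {}" and sub: "\<And>p. p \<in> C \<Longrightarrow> sublinear p \<and> p \<le> p0"
    and chain: "\<And>p q. p \<in> C \<Longrightarrow> q \<in> C \<Longrightarrow> p \<le> q \<or> q \<le> p"
  shows "sublinear (\<lambda>x. INF p\<in>C. p x) \<and> (\<forall>p\<in>C. (\<lambda>x. INF p\<in>C. p x) \<le> p)"
proof -
  define u where "u = (\<lambda>x. INF p\<in>C. p x)"
  have bdd: "bdd_below ((\<lambda>p. p x) ` C)" for x
  proof (rule bdd_belowI2)
    fix p assume "p \<in> C"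
    then have "- p (- x) \<le> p x" "p (- x) \<le> p0 (- x)" using sub sublinear_minus by (auto simp: le_fun_def)
    then show "- p0 (- x) \<le> p x" by linarith
  qed
  have low: "u x \<le> p x" if "p \<in> C" for p x unfolding u_def by (rule cINF_lower[OF bdd that])
  have ge: "a \<le> u x" if "\<And>p. p \<in> C \<Longrightarrow> a \<le> p x" for a x unfolding u_def by (rule cINF_greatest[OF ne that])
  have add: "u (x + y) \<le> p x + q y" if pq: "p \<in> C" "q \<in> C" for p q x y
  proof -
    obtain r where r: "r \<in> C" "r \<le> p" "r \<le> q" using chain[OF pq] pq by blast
    have "u (x + y) \<le> r x + r y" using low[OF r(1), of "x + y"] sublinear_add[of r x y] sub[OF r(1)] by linarith
    also have "\<dots> \<le> p x + q y" using r by (intro add_mono) (auto simp: le_fun_def)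
    finally show ?thesis .
  qed
  have "sublinear u"
    unfolding sublinear_def
  proof (intro conjI allI impI)
    fix x y
    have "u (x + y) - q y \<le> u x" if "q \<in> C" for q
      by (rule ge) (use add[OF _ that] in \<open>simp add: algebra_simps\<close>)
    then have "u (x + y) - u x \<le> u y" by (intro ge) (simp add: algebra_simps)
    then show "u (x + y) \<le> u x + u y" by simp
  next
    fix c :: real and x assume c: "0 \<le> c"
    have le: "c * u x \<le> u (c *\<^sub>R x)" if c: "0 \<le> c" for c x
    proof (rule ge)
      fix p assume p: "p \<in> C"
      show "c * u x \<le> p (c *\<^sub>R x)"
        using mult_left_mono[OF low[OF p, of x] c] sublinear_scale[of p c x] sub[OF p] c by simp
    qed
    show "u (c *\<^sub>R x) = c * u x"
    proof (cases "c = 0")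
      case True
      obtain p where p: "p \<in> C" using ne by blast
      have "u 0 \<le> 0" using low[OF p, of 0] sublinear_0[of p] sub[OF p] by simp
      moreover have "0 \<le> u 0" by (rule ge) (use sub sublinear_0 in fastforce)
      ultimately show ?thesis using True by simp
    next
      case False
      then have "(1 / c) * u (c *\<^sub>R x) \<le> u x" using le[of "1 / c" "c *\<^sub>R x"] c by simp
      then show ?thesis using le[OF c, of x] c False by (simp add: field_simps)
    qed
  qed
  then show ?thesis using low by (auto simp: u_def le_fun_def)
qed

lemma exists_separating_functional:
  fixes e :: "'a::real_normed_vector"
  assumes e: "e \<noteq> 0"
  obtains \<phi> :: "'a \<Rightarrow> real" where "bounded_linear \<phi>" "\<phi> e = 1"
proof -
  have N: "sublinear (norm :: 'a \<Rightarrow> real)" by (auto simp: sublinear_def norm_triangle_ineq)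
  define p0 where "p0 = flatten_along e (norm :: 'a \<Rightarrow> real)"
  have p0: "sublinear p0" unfolding p0_def by (rule sublinear_flatten_along[OF N])
  have p0n: "p0 x \<le> norm x" for x using flatten_along_le[OF N, of 0 e x] by (simp add: p0_def)
  \<comment> \<open>This is why the minimal functional is sought below \<open>p0\<close> and not
    below the norm: it forces the functional to be at least \<open>norm e\<close> at
    \<open>e\<close>.\<close>
  have p0e: "p0 (- e) \<le> - norm e" using flatten_along_le[OF N, of 1 e "- e"] by (simp add: p0_def)
  define A where "A = {p. sublinear p \<and> p \<le> p0}"
  let ?P = "\<lambda>p q :: 'a \<Rightarrow> real. q \<le> p"
  have "\<exists>p\<in>A. \<forall>q\<in>A. ?P p q \<longrightarrow> q = p"
  proof (rule predicate_Zorn)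
    show "partial_order_on A (relation_of ?P A)"
      by (rule partial_order_on_relation_ofI) auto
    fix C assume C: "C \<in> Chains (relation_of ?P A)"
    show "\<exists>u\<in>A. \<forall>a\<in>C. ?P a u"
    proof (cases "C = {}")
      case True
      then show ?thesis using p0 by (auto simp: A_def)
    next
      case False
      have CA: "C \<subseteq> A" using C by (auto simp: Chains_def relation_of_def)
      have "sublinear (\<lambda>x. INF p\<in>C. p x) \<and> (\<forall>p\<in>C. (\<lambda>x. INF p\<in>C. p x) \<le> p)"
      proof (rule sublinear_chain_Inf[OF False])
        show "sublinear p \<and> p \<le> p0" if "p \<in> C" for p using that CA by (auto simp: A_def)
        show "p \<le> q \<or> q \<le> p" if "p \<in> C" "q \<in> C" for p q
          using that C by (auto simp: Chains_def relation_of_def)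
      qed
      moreover obtain p where "p \<in> C" using False by blast
      ultimately have "(\<lambda>x. INF p\<in>C. p x) \<in> A" using CA by (auto simp: A_def intro: order_trans)
      with \<open>sublinear _ \<and> _\<close> show ?thesis by blast
    qed
  qed
  then obtain p where p: "sublinear p" "p \<le> p0" and min: "\<And>q. sublinear q \<Longrightarrow> q \<le> p \<Longrightarrow> q = p"
    unfolding A_def by (auto intro: order_trans)
  \<comment> \<open>Flattening \<open>p\<close> along \<open>z\<close> gives something below
    \<open>p\<close>, so by minimality \<open>p\<close> itself; the case \<open>t = 1\<close> of the
    infimum is superadditivity.\<close>
  have ge: "p x + p z \<le> p (x + z)" for x z
  proof -
    have "flatten_along z p = p"
      using flatten_along_le[OF p(1), of 0 z] by (intro min sublinear_flatten_along p) (simp add: le_fun_def)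
    then show ?thesis using flatten_along_le[OF p(1), of 1 z x] by simp
  qed
  have add: "p (x + y) = p x + p y" for x y using ge[of x y] sublinear_add[OF p(1), of x y] by simp
  have neg: "p (- x) = - p x" for x using add[of x "- x"] sublinear_0[OF p(1)] by simp
  have scale: "p (c *\<^sub>R x) = c * p x" for c x
  proof (cases "0 \<le> c")
    case False
    then have "p ((- c) *\<^sub>R x) = (- c) * p x" by (intro sublinear_scale[OF p(1)]) simp
    then show ?thesis using neg[of "c *\<^sub>R x"] by simp
  qed (rule sublinear_scale[OF p(1)])
  have pn: "p x \<le> norm x" for x using p(2) p0n[of x] by (auto simp: le_fun_def intro: order_trans)
  have bl: "bounded_linear p"
  proof (rule bounded_linear_intro[where K = 1])
    show "norm (p x) \<le> norm x * 1" for x using pn[of x] pn[of "- x"] neg[of x] by (simp add: abs_le_iff)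
  qed (auto simp: add scale)
  have "p (- e) \<le> - norm e" using p(2) p0e by (auto simp: le_fun_def intro: order_trans)
  then have "0 < p e" using neg[of e] e by (simp add: order.strict_trans2[of 0 "norm e"])
  then show ?thesis
    using that[of "\<lambda>x. p x / p e"] bounded_linear_compose[OF bounded_linear_divide[of "p e"] bl] by simp
qed

text \<open>While the \<open>x k\<close> do not span the space, some \<open>v\<close> differs from
  its projection by \<open>w \<noteq> 0\<close>, and all previous \<phi> vanish at \<open>w\<close>.
  A functional that is 1 at \<open>w\<close> is corrected by the previous ones so as to vanish at
  all previous \<open>x k\<close>.\<close>

lemma exists_biorthogonal:
  assumes "enat N \<le> vdim TYPE('a::real_normed_vector)"
  shows "\<exists>(\<phi> :: nat \<Rightarrow> 'a \<Rightarrow> real) x. (\<forall>k<N. bounded_linear (\<phi> k)) \<and>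
    (\<forall>k<N. \<forall>l<N. \<phi> k (x l) = (if k = l then 1 else 0))"
  using assms
proof (induction N)
  case (Suc N)
  then have lt: "enat N < vdim TYPE('a)" by (simp add: Suc_ile_eq)
  then obtain \<phi> :: "nat \<Rightarrow> 'a \<Rightarrow> real" and x where bl: "\<And>k. k < N \<Longrightarrow> bounded_linear (\<phi> k)"
    and bi: "\<And>k l. k < N \<Longrightarrow> l < N \<Longrightarrow> \<phi> k (x l) = (if k = l then 1 else 0)"
    using Suc.IH[OF less_imp_le[OF lt]] by blast
  have "\<exists>v. v \<noteq> (\<Sum>k<N. \<phi> k v *\<^sub>R x k)"
  proof (rule ccontr)
    assume "\<not> ?thesis"
    then have eq: "v = (\<Sum>k<N. \<phi> k v *\<^sub>R x k)" for v by blast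
    let ?B = "x ` {..<N}"
    have "v \<in> span ?B" for v
      by (subst eq) (intro span_sum span_scale span_base, auto)
    then have sp: "span ?B = UNIV" by auto
    then have "vdim TYPE('a) = enat (dim (UNIV :: 'a set))" unfolding vdim_def by (auto intro!: exI[of _ ?B])
    moreover have "dim (UNIV :: 'a set) \<le> card ?B" using sp by (intro dim_le_card) auto
    moreover have "card ?B \<le> N" using card_image_le[of "{..<N}" x] by simp
    ultimately show False using lt by simp
  qed
  then obtain v where v: "v \<noteq> (\<Sum>k<N. \<phi> k v *\<^sub>R x k)" by blast
  define w where "w = v - (\<Sum>k<N. \<phi> k v *\<^sub>R x k)"
  have w0: "\<phi> k w = 0" if k: "k < N" for k
  proof -
    interpret bounded_linear "\<phi> k" by (rule bl[OF k])
    have "\<phi> k w = \<phi> k v - (\<Sum>l<N. \<phi> l v * \<phi> k (x l))" by (simp add: w_def diff sum scale)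
    also have "(\<Sum>l<N. \<phi> l v * \<phi> k (x l)) = (\<Sum>l<N. if l = k then \<phi> l v else 0)"
      using bi k by (intro sum.cong) auto
    finally show ?thesis using k by simp
  qed
  have "w \<noteq> 0" using v by (simp add: w_def)
  then obtain \<psi> :: "'a \<Rightarrow> real" where \<psi>: "bounded_linear \<psi>" "\<psi> w = 1"
    by (rule exists_separating_functional)
  define \<phi>' where "\<phi>' = \<phi>(N := \<lambda>u. \<psi> u - (\<Sum>k<N. \<psi> (x k) * \<phi> k u))"
  define x' where "x' = x(N := w)"
  have "bounded_linear (\<phi>' k)" if "k < Suc N" for k
  proof (cases "k = N")
    case True
    have "bounded_linear (\<lambda>u. \<psi> u - (\<Sum>k<N. \<psi> (x k) * \<phi> k u))"
      using bl by (intro bounded_linear_sub \<psi> bounded_linear_sum bounded_linear_compose[OF bounded_linear_mult_right]) auto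
    then show ?thesis using True by (simp add: \<phi>'_def)
  qed (use that bl in \<open>simp add: \<phi>'_def\<close>)
  moreover have "\<phi>' k (x' l) = (if k = l then 1 else 0)" if "k < Suc N" "l < Suc N" for k l
  proof (cases "k = N")
    case True
    show ?thesis
    proof (cases "l = N")
      case True
      then show ?thesis using \<open>k = N\<close> w0 \<psi> by (simp add: \<phi>'_def x'_def)
    next
      case False
      then have l: "l < N" using that by simp
      have "(\<Sum>k<N. \<psi> (x k) * \<phi> k (x l)) = (\<Sum>k<N. if k = l then \<psi> (x k) else 0)"
        using bi l by (intro sum.cong) auto
      then show ?thesis using l \<open>k = N\<close> by (simp add: \<phi>'_def x'_def)
    qed
  next
    case False
    then show ?thesis using that w0 bi by (auto simp: \<phi>'_def x'_def less_Suc_eq)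
  qed
  ultimately show ?case by blast
qed simp

subsection \<open>Baire category for surfaces\<close>

lemma convex_unit_cube: "convex (unit_cube :: (real ^ 'n) set)"
proof -
  have "(unit_cube :: (real ^ 'n) set) = cbox 0 (\<chi> i. 1)" by (auto simp: unit_cube_def mem_box_cart)
  then show ?thesis by (metis convex_box(1))
qed

text \<open>\<open>C1_norm\<close> sees partial derivatives only, so it controls operator norms up
  to the factor \<open>CARD('n)\<close>, which recurs in \<open>lip\<close>.\<close>

lemma bounded_linear_axis_bound:
  fixes D :: "real ^ 'n \<Rightarrow> 'a::real_normed_vector"
  assumes D: "bounded_linear D" and B: "\<And>j. norm (D (axis j 1)) \<le> B"
  shows "norm (D v) \<le> real CARD('n) * B * norm v"
proof -
  interpret bounded_linear D by (rule D)
  have "v = (\<Sum>j\<in>UNIV. (v $ j) *\<^sub>R axis j 1)" by (simp add: basis_expansion flip: scalar_mult_eq_scaleR)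
  then have "D v = (\<Sum>j\<in>UNIV. v $ j *\<^sub>R D (axis j 1))"
    by (metis (no_types, lifting) scaleR sum sum.cong)
  also have "norm \<dots> \<le> (\<Sum>j\<in>(UNIV::'n set). norm v * B)"
  proof (rule sum_norm_le)
    fix j show "norm (v $ j *\<^sub>R D (axis j 1)) \<le> norm v * B"
      unfolding norm_scaleR by (intro mult_mono B) (auto intro: component_le_norm_cart)
  qed
  finally show ?thesis by (simp add: ac_simps)
qed

lemma has_derivative_partial_bound:
  fixes f :: "real ^ 'n \<Rightarrow> 'a::real_normed_vector"
  assumes "C1_on unit_cube f" and f': "(f has_derivative D) (at x within unit_cube)" and x: "x \<in> unit_cube"
  shows "norm (D v) \<le> real CARD('n) * C1_norm f * norm v"
proof (rule bounded_linear_axis_bound)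
  show "bounded_linear D" using f' by (rule has_derivative_bounded_linear)
  fix j
  have "norm (D (axis j 1)) = norm (partial j f x)" using partial_eq[OF f' x] by simp
  also have "\<dots> \<le> sup_norm (partial j f)" by (rule sup_norm_upper[OF C1_on_partial[OF assms(1)] x])
  also have "\<dots> \<le> C1_norm f" by (rule sup_norm_le_C1_norm)
  finally show "norm (D (axis j 1)) \<le> C1_norm f" .
qed

lemma C1_norm_lipschitz:
  fixes f :: "real ^ 'n \<Rightarrow> 'a::real_normed_vector"
  assumes f: "C1_on unit_cube f" and x: "x \<in> unit_cube" "y \<in> unit_cube"
  shows "norm (f x - f y) \<le> real CARD('n) * C1_norm f * norm (x - y)"
proof -
  obtain f' where f': "\<And>x. x \<in> unit_cube \<Longrightarrow> (f has_derivative blinfun_apply (f' x)) (at x within unit_cube)"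
    using f by (auto simp: C1_on_def)
  show ?thesis
  proof (rule differentiable_bound[OF convex_unit_cube f' _ x])
    fix z :: "real ^ 'n" assume z: "z \<in> unit_cube"
    show "onorm (blinfun_apply (f' z)) \<le> real CARD('n) * C1_norm f"
      using C1_norm_nonneg[OF f] has_derivative_partial_bound[OF f f'[OF z] z]
      by (intro onorm_bound) auto
  qed
qed

lemma C1_dist_upper:
  assumes "f \<in> surfaces" "g \<in> surfaces" "x \<in> unit_cube"
  shows "norm (f x - g x) \<le> C1_dist f g"
proof -
  have "norm (f x - g x) \<le> sup_norm (\<lambda>x. f x - g x)"
    using assms by (intro sup_norm_upper[of "\<lambda>x. f x - g x"] C1_on_continuous C1_on_diff) (auto simp: surfaces_def)
  also have "\<dots> \<le> C1_dist f g" using assms by (simp add: C1_dist_def sup_norm_le_C1_norm)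
  finally show ?thesis .
qed

lemma C1_dist_lipschitz:
  fixes f g :: "real ^ 'n \<Rightarrow> 'a::real_normed_vector"
  assumes "f \<in> surfaces" "g \<in> surfaces" "x \<in> unit_cube" "y \<in> unit_cube"
  shows "norm ((f x - g x) - (f y - g y)) \<le> real CARD('n) * C1_dist f g * norm (x - y)"
  using C1_norm_lipschitz[of "\<lambda>x. f x - g x" x y] assms
  by (auto simp: C1_dist_def surfaces_def intro: C1_on_diff)

text \<open>By \<open>has_derivative_partial_bound\<close> a Cauchy sequence of surfaces has
  uniformly Cauchy derivatives. These converge uniformly to a continuous limit, and together with
  convergence at one point this gives a limit with the right derivative.\<close>

lemma mcomplete_surfaces:
  "Metric_space.mcomplete (surfaces :: (real ^ 'n \<Rightarrow> 'a::banach) set) C1_dist"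
proof -
  interpret Metric_space "surfaces :: (real ^ 'n \<Rightarrow> 'a) set" C1_dist by (rule Metric_space_surfaces)
  let ?Q = "unit_cube :: (real ^ 'n) set"
  have "\<exists>g. limitin mtopology F g sequentially" if F: "MCauchy F" for F
  proof -
    have FS: "F k \<in> surfaces" for k using F by (auto simp: MCauchy_def)
    then have C1: "C1_on ?Q (F k)" for k by (auto simp: surfaces_def)
    then have "\<forall>k. \<exists>f'. (\<forall>x\<in>?Q. (F k has_derivative blinfun_apply (f' x)) (at x within ?Q)) \<and> continuous_on ?Q f'"
      by (simp add: C1_on_def)
    then obtain F' where F': "\<And>k x. x \<in> ?Q \<Longrightarrow> (F k has_derivative blinfun_apply (F' k x)) (at x within ?Q)"
      and cF': "\<And>k. continuous_on ?Q (F' k)" by metis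
    have d1: "norm (F k x - F l x) \<le> C1_dist (F k) (F l)" if x: "x \<in> ?Q" for k l x
      by (rule C1_dist_upper[OF FS FS x])
    have d2: "norm (F' k x - F' l x) \<le> real CARD('n) * C1_dist (F k) (F l)" if x: "x \<in> ?Q" for k l x
    proof (rule norm_blinfun_bound)
      show "0 \<le> real CARD('n) * C1_dist (F k) (F l)" by simp
      fix v
      show "norm (blinfun_apply (F' k x - F' l x) v) \<le> real CARD('n) * C1_dist (F k) (F l) * norm v"
        using has_derivative_partial_bound[OF C1_on_diff[OF C1 C1] has_derivative_diff[OF F'[OF x, of k] F'[OF x, of l]] x, of v] FS
        by (simp add: minus_blinfun.rep_eq C1_dist_def)
    qed
    have cau: "\<exists>N. \<forall>k\<ge>N. \<forall>l\<ge>N. C1_dist (F k) (F l) < e" if "0 < e" for e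
      using F that by (auto simp: MCauchy_def)
    have "uniformly_Cauchy_on ?Q F'"
      unfolding uniformly_Cauchy_on_def
    proof (intro allI impI)
      fix e :: real assume e: "0 < e"
      then obtain N where N: "\<And>k l. N \<le> k \<Longrightarrow> N \<le> l \<Longrightarrow> C1_dist (F k) (F l) < e / real CARD('n)"
        using cau[of "e / real CARD('n)"] by auto
      show "\<exists>M. \<forall>x\<in>?Q. \<forall>k\<ge>M. \<forall>l\<ge>M. dist (F' k x) (F' l x) < e"
      proof (intro exI[of _ N] ballI allI impI)
        fix x k l assume "x \<in> ?Q" "N \<le> k" "N \<le> l"
        then have "norm (F' k x - F' l x) \<le> real CARD('n) * C1_dist (F k) (F l)" using d2 by blast
        also have "\<dots> < e" using N[OF \<open>N \<le> k\<close> \<open>N \<le> l\<close>] by (simp add: field_simps)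
        finally show "dist (F' k x) (F' l x) < e" by (simp add: dist_norm)
      qed
    qed
    then obtain G' where G': "uniform_limit ?Q F' G' sequentially"
      using Cauchy_uniformly_convergent uniformly_convergent_on_def by blast
    have cG': "continuous_on ?Q G'"
      by (rule uniform_limit_theorem[OF _ G']) (auto simp: cF')
    have "Cauchy (\<lambda>k. F k 0)"
    proof (rule CauchyI)
      fix e :: real assume "0 < e"
      then obtain N where "\<forall>k\<ge>N. \<forall>l\<ge>N. C1_dist (F k) (F l) < e" using cau by blast
      then show "\<exists>M. \<forall>m\<ge>M. \<forall>n\<ge>M. norm (F m 0 - F n 0) < e"
        using d1[OF zero_in_unit_cube] by (meson le_less_trans)
    qed
    then obtain y0 where y0: "(\<lambda>k. F k 0) \<longlonglongrightarrow> y0" by (auto simp: Cauchy_convergent_iff convergent_def)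
    have "\<exists>g. \<forall>x\<in>?Q. (\<lambda>k. F k x) \<longlonglongrightarrow> g x \<and> (g has_derivative blinfun_apply (G' x)) (at x within ?Q)"
    proof (rule has_derivative_sequence[where f' = "\<lambda>k x. blinfun_apply (F' k x)", OF _ F' _ zero_in_unit_cube y0])
      show "convex ?Q" by (rule convex_unit_cube)
      fix e :: real assume e: "0 < e"
      from uniform_limitD[OF G' e]
      show "\<forall>\<^sub>F k in sequentially. \<forall>x\<in>?Q. \<forall>h. norm (blinfun_apply (F' k x) h - blinfun_apply (G' x) h) \<le> e * norm h"
      proof eventually_elim
        case (elim k)
        show ?case
        proof (intro ballI allI)
          fix x h assume "x \<in> ?Q"
          then have "norm (F' k x - G' x) \<le> e" using elim by (auto simp: dist_norm intro: less_imp_le)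
          then show "norm (blinfun_apply (F' k x) h - blinfun_apply (G' x) h) \<le> e * norm h"
            using norm_blinfun[of "F' k x - G' x" h] mult_right_mono[of "norm (F' k x - G' x)" e "norm h"]
            by (simp add: blinfun.diff_left)
        qed
      qed
    qed auto
    then obtain g0 where g0: "\<And>x. x \<in> ?Q \<Longrightarrow> (\<lambda>k. F k x) \<longlonglongrightarrow> g0 x"
      "\<And>x. x \<in> ?Q \<Longrightarrow> (g0 has_derivative blinfun_apply (G' x)) (at x within ?Q)" by blast
    define g where "g = restrict g0 ?Q"
    have dg: "(g has_derivative blinfun_apply (G' x)) (at x within ?Q)" if "x \<in> ?Q" for x
      by (rule has_derivative_transform[OF that _ g0(2)[OF that]]) (simp add: g_def)
    then have C1g: "C1_on ?Q g" using cG' by (auto simp: C1_on_def)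
    then have gS: "g \<in> surfaces" by (simp add: surfaces_def g_def)
    have "\<exists>N. \<forall>k\<ge>N. F k \<in> surfaces \<and> C1_dist (F k) g < e" if e: "0 < e" for e
    proof -
      obtain N1 where N1: "\<And>k l. N1 \<le> k \<Longrightarrow> N1 \<le> l \<Longrightarrow> C1_dist (F k) (F l) < e / 2" using cau[of "e / 2"] e by auto
      obtain N2 where N2: "\<And>k x. N2 \<le> k \<Longrightarrow> x \<in> ?Q \<Longrightarrow> dist (F' k x) (G' x) < e / 2"
        using uniform_limitD[OF G', of "e / 2"] e by (auto simp: eventually_sequentially)
      have "C1_dist (F k) g \<le> e / 2" if k: "max N1 N2 \<le> k" for k
      proof -
        have "C1_norm (\<lambda>x. F k x - g x) \<le> e / 2"
        proof (rule C1_norm_least; rule sup_norm_least)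
          fix x assume x: "x \<in> ?Q"
          have "(\<lambda>l. norm (F k x - F l x)) \<longlonglongrightarrow> norm (F k x - g x)"
            using g0(1)[OF x] x by (intro tendsto_intros) (simp add: g_def)
          then show "norm (F k x - g x) \<le> e / 2"
          proof (rule LIMSEQ_le_const2)
            show "\<exists>N. \<forall>l\<ge>N. norm (F k x - F l x) \<le> e / 2"
            proof (intro exI[of _ N1] allI impI)
              fix l assume "N1 \<le> l"
              then have "C1_dist (F k) (F l) < e / 2" using N1 k by simp
              then show "norm (F k x - F l x) \<le> e / 2" using d1[OF x, of k l] by linarith
            qed
          qed
        next
          fix j x assume x: "x \<in> ?Q"
          have "partial j (\<lambda>x. F k x - g x) x = blinfun_apply (F' k x - G' x) (axis j 1)"
            using partial_eq[OF has_derivative_diff[OF F'[OF x] dg[OF x]] x] by (simp add: minus_blinfun.rep_eq)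
          also have "norm \<dots> \<le> norm (F' k x - G' x) * norm (axis j (1::real) :: real ^ 'n)" by (rule norm_blinfun)
          also have "\<dots> \<le> e / 2" using N2[of k x] k x by (simp add: dist_norm less_imp_le)
          finally show "norm (partial j (\<lambda>x. F k x - g x) x) \<le> e / 2" .
        qed
        then show ?thesis using FS gS by (simp add: C1_dist_def)
      qed
      then show ?thesis using e FS by (intro exI[of _ "max N1 N2"]) fastforce
    qed
    then have "limitin mtopology F g sequentially"
      using gS by (simp add: limit_metric_sequentially)
    then show ?thesis by blast
  qed
  then show ?thesis by (simp add: mcomplete_def)
qed

lemma residual_meets:
  fixes R :: "(real ^ 'n \<Rightarrow> 'a::banach) set" and Op :: "nat \<Rightarrow> (real ^ 'n \<Rightarrow> 'a) set"
  assumes R: "residual_in surface_topology R"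
    and W: "openin surface_topology W" "W \<noteq> {}"
    and Op: "\<And>N. openin surface_topology (Op N)"
    and dense: "\<And>N f \<eta>. f \<in> W \<Longrightarrow> 0 < \<eta> \<Longrightarrow> \<exists>f'\<in>Op N. C1_dist f f' < \<eta>"
  shows "\<exists>f. f \<in> W \<and> f \<in> R \<and> (\<forall>N. f \<in> Op N)"
proof -
  interpret Metric_space "surfaces :: (real ^ 'n \<Rightarrow> 'a) set" C1_dist by (rule Metric_space_surfaces)
  let ?T = "mtopology"
  have T: "surface_topology = ?T" by (simp add: surface_topology_def)
  obtain \<D> where D: "countable \<D>" "\<And>D. D \<in> \<D> \<Longrightarrow> nowhere_dense_in ?T D" "topspace ?T - R = \<Union>\<D>"
    using R by (auto simp: residual_in_def meager_in_def T)
  \<comment> \<open>The sets \<open>Op N\<close> are dense in \<open>W\<close> only. Adding the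
    complement of the closure of \<open>W\<close> makes them dense everywhere without changing them
    inside \<open>W\<close>, so that Baire's theorem for the whole space can be used.\<close>
  define \<G> where "\<G> = (\<lambda>N. Op N \<union> (surfaces - ?T closure_of W)) ` UNIV \<union> (\<lambda>D. surfaces - ?T closure_of D) ` \<D>"
  have G: "openin ?T U \<and> ?T closure_of U = surfaces" if U: "U \<in> \<G>" for U
  proof -
    consider N where "U = Op N \<union> (surfaces - ?T closure_of W)" | D where "D \<in> \<D>" "U = surfaces - ?T closure_of D"
      using U by (auto simp: \<G>_def)
    then show ?thesis
    proof cases
      case 1
      have "openin ?T (surfaces - ?T closure_of W)"
        using openin_diff[OF openin_topspace closedin_closure_of[of ?T W]] by simp
      then have "openin ?T U" unfolding 1 using Op[of N] by (simp add: T openin_Un)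
      moreover have "U \<inter> V \<noteq> {}" if V: "openin ?T V" "V \<noteq> {}" for V
      proof (cases "V \<inter> W = {}")
        case True
        then have "V \<inter> ?T closure_of W = {}" using V(1) by (simp add: openin_Int_closure_of_eq_empty)
        moreover have "V \<subseteq> surfaces" using openin_subset[OF V(1)] by simp
        ultimately show ?thesis using V(2) 1 by blast
      next
        case False
        then obtain f where f: "f \<in> V" "f \<in> W" by blast
        then obtain r where r: "0 < r" "mball f r \<subseteq> V" using V(1) by (auto simp: openin_mtopology)
        obtain f' where f': "f' \<in> Op N" "C1_dist f f' < r" using dense[OF f(2) r(1)] by blast
        moreover have "f' \<in> surfaces" using openin_subset[OF Op[of N]] f'(1) by (auto simp: T)
        moreover have "f \<in> surfaces" using openin_subset[OF V(1)] f(1) by auto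
        ultimately have "f' \<in> mball f r" by (simp add: in_mball)
        then show ?thesis using r(2) f'(1) 1 by blast
      qed
      ultimately show ?thesis using dense_intersects_open[of ?T U] by simp
    next
      case 2
      have "?T closure_of U = surfaces - ?T interior_of (?T closure_of D)"
        unfolding 2 using closure_of_complement[of ?T "?T closure_of D"] by simp
      moreover have "openin ?T U" unfolding 2 using openin_diff[OF openin_topspace closedin_closure_of[of ?T D]] by simp
      ultimately show ?thesis using D(2)[OF 2(1)] by (simp add: nowhere_dense_in_def)
    qed
  qed
  have "?T closure_of \<Inter>\<G> = surfaces"
  proof (rule metric_Baire_category[OF mcomplete_surfaces])
    show "countable \<G>" using D(1) by (simp add: \<G>_def)
  qed (rule G)
  then have "\<Inter>\<G> \<inter> W \<noteq> {}"
    using W dense_intersects_open[of ?T "\<Inter>\<G>"] by (simp add: T)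
  then obtain f where f: "f \<in> W" "\<And>U. U \<in> \<G> \<Longrightarrow> f \<in> U" by blast
  have WS: "W \<subseteq> surfaces" using openin_subset[OF W(1)] by (simp add: T)
  have "f \<in> Op N" for N
  proof -
    have "f \<in> Op N \<union> (surfaces - ?T closure_of W)" using f(2) by (auto simp: \<G>_def)
    moreover have "f \<in> ?T closure_of W" using f(1) closure_of_subset[of W ?T] WS by auto
    ultimately show ?thesis by blast
  qed
  moreover have "f \<in> R"
  proof (rule ccontr)
    assume "f \<notin> R"
    then have "f \<in> \<Union>\<D>" using D(3) f(1) WS by auto
    then obtain D' where D': "D' \<in> \<D>" "f \<in> D'" by blast
    then have "f \<in> surfaces - ?T closure_of D'" using f(2) by (auto simp: \<G>_def)
    moreover have "D' \<subseteq> surfaces" using D(2)[OF D'(1)] by (simp add: nowhere_dense_in_def)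
    ultimately show False using closure_of_subset[of D' ?T] D'(2) by auto
  qed
  ultimately show ?thesis using f(1) by blast
qed

subsection \<open>Surfaces close to an affine one\<close>

text \<open>\<open>\<pi>\<close> gives the base point and \<open>\<tau>\<close> the height; the
  vectors \<open>e j\<close> and \<open>e0\<close> are preimages of the basis vectors. The rest of
  the space is seen only through these finitely many coordinates.\<close>

locale coords =
  fixes e :: "'n::finite \<Rightarrow> 'a::banach" and e0 :: 'a and \<pi> :: "'a \<Rightarrow> real ^ 'n" and \<tau> :: "'a \<Rightarrow> real" and L :: real
  assumes pi: "bounded_linear \<pi>" and tau: "bounded_linear \<tau>"
    and pi_e: "\<pi> (e j) = axis j 1" and tau_e: "\<tau> (e j) = 0" and pi_e0: "\<pi> e0 = 0" and tau_e0: "\<tau> e0 = 1"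
    and L: "0 < L" and piL: "norm (\<pi> v) \<le> L * norm v" and tauL: "\<bar>\<tau> v\<bar> \<le> L * norm v"
begin

definition flat :: "real ^ 'n \<Rightarrow> 'a" where
  "flat = restrict (\<lambda>x. \<Sum>j\<in>UNIV. x $ j *\<^sub>R e j) unit_cube"

lemma flat_surface: "flat \<in> surfaces"
proof -
  let ?g = "\<lambda>x :: real ^ 'n. \<Sum>j\<in>UNIV. x $ j *\<^sub>R e j"
  have bl: "bounded_linear ?g"
    by (intro bounded_linear_sum bounded_linear_compose[OF bounded_linear_scaleR_left] bounded_linear_vec_nth)
  have "(flat has_derivative blinfun_apply (Blinfun ?g)) (at x within unit_cube)" if "x \<in> unit_cube" for x
  proof (rule has_derivative_transform[OF that])
    show "(?g has_derivative blinfun_apply (Blinfun ?g)) (at x within unit_cube)"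
      using bounded_linear.has_derivative[OF bl has_derivative_ident] by (simp add: bounded_linear_Blinfun_apply[OF bl])
  qed (simp add: flat_def)
  then have "C1_on unit_cube flat" unfolding C1_on_def by (intro exI[of _ "\<lambda>_. Blinfun ?g"]) auto
  then show ?thesis by (simp add: surfaces_def flat_def)
qed

lemma pi_flat: "x \<in> unit_cube \<Longrightarrow> \<pi> (flat x) = x"
proof -
  interpret bounded_linear \<pi> by (rule pi)
  assume "x \<in> unit_cube"
  then have "\<pi> (flat x) = (\<Sum>j\<in>UNIV. x $ j *\<^sub>R axis j 1)" by (simp add: flat_def sum scale pi_e)
  then show ?thesis by (simp add: basis_expansion flip: scalar_mult_eq_scaleR)
qed

lemma tau_flat: "x \<in> unit_cube \<Longrightarrow> \<tau> (flat x) = 0"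
proof -
  interpret bounded_linear \<tau> by (rule tau)
  assume "x \<in> unit_cube"
  then show ?thesis by (simp add: flat_def sum scale tau_e)
qed

definition near :: "real \<Rightarrow> (real ^ 'n \<Rightarrow> 'a) set" where
  "near \<epsilon> = {f \<in> surfaces. C1_dist f flat < \<epsilon>}"

text \<open>The Lipschitz constant of the deviation from \<open>flat\<close>, in both base point and
  height, for surfaces in \<open>near \<epsilon>\<close>: \<open>L\<close> comes from the
  coordinates and \<open>CARD('n)\<close> from the passage from partial derivatives to the
  derivative.\<close>

definition lip :: "real \<Rightarrow> real" where
  "lip \<epsilon> = L * (real CARD('n) * \<epsilon>)"

lemma pi_diff: "\<pi> (u - v) = \<pi> u - \<pi> v" and tau_diff: "\<tau> (u - v) = \<tau> u - \<tau> v"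
  using bounded_linear.linear[OF pi] bounded_linear.linear[OF tau] by (auto simp: linear_diff)

lemma near_pi: 
  assumes f: "f \<in> near \<epsilon>" and x: "x \<in> unit_cube"
  shows "norm (\<pi> (f x) - x) \<le> L * \<epsilon>"
proof -
  have "norm (\<pi> (f x) - x) = norm (\<pi> (f x - flat x))" using x by (simp add: pi_diff pi_flat)
  also have "\<dots> \<le> L * norm (f x - flat x)" by (rule piL)
  also have "\<dots> \<le> L * \<epsilon>"
    using f L C1_dist_upper[OF _ flat_surface x, of f] by (intro mult_left_mono) (auto simp: near_def)
  finally show ?thesis .
qed

lemma near_tau:
  assumes f: "f \<in> near \<epsilon>" and x: "x \<in> unit_cube"
  shows "\<bar>\<tau> (f x)\<bar> \<le> L * \<epsilon>"
proof -
  have "\<bar>\<tau> (f x)\<bar> = \<bar>\<tau> (f x - flat x)\<bar>" using x by (simp add: tau_diff tau_flat)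
  also have "\<dots> \<le> L * norm (f x - flat x)" by (rule tauL)
  also have "\<dots> \<le> L * \<epsilon>"
    using f L C1_dist_upper[OF _ flat_surface x, of f] by (intro mult_left_mono) (auto simp: near_def)
  finally show ?thesis .
qed

lemma near_lip:
  assumes f: "f \<in> near \<epsilon>" and x: "x \<in> unit_cube" "y \<in> unit_cube"
  shows "norm ((\<pi> (f x) - x) - (\<pi> (f y) - y)) \<le> lip \<epsilon> * norm (x - y)"
    and "\<bar>\<tau> (f x) - \<tau> (f y)\<bar> \<le> lip \<epsilon> * norm (x - y)"
proof -
  let ?d = "(f x - flat x) - (f y - flat y)"
  have "norm ?d \<le> real CARD('n) * C1_dist f flat * norm (x - y)"
    using f x flat_surface by (intro C1_dist_lipschitz) (auto simp: near_def)
  also have "\<dots> \<le> real CARD('n) * \<epsilon> * norm (x - y)"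
    using f by (intro mult_right_mono mult_left_mono) (auto simp: near_def)
  finally have d: "L * norm ?d \<le> lip \<epsilon> * norm (x - y)"
    using L by (simp add: lip_def mult.assoc)
  have "\<pi> ?d = (\<pi> (f x) - x) - (\<pi> (f y) - y)" using x by (simp add: pi_diff pi_flat)
  then show "norm ((\<pi> (f x) - x) - (\<pi> (f y) - y)) \<le> lip \<epsilon> * norm (x - y)" using piL[of ?d] d by simp
  have "\<tau> ?d = \<tau> (f x) - \<tau> (f y)" using x by (simp add: tau_diff tau_flat)
  then show "\<bar>\<tau> (f x) - \<tau> (f y)\<bar> \<le> lip \<epsilon> * norm (x - y)" using tauL[of ?d] d by simp
qed

lemma near_expand:
  assumes f: "f \<in> near \<epsilon>" and x: "x \<in> unit_cube" "y \<in> unit_cube" and c: "lip \<epsilon> \<le> 1 / 4"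
  shows "norm (x - y) \<le> 4 / 3 * norm (\<pi> (f x) - \<pi> (f y))"
proof -
  let ?d = "(\<pi> (f x) - x) - (\<pi> (f y) - y)"
  have "x - y = (\<pi> (f x) - \<pi> (f y)) - ?d" by simp
  then have "norm (x - y) \<le> norm (\<pi> (f x) - \<pi> (f y)) + norm ?d" by (metis norm_triangle_ineq4)
  also have "norm ?d \<le> 1 / 4 * norm (x - y)"
    using near_lip(1)[OF f x] c by (meson mult_right_mono norm_ge_zero order_trans)
  finally show ?thesis by simp
qed

definition cinv :: "(real ^ 'n \<Rightarrow> 'a) \<Rightarrow> real ^ 'n \<Rightarrow> real ^ 'n" where
  "cinv f y = (SOME x. x \<in> unit_cube \<and> \<pi> (f x) = y)"

text \<open>Over \<open>core\<close>, the surface is the graph of \<open>hgt f\<close>.\<close>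

definition hgt :: "(real ^ 'n \<Rightarrow> 'a) \<Rightarrow> real ^ 'n \<Rightarrow> real" where
  "hgt f y = \<tau> (f (cinv f y))"

text \<open>The parameter of \<open>y\<close> is the fixed point of
  \<open>x \<mapsto> y - (\<pi> (f x) - x)\<close>. This contraction maps the unit cube into itself
  because \<open>y\<close> has distance at least \<open>1 / 4\<close> from its boundary; this
  determines the size of \<open>core\<close>.\<close>

lemma cinv:
  assumes f: "f \<in> near \<epsilon>" and c: "lip \<epsilon> \<le> 1 / 4" "L * \<epsilon> \<le> 1 / 4" and y: "y \<in> core"
  shows "cinv f y \<in> unit_cube \<and> \<pi> (f (cinv f y)) = y"
proof -
  let ?T = "\<lambda>x. y - (\<pi> (f x) - x)"
  have "\<exists>!x. x \<in> unit_cube \<and> ?T x = x"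
  proof (rule Banach_fix[where c = "1 / 4"])
    show "complete (unit_cube :: (real ^ 'n) set)" by (rule compact_imp_complete[OF compact_unit_cube])
    show "(unit_cube :: (real ^ 'n) set) \<noteq> {}" using zero_in_unit_cube by blast
    show "?T ` unit_cube \<subseteq> unit_cube"
    proof
      fix z assume "z \<in> ?T ` unit_cube"
      then obtain x where x: "x \<in> unit_cube" "z = ?T x" by blast
      have "0 \<le> z $ j \<and> z $ j \<le> 1" for j
      proof -
        have "\<bar>(\<pi> (f x) - x) $ j\<bar> \<le> 1 / 4"
          using near_pi[OF f x(1)] c component_le_norm_cart[of "\<pi> (f x) - x" j] by linarith
        moreover have "1 / 4 \<le> y $ j" "y $ j \<le> 3 / 4" using y by (auto simp: mem_core)
        moreover have "z $ j = y $ j - (\<pi> (f x) - x) $ j" using x(2) by simp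
        ultimately show ?thesis by linarith
      qed
      then show "z \<in> unit_cube" by (simp add: unit_cube_def)
    qed
    fix x x' :: "real ^ 'n" assume x: "x \<in> unit_cube" "x' \<in> unit_cube"
    have "?T x - ?T x' = - ((\<pi> (f x) - x) - (\<pi> (f x') - x'))" by simp
    then have "dist (?T x) (?T x') = norm ((\<pi> (f x) - x) - (\<pi> (f x') - x'))"
      by (simp only: dist_norm norm_minus_cancel)
    also have "\<dots> \<le> 1 / 4 * norm (x - x')"
      using near_lip(1)[OF f x] c(1) by (meson mult_right_mono norm_ge_zero order_trans)
    finally show "dist (?T x) (?T x') \<le> 1 / 4 * dist x x'" by (simp add: dist_norm)
  qed auto
  then have "\<exists>x. x \<in> unit_cube \<and> \<pi> (f x) = y" by (auto simp: algebra_simps)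
  then show ?thesis unfolding cinv_def by (rule someI_ex)
qed

lemma hgt_lipschitz:
  assumes f: "f \<in> near \<epsilon>" and c: "lip \<epsilon> \<le> 1 / 4" "L * \<epsilon> \<le> 1 / 4" and y: "y \<in> core" "z \<in> core"
  shows "\<bar>hgt f y - hgt f z\<bar> \<le> 4 / 3 * lip \<epsilon> * norm (y - z)"
proof -
  note iy = cinv[OF f c y(1)] and iz = cinv[OF f c y(2)]
  have "f \<in> surfaces" "C1_dist f flat < \<epsilon>" using f by (auto simp: near_def)
  then have "0 \<le> \<epsilon>"
    using C1_dist_upper[OF _ flat_surface zero_in_unit_cube, of f] norm_ge_zero[of "f 0 - flat 0"] by linarith
  then have l0: "0 \<le> lip \<epsilon>" using L by (simp add: lip_def)
  have "\<bar>hgt f y - hgt f z\<bar> \<le> lip \<epsilon> * norm (cinv f y - cinv f z)"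
    unfolding hgt_def using iy iz by (intro near_lip(2)[OF f]) auto
  also have "\<dots> \<le> lip \<epsilon> * (4 / 3 * norm (y - z))"
    using near_expand[OF f, of "cinv f y" "cinv f z"] iy iz c l0 by (intro mult_left_mono) auto
  finally show ?thesis by simp
qed

lemma hgt_bound:
  assumes f: "f \<in> near \<epsilon>" and c: "lip \<epsilon> \<le> 1 / 4" "L * \<epsilon> \<le> 1 / 4" and y: "y \<in> core"
  shows "\<bar>hgt f y\<bar> \<le> L * \<epsilon>"
  unfolding hgt_def using cinv[OF f c y] by (intro near_tau[OF f]) auto

text \<open>Replacing \<open>f\<close> by \<open>f'\<close> at the same parameter costs
  \<open>L\<close> times the distance, and adjusting the parameter another third of this, as
  \<open>1 / 4 * 4 / 3 = 1 / 3\<close>.\<close>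

lemma hgt_dist:
  assumes f: "f \<in> near \<epsilon>" and f': "f' \<in> near \<epsilon>" and c: "lip \<epsilon> \<le> 1 / 4" "L * \<epsilon> \<le> 1 / 4" and y: "y \<in> core"
  shows "\<bar>hgt f y - hgt f' y\<bar> \<le> 2 * L * C1_dist f f'"
proof -
  let ?x = "cinv f y" and ?x' = "cinv f' y" and ?D = "C1_dist f f'"
  note i = cinv[OF f c y] and i' = cinv[OF f' c y]
  have d: "norm (f ?x - f' ?x) \<le> ?D" using f f' i by (intro C1_dist_upper) (auto simp: near_def)
  have "norm (?x - ?x') \<le> 4 / 3 * norm (\<pi> (f' ?x) - \<pi> (f' ?x'))"
    using i i' by (intro near_expand[OF f' _ _ c(1)]) auto
  also have "\<pi> (f' ?x) - \<pi> (f' ?x') = - \<pi> (f ?x - f' ?x)" using i i' by (simp add: pi_diff)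
  also have "norm \<dots> \<le> L * ?D" using piL[of "f ?x - f' ?x"] d L
    by (simp add: mult_left_mono order_trans)
  finally have x: "norm (?x - ?x') \<le> 4 / 3 * (L * ?D)" by simp
  have "\<bar>\<tau> (f' ?x) - \<tau> (f' ?x')\<bar> \<le> lip \<epsilon> * norm (?x - ?x')" using i i' by (intro near_lip(2)[OF f']) auto
  also have "\<dots> \<le> 1 / 4 * (4 / 3 * (L * ?D))" using x c(1) by (intro mult_mono) auto
  finally have 1: "\<bar>\<tau> (f' ?x) - \<tau> (f' ?x')\<bar> \<le> 1 / 3 * (L * ?D)" by simp
  have "\<bar>\<tau> (f ?x) - \<tau> (f' ?x)\<bar> \<le> L * ?D"
    using tauL[of "f ?x - f' ?x"] d L by (simp add: tau_diff mult_left_mono order_trans)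
  moreover have "0 \<le> L * ?D" using L d norm_ge_zero[of "f ?x - f' ?x"] by (intro mult_nonneg_nonneg) linarith+
  ultimately show ?thesis using 1 unfolding hgt_def by linarith
qed

lemma openin_near: "openin surface_topology (near \<epsilon>)"
proof -
  interpret Metric_space "surfaces :: (real ^ 'n \<Rightarrow> 'a) set" C1_dist by (rule Metric_space_surfaces)
  have "near \<epsilon> = mball flat \<epsilon>" using flat_surface by (auto simp: near_def mball_def commute)
  then show ?thesis by (simp add: surface_topology_def)
qed

end

text \<open>By the strict inequality there are \<open>n + 1\<close> biorthogonal pairs:
  \<open>n\<close> for the base and one for the height.\<close>

lemma coords_exist:
  assumes "enat CARD('n::finite) < vdim TYPE('a::banach)"
  obtains e :: "'n::finite \<Rightarrow> 'a::banach" and e0 \<pi> \<tau> L where "coords e e0 \<pi> \<tau> L"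
proof -
  let ?n = "CARD('n)"
  have "enat (Suc ?n) \<le> vdim TYPE('a)" using assms by (simp add: Suc_ile_eq)
  from exists_biorthogonal[OF this] obtain \<phi> :: "nat \<Rightarrow> 'a \<Rightarrow> real" and x where
    bl: "\<And>k. k < Suc ?n \<Longrightarrow> bounded_linear (\<phi> k)"
    and bi: "\<And>k l. k < Suc ?n \<Longrightarrow> l < Suc ?n \<Longrightarrow> \<phi> k (x l) = (if k = l then 1 else 0)" by blast
  obtain \<sigma> :: "'n \<Rightarrow> nat" where \<sigma>: "bij_betw \<sigma> UNIV {0..<?n}"
    using ex_bij_betw_finite_nat[of "UNIV :: 'n set"] by auto
  have \<sigma>n: "\<sigma> j < ?n" for j using bij_betwE[OF \<sigma>] by auto
  have \<sigma>i: "\<sigma> i = \<sigma> j \<longleftrightarrow> i = j" for i j using \<sigma> by (auto simp: bij_betw_def inj_def)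
  define \<pi> where "\<pi> = (\<lambda>v. (\<chi> j. \<phi> (\<sigma> j) v) :: real ^ 'n)"
  have "\<pi> = (\<lambda>v. \<Sum>j\<in>UNIV. \<phi> (\<sigma> j) v *\<^sub>R axis j 1)"
  proof (rule ext)
    fix v show "\<pi> v = (\<Sum>j\<in>UNIV. \<phi> (\<sigma> j) v *\<^sub>R axis j 1)"
      using basis_expansion[of "\<pi> v"] by (simp add: \<pi>_def scalar_mult_eq_scaleR)
  qed
  moreover have "bounded_linear (\<lambda>v. \<Sum>j\<in>UNIV. \<phi> (\<sigma> j) v *\<^sub>R (axis j 1 :: real ^ 'n))"
    using \<sigma>n by (intro bounded_linear_sum bounded_linear_compose[OF bounded_linear_scaleR_left] bl) (auto simp: less_SucI)
  ultimately have pi: "bounded_linear \<pi>" by simp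
  have tau: "bounded_linear (\<phi> ?n)" by (intro bl) simp
  obtain L1 where L1: "\<And>v. norm (\<pi> v) \<le> norm v * L1" using bounded_linear.bounded[OF pi] by blast
  obtain L2 where L2: "\<And>v. norm (\<phi> ?n v) \<le> norm v * L2" using bounded_linear.bounded[OF tau] by blast
  define L where "L = max 1 (max L1 L2)"
  have Lb: "norm v * L1 \<le> L * norm v" "norm v * L2 \<le> L * norm v" for v :: 'a
    by (auto simp: L_def mult.commute[of "norm v"] intro!: mult_right_mono)
  have "coords (\<lambda>j. x (\<sigma> j)) (x ?n) \<pi> (\<phi> ?n) L"
  proof (rule coords.intro[OF pi tau])
    fix j v
    show "\<pi> (x (\<sigma> j)) = axis j 1"
      using bi \<sigma>n by (auto simp: \<pi>_def vec_eq_iff axis_def \<sigma>i less_SucI)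
    show "\<phi> ?n (x (\<sigma> j)) = 0" using bi[of ?n "\<sigma> j"] \<sigma>n[of j] by simp
    show "\<pi> (x ?n) = 0" using bi \<sigma>n by (auto simp: \<pi>_def vec_eq_iff less_SucI) (metis less_irrefl)
    show "\<phi> ?n (x ?n) = 1" using bi[of ?n ?n] by simp
    show "norm (\<pi> v) \<le> L * norm v" using L1[of v] Lb(1)[of v] by linarith
    show "\<bar>\<phi> ?n v\<bar> \<le> L * norm v" using L2[of v] Lb(2)[of v] by simp
  qed (simp add: L_def)
  then show ?thesis by (rule that)
qed

subsection \<open>Perturbations that are locally affine\<close>

text \<open>A C1 substitute for the positive part, from which cutoff functions with explicit
  derivatives are built.\<close>

definition pos_sq :: "real \<Rightarrow> real" where
  "pos_sq s = (max 0 s)\<^sup>2"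

lemma pos_sq_deriv: "(pos_sq has_real_derivative 2 * max 0 s) (at s)"
proof -
  consider "0 < s" | "s < 0" | "s = 0" by linarith
  then show ?thesis
  proof cases
    case 1
    have "((\<lambda>s. s\<^sup>2) has_real_derivative 2 * max 0 s) (at s)"
      using 1 by (auto intro!: derivative_eq_intros)
    then show ?thesis
      by (rule has_field_derivative_transform_within_open[of _ _ _ "{0<..}"]) (use 1 in \<open>auto simp: pos_sq_def\<close>)
  next
    case 2
    have "((\<lambda>s. 0) has_real_derivative 2 * max 0 s) (at s)"
      using 2 by (auto intro!: derivative_eq_intros)
    then show ?thesis
      by (rule has_field_derivative_transform_within_open[of _ _ _ "{..<0}"]) (use 2 in \<open>auto simp: pos_sq_def\<close>)
  next
    case 3
    have "(\<lambda>h. max 0 h) \<midarrow>0\<rightarrow> max 0 (0::real)" by (intro tendsto_intros)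
    then have "(\<lambda>h. max 0 h) \<midarrow>0\<rightarrow> (0::real)" by simp
    then have "(\<lambda>h. (pos_sq (0 + h) - pos_sq 0) / h) \<midarrow>0\<rightarrow> 0"
      by (rule Lim_transform_eventually) (auto simp: eventually_at_filter pos_sq_def max_def power2_eq_square)
    then show ?thesis using 3 by (simp add: DERIV_def)
  qed
qed

lemma pos_sq_nonneg: "0 \<le> pos_sq s" and pos_sq_eq_0: "s \<le> 0 \<Longrightarrow> pos_sq s = 0"
  and pos_sq_ge_1: "1 \<le> s \<Longrightarrow> 1 \<le> pos_sq s" and pos_sq_1: "pos_sq 1 = 1"
  by (auto simp: pos_sq_def)

lemma continuous_on_pos_sq: "continuous_on S f \<Longrightarrow> continuous_on S (\<lambda>x. pos_sq (f x))"
  unfolding pos_sq_def by (intro continuous_intros)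

text \<open>In the cell \<open>c\<close> of the grid of width \<open>1 / M\<close> the wall vanishes except near the boundary, and it
  is at least \<open>1\<close> outside the cell.\<close>

definition wall :: "real \<Rightarrow> real \<Rightarrow> ('n \<Rightarrow> nat) \<Rightarrow> real ^ 'n \<Rightarrow> real" where
  "wall \<kappa> M c y = (\<Sum>j\<in>UNIV. pos_sq ((\<kappa> - (M * y $ j - real (c j))) / \<kappa>) + pos_sq ((M * y $ j - real (c j) - 1 + \<kappa>) / \<kappa>))"

definition dwall :: "real \<Rightarrow> real \<Rightarrow> ('n \<Rightarrow> nat) \<Rightarrow> real ^ 'n \<Rightarrow> real ^ 'n \<Rightarrow> real" where
  "dwall \<kappa> M c y v = (\<Sum>j\<in>UNIV. - (M * v $ j / \<kappa>) * (2 * max 0 ((\<kappa> - (M * y $ j - real (c j))) / \<kappa>))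
      + (M * v $ j / \<kappa>) * (2 * max 0 ((M * y $ j - real (c j) - 1 + \<kappa>) / \<kappa>)))"

definition bump :: "real \<Rightarrow> real \<Rightarrow> ('n \<Rightarrow> nat) \<Rightarrow> real ^ 'n \<Rightarrow> real" where
  "bump \<kappa> M c y = pos_sq (1 - wall \<kappa> M c y)"

definition dbump :: "real \<Rightarrow> real \<Rightarrow> ('n \<Rightarrow> nat) \<Rightarrow> real ^ 'n \<Rightarrow> real ^ 'n \<Rightarrow> real" where
  "dbump \<kappa> M c y v = - dwall \<kappa> M c y v * (2 * max 0 (1 - wall \<kappa> M c y))"

lemma wall_deriv:
  assumes "\<kappa> \<noteq> 0" shows "(wall \<kappa> M c has_derivative dwall \<kappa> M c y) (at y)"
proof -
  have 1: "((\<lambda>x. (\<kappa> - (M * x $ j - real (c j))) / \<kappa>) has_derivative (\<lambda>v. - (M * v $ j / \<kappa>))) (at y)" for j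
    using assms by (auto intro!: derivative_eq_intros bounded_linear_imp_has_derivative[OF bounded_linear_vec_nth])
  have 2: "((\<lambda>x. (M * x $ j - real (c j) - 1 + \<kappa>) / \<kappa>) has_derivative (\<lambda>v. M * v $ j / \<kappa>)) (at y)" for j
    using assms by (auto intro!: derivative_eq_intros bounded_linear_imp_has_derivative[OF bounded_linear_vec_nth])
  show ?thesis
    unfolding wall_def[abs_def] dwall_def[abs_def]
    by (intro has_derivative_sum has_derivative_add DERIV_compose_FDERIV[OF pos_sq_deriv] 1 2)
qed

lemma bump_deriv:
  assumes "\<kappa> \<noteq> 0" shows "(bump \<kappa> M c has_derivative dbump \<kappa> M c y) (at y)"
proof -
  have "((\<lambda>y. 1 - wall \<kappa> M c y) has_derivative (\<lambda>v. - dwall \<kappa> M c y v)) (at y)"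
    using has_derivative_diff[OF has_derivative_const wall_deriv[OF assms, of M c y]] by simp
  from DERIV_compose_FDERIV[OF pos_sq_deriv this] show ?thesis
    unfolding bump_def[abs_def] dbump_def[abs_def] .
qed

lemma continuous_on_wall:
  fixes f :: "'b::topological_space \<Rightarrow> real ^ 'n"
  shows "continuous_on S f \<Longrightarrow> continuous_on S (\<lambda>x. wall \<kappa> M c (f x))"
  unfolding wall_def divide_inverse by (intro continuous_intros continuous_on_pos_sq)

lemma continuous_on_bump:
  fixes f :: "'b::topological_space \<Rightarrow> real ^ 'n"
  shows "continuous_on S f \<Longrightarrow> continuous_on S (\<lambda>x. bump \<kappa> M c (f x))"
  unfolding bump_def by (intro continuous_intros continuous_on_pos_sq continuous_on_wall)

lemma continuous_on_dbump:
  fixes f :: "'b::topological_space \<Rightarrow> real ^ 'n"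
  shows "continuous_on S f \<Longrightarrow> continuous_on S v \<Longrightarrow> continuous_on S (\<lambda>x. dbump \<kappa> M c (f x) (v x))"
  unfolding dbump_def dwall_def divide_inverse by (intro continuous_intros continuous_on_wall)

lemma wall_nonneg: "0 \<le> wall \<kappa> M c y"
  unfolding wall_def by (intro sum_nonneg add_nonneg_nonneg pos_sq_nonneg)

lemma wall_term_le:
  shows "pos_sq ((\<kappa> - (M * y $ j - real (c j))) / \<kappa>) \<le> wall \<kappa> M c y"
    and "pos_sq ((M * y $ j - real (c j) - 1 + \<kappa>) / \<kappa>) \<le> wall \<kappa> M c y"
proof -
  have "pos_sq ((\<kappa> - (M * y $ j - real (c j))) / \<kappa>) + pos_sq ((M * y $ j - real (c j) - 1 + \<kappa>) / \<kappa>) \<le> wall \<kappa> M c y"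
    unfolding wall_def
    by (rule member_le_sum[where f = "\<lambda>j. pos_sq ((\<kappa> - (M * y $ j - real (c j))) / \<kappa>) + pos_sq ((M * y $ j - real (c j) - 1 + \<kappa>) / \<kappa>)"])
      (auto intro: add_nonneg_nonneg pos_sq_nonneg)
  then show "pos_sq ((\<kappa> - (M * y $ j - real (c j))) / \<kappa>) \<le> wall \<kappa> M c y"
    "pos_sq ((M * y $ j - real (c j) - 1 + \<kappa>) / \<kappa>) \<le> wall \<kappa> M c y"
    using pos_sq_nonneg[of "(\<kappa> - (M * y $ j - real (c j))) / \<kappa>"] pos_sq_nonneg[of "(M * y $ j - real (c j) - 1 + \<kappa>) / \<kappa>"] by linarith+
qed

lemma wall_less_1:
  assumes "wall \<kappa> M c y < 1" "0 < \<kappa>"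
  shows "real (c j) < M * y $ j \<and> M * y $ j < real (c j) + 1"
proof -
  have "pos_sq ((\<kappa> - (M * y $ j - real (c j))) / \<kappa>) < 1" "pos_sq ((M * y $ j - real (c j) - 1 + \<kappa>) / \<kappa>) < 1"
    using wall_term_le[where \<kappa> = \<kappa> and M = M and y = y and j = j and c = c] assms by linarith+
  then have "(\<kappa> - (M * y $ j - real (c j))) / \<kappa> < 1" "(M * y $ j - real (c j) - 1 + \<kappa>) / \<kappa> < 1"
    using pos_sq_ge_1 by (meson not_le)+
  then show ?thesis using assms(2) by (simp add: divide_less_eq)
qed

lemma wall_eq_0:
  assumes "\<And>j. \<kappa> \<le> M * y $ j - real (c j) \<and> M * y $ j - real (c j) \<le> 1 - \<kappa>" "0 < \<kappa>"
  shows "wall \<kappa> M c y = 0"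
  unfolding wall_def
proof (rule sum.neutral, rule ballI)
  fix j
  have "(\<kappa> - (M * y $ j - real (c j))) / \<kappa> \<le> 0" "(M * y $ j - real (c j) - 1 + \<kappa>) / \<kappa> \<le> 0"
    using assms(1)[of j] assms(2) by (auto simp: divide_le_eq)
  then show "pos_sq ((\<kappa> - (M * y $ j - real (c j))) / \<kappa>) + pos_sq ((M * y $ j - real (c j) - 1 + \<kappa>) / \<kappa>) = 0"
    by (simp add: pos_sq_eq_0)
qed

lemma bump_bounds: "0 \<le> bump \<kappa> M c y" "bump \<kappa> M c y \<le> 1"
proof -
  have "max 0 (1 - wall \<kappa> M c y) \<le> 1" using wall_nonneg[of \<kappa> M c y] by simp
  then have "(max 0 (1 - wall \<kappa> M c y))\<^sup>2 \<le> 1\<^sup>2" by (intro power_mono) auto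
  then show "bump \<kappa> M c y \<le> 1" by (simp add: bump_def pos_sq_def)
qed (simp add: bump_def pos_sq_nonneg)

text \<open>Where the wall is below 1, so is each of its terms, and the positive parts in
  \<open>dwall\<close> are at most 1. Elsewhere the derivative of the bump vanishes.\<close>

lemma dbump_bound:
  fixes v :: "real ^ 'n"
  assumes k: "0 < \<kappa>" and M: "0 \<le> M"
  shows "\<bar>dbump \<kappa> M c y v\<bar> \<le> 8 * real CARD('n) * M / \<kappa> * norm v"
proof (cases "wall \<kappa> M c y < 1")
  case True
  have m1: "\<bar>max 0 s\<bar> \<le> 1" if "pos_sq s < 1" for s :: real
  proof -
    have "(max 0 s)\<^sup>2 \<le> 1\<^sup>2" using that by (simp add: pos_sq_def)
    then have "max 0 s \<le> 1" by (rule power2_le_imp_le) simp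
    then show ?thesis by simp
  qed
  have "\<bar>dwall \<kappa> M c y v\<bar> \<le> (\<Sum>j\<in>(UNIV::'n set). 4 * (M / \<kappa> * norm v))"
    unfolding dwall_def
  proof (rule order_trans[OF sum_abs], rule sum_mono)
    fix j
    let ?a = "max 0 ((\<kappa> - (M * y $ j - real (c j))) / \<kappa>)" and ?b = "max 0 ((M * y $ j - real (c j) - 1 + \<kappa>) / \<kappa>)"
    let ?m = "M * v $ j / \<kappa>"
    have a: "\<bar>?a\<bar> \<le> 1" "\<bar>?b\<bar> \<le> 1" using wall_term_le[where \<kappa> = \<kappa> and M = M and y = y and j = j and c = c] True by (intro m1; linarith)+
    have m: "\<bar>?m\<bar> \<le> M / \<kappa> * norm v"
      using k M component_le_norm_cart[of v j] by (simp add: abs_mult abs_divide divide_right_mono mult_left_mono)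
    have "\<bar>- ?m * (2 * ?a) + ?m * (2 * ?b)\<bar> \<le> \<bar>- ?m * (2 * ?a)\<bar> + \<bar>?m * (2 * ?b)\<bar>" by (rule abs_triangle_ineq)
    also have "\<dots> = 2 * (\<bar>?m\<bar> * \<bar>?a\<bar>) + 2 * (\<bar>?m\<bar> * \<bar>?b\<bar>)" by (simp only: abs_mult abs_minus abs_numeral)
    also have "\<dots> \<le> 2 * (\<bar>?m\<bar> * 1) + 2 * (\<bar>?m\<bar> * 1)" using a by (intro add_mono mult_left_mono) auto
    also have "\<dots> \<le> 4 * (M / \<kappa> * norm v)" using m by linarith
    finally show "\<bar>- ?m * (2 * ?a) + ?m * (2 * ?b)\<bar> \<le> 4 * (M / \<kappa> * norm v)" .
  qed
  then have d: "\<bar>dwall \<kappa> M c y v\<bar> \<le> real CARD('n) * (4 * (M / \<kappa> * norm v))" by (simp only: sum_constant)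
  have "\<bar>2 * max 0 (1 - wall \<kappa> M c y)\<bar> \<le> 2" using wall_nonneg[of \<kappa> M c y] by simp
  then have "\<bar>dbump \<kappa> M c y v\<bar> \<le> (real CARD('n) * (4 * (M / \<kappa> * norm v))) * 2"
    unfolding dbump_def abs_mult[of "- _"] abs_minus using d by (intro mult_mono) auto
  also have "\<dots> = 8 * real CARD('n) * M / \<kappa> * norm v" by simp
  finally show ?thesis .
next
  case False
  then show ?thesis using k M by (simp add: dbump_def)
qed

lemma bump_eq_0: "1 \<le> wall \<kappa> M c y \<Longrightarrow> bump \<kappa> M c y = 0"
  and dbump_eq_0: "1 \<le> wall \<kappa> M c y \<Longrightarrow> dbump \<kappa> M c y v = 0"
  by (auto simp: bump_def dbump_def pos_sq_eq_0)

lemma wall_unique: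
  assumes "wall \<kappa> M c y < 1" "wall \<kappa> M c' y < 1" "0 < \<kappa>"
  shows "c = c'"
proof
  fix j
  show "c j = c' j"
    using wall_less_1[OF assms(1,3), of j] wall_less_1[OF assms(2,3), of j] by linarith
qed

text \<open>With \<open>A\<close> and \<open>g\<close> the derivatives of base point and height with
  respect to the parameter, \<open>a\<close> is the gradient of the height as a function of the base
  point. As \<open>A\<close> is within \<open>1 / 4\<close> of the identity, it has an inverse of
  norm at most \<open>4 / 3\<close>.\<close>

lemma exists_gradient:
  fixes A :: "real ^ 'n \<Rightarrow> real ^ 'n" and g :: "real ^ 'n \<Rightarrow> real"
  assumes A: "linear A" and g: "linear g" and Ab: "\<And>v. norm (A v - v) \<le> 1 / 4 * norm v"
    and gb: "\<And>v. \<bar>g v\<bar> \<le> \<gamma> * norm v" and \<gamma>: "0 \<le> \<gamma>"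
  shows "\<exists>a. (\<forall>v. a \<bullet> A v = g v) \<and> (\<forall>j. \<bar>a $ j\<bar> \<le> 4 / 3 * \<gamma>)"
proof -
  have low: "norm v \<le> 4 / 3 * norm (A v)" for v
    using Ab[of v] norm_triangle_ineq2[of v "A v"] by (simp add: norm_minus_commute)
  have "inj A" unfolding linear_injective_0[OF A]
  proof (intro allI impI)
    fix x assume "A x = 0"
    then show "x = 0" using low[of x] by simp
  qed
  then obtain B where B: "linear B" "\<And>x. B (A x) = x" "\<And>x. A (B x) = x"
    using linear_injective_isomorphism[OF A] by blast
  define a where "a = (\<chi> j. g (B (axis j 1)))"
  have lin: "linear (\<lambda>v. g (B v))" using linear_compose[OF B(1) g] by (simp add: o_def)
  have ga: "a \<bullet> v = g (B v)" for v
  proof -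
    have "v = (\<Sum>j\<in>UNIV. (v $ j) *\<^sub>R axis j 1)" by (simp add: basis_expansion flip: scalar_mult_eq_scaleR)
    then have "g (B v) = (\<Sum>j\<in>UNIV. v $ j * g (B (axis j 1)))"
      using linear_sum[OF lin, of "\<lambda>j. v $ j *\<^sub>R axis j 1" UNIV] linear_scale[OF lin] by simp
    then show ?thesis by (simp add: a_def inner_vec_def mult.commute)
  qed
  have "\<bar>a $ j\<bar> \<le> 4 / 3 * \<gamma>" for j
  proof -
    have "\<bar>a $ j\<bar> \<le> \<gamma> * norm (B (axis j 1))" using gb by (simp add: a_def)
    also have "\<dots> \<le> \<gamma> * (4 / 3 * norm (A (B (axis j 1))))" by (intro mult_left_mono low \<gamma>)
    finally show ?thesis by (simp add: B(3))
  qed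
  then show ?thesis using ga B by (intro exI[of _ a]) auto
qed

definition margin :: "real \<Rightarrow> nat \<Rightarrow> (real ^ 'n) set" where
  "margin \<kappa> M = {y \<in> hcube 0 1. \<not> (\<exists>c. (\<forall>j. c j < M) \<and>
     (\<forall>j. \<kappa> \<le> real M * y $ j - real (c j) \<and> real M * y $ j - real (c j) < 1 - \<kappa>))}"

text \<open>In each cell a concentric cube of relative side \<open>1 - 2 * \<kappa>\<close> is free
  of the margin, and \<open>1 - (1 - 2 * \<kappa>) ^ n <= 2 * n * \<kappa>\<close> by Bernoulli's
  inequality.\<close>

lemma measure_margin_le:
  fixes M :: nat
  assumes k: "0 < \<kappa>" "\<kappa> < 1 / 2" and M: "0 < M"
  shows "(margin \<kappa> M :: (real ^ 'n) set) \<in> sets borel"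
    and "measure lborel (margin \<kappa> M :: (real ^ 'n) set) \<le> 2 * real CARD('n) * \<kappa>"
proof -
  let ?n = "CARD('n)"
  let ?X = "margin \<kappa> M :: (real ^ 'n) set"
  let ?H = "hcube (\<chi> j. \<kappa> / real M) ((1 - 2 * \<kappa>) / real M) :: (real ^ 'n) set"
  let ?W = "hcube 0 (1 / real M) - ?H :: (real ^ 'n) set"
  let ?C = "{c :: 'n \<Rightarrow> nat. \<forall>j. c j < M}"
  have M0: "0 < real M" using M by simp
  have cell_iff: "(\<kappa> \<le> real M * y $ j - real (c j) \<and> real M * y $ j - real (c j) < 1 - \<kappa>) \<longleftrightarrow>
          1 / real M * real (c j) + \<kappa> / real M \<le> y $ j \<and> y $ j < 1 / real M * real (c j) + \<kappa> / real M + (1 - 2 * \<kappa>) / real M"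
        for y :: "real ^ 'n" and c :: "'n \<Rightarrow> nat" and j
      proof -
        have "1 / real M * real (c j) + \<kappa> / real M = (real (c j) + \<kappa>) / real M"
          "1 / real M * real (c j) + \<kappa> / real M + (1 - 2 * \<kappa>) / real M = (real (c j) + 1 - \<kappa>) / real M"
          using M0 by (auto simp: field_simps)
        then show ?thesis using M0 by (auto simp: divide_le_eq less_divide_eq mult.commute)
      qed
  have X: "?X \<in> sets borel"
  proof -
    have "?X = hcube 0 1 - (\<Union>c\<in>?C. hcube (gridpt (1 / real M) c + (\<chi> j. \<kappa> / real M)) ((1 - 2 * \<kappa>) / real M))"
    proof -
      show ?thesis by (auto simp: margin_def hcube_def gridpt_def cell_iff)
    qed
    also have "\<dots> \<in> sets borel" by (intro sets.Diff hcube_borel sets.finite_UN finite_grid)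
    finally show ?thesis .
  qed
  show "?X \<in> sets borel" by (rule X)
  have "measure lborel ?X \<le> real (card ?C) * measure lborel ?W"
  proof (rule measure_grid_union_le[where s = "1 / real M", OF X])
    show "?W \<in> sets borel" by (intro sets.Diff hcube_borel)
    show "bounded ?W" by (rule bounded_subset[OF bounded_hcube]) auto
    show "finite ?C" by (rule finite_grid)
    fix y assume y: "y \<in> ?X"
    define c where "c = (\<lambda>j. nat \<lfloor>y $ j / (1 / real M)\<rfloor>)"
    have c: "c j < M" "1 / real M * real (c j) \<le> y $ j" "y $ j < 1 / real M * real (c j) + 1 / real M" for j
      using y floor_grid[of "1 / real M" "y $ j" M] M0 unfolding c_def by (auto simp: margin_def hcube_def)
    have "y - gridpt (1 / real M) c \<in> hcube 0 (1 / real M)" using c by (simp add: hcube_def gridpt_def algebra_simps)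
    moreover have "y - gridpt (1 / real M) c \<notin> ?H"
    proof
      assume "y - gridpt (1 / real M) c \<in> ?H"
      then have "\<kappa> \<le> real M * y $ j - real (c j) \<and> real M * y $ j - real (c j) < 1 - \<kappa>" for j
      proof -
        have "\<kappa> / real M \<le> y $ j - 1 / real M * real (c j)"
          "y $ j - 1 / real M * real (c j) < \<kappa> / real M + (1 - 2 * \<kappa>) / real M"
          using \<open>y - gridpt (1 / real M) c \<in> ?H\<close> by (auto simp: hcube_def gridpt_def)
        then show ?thesis unfolding cell_iff by linarith
      qed
      then show False using y c(1) unfolding margin_def by blast
    qed
    ultimately show "\<exists>c\<in>?C. y - gridpt (1 / real M) c \<in> ?W" using c(1) by blast
  qed
  also have "measure lborel ?W = (1 / real M) ^ ?n - ((1 - 2 * \<kappa>) / real M) ^ ?n"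
  proof -
    have "?H \<subseteq> hcube 0 (1 / real M)"
    proof
      fix x assume x: "x \<in> ?H"
      have "0 \<le> x $ j \<and> x $ j < 1 / real M" for j
      proof -
        have "\<kappa> / real M \<le> x $ j" "x $ j < \<kappa> / real M + (1 - 2 * \<kappa>) / real M" using x by (auto simp: hcube_def)
        moreover have "\<kappa> / real M + (1 - 2 * \<kappa>) / real M \<le> 1 / real M"
          using k M0 by (simp add: divide_right_mono flip: add_divide_distrib)
        moreover have "0 \<le> \<kappa> / real M" using k by simp
        ultimately show ?thesis by linarith
      qed
      then show "x \<in> hcube 0 (1 / real M)" by (simp add: hcube_def)
    qed
    then have "measure lborel ?W = measure lborel (hcube 0 (1 / real M) :: (real ^ 'n) set) - measure lborel ?H"
      using fmeasurableD2[OF hcube_fmeasurable] by (intro measure_Diff) auto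
    then show ?thesis using k M0 by (simp add: measure_hcube)
  qed
  also have "real (card ?C) * \<dots> = 1 - (1 - 2 * \<kappa>) ^ ?n"
    using M0 by (simp add: card_grid power_divide field_simps)
  also have "\<dots> \<le> 2 * real ?n * \<kappa>"
    using Bernoulli_inequality[of "- 2 * \<kappa>" ?n] k by (simp add: algebra_simps)
  finally show "measure lborel ?X \<le> 2 * real ?n * \<kappa>" .
qed

text \<open>\<open>A\<close> and \<open>g\<close> stand for base point and height of a surface. Over
  a cell of width \<open>1 / M\<close> the height is nearly affine in the base point: the error
  \<open>w\<close> to a suitable member of the sequence is of order \<open>\<tau> / M\<close> and
  its derivative of order \<open>\<tau>\<close>. Multiplying \<open>w\<close> by a bump of slope of
  order \<open>M / \<kappa>\<close> creates a derivative of order \<open>\<tau> / \<kappa>\<close>,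
  which is small if \<open>\<tau>\<close> is chosen after \<open>\<kappa>\<close>, no matter how
  large \<open>M\<close> is. Where the bump is 1, adding the product makes the height exactly
  affine.\<close>

lemma local_affine_perturbation:
  fixes A :: "real ^ 'n \<Rightarrow> real ^ 'n" and g :: "real ^ 'n \<Rightarrow> real" and a :: "nat \<Rightarrow> real ^ 'n" and b :: "nat \<Rightarrow> real"
  defines "Q \<equiv> unit_cube :: (real ^ 'n) set"
  assumes dA: "\<And>x. x \<in> Q \<Longrightarrow> (A has_derivative A' x) (at x within Q)"
    and dg: "\<And>x. x \<in> Q \<Longrightarrow> (g has_derivative g' x) (at x within Q)"
    and cA: "\<And>v. continuous_on Q (\<lambda>x. A' x v)" and cg: "\<And>v. continuous_on Q (\<lambda>x. g' x v)"
    and uc: "\<And>t. 0 < t \<Longrightarrow> \<exists>\<theta>>0. \<forall>x\<in>Q. \<forall>x'\<in>Q. norm (x - x') < \<theta> \<longrightarrow>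
       (\<forall>v. norm (A' x v - A' x' v) \<le> t * norm v \<and> \<bar>g' x v - g' x' v\<bar> \<le> t * norm v)"
    and Ab: "\<And>x v. x \<in> Q \<Longrightarrow> norm (A' x v - v) \<le> 1 / 4 * norm v"
    and gb: "\<And>x v. x \<in> Q \<Longrightarrow> \<bar>g' x v\<bar> \<le> \<gamma> * norm v" and \<gamma>: "0 \<le> \<gamma>" "4 / 3 * \<gamma> < \<epsilon>"
    and ex: "\<And>x y. x \<in> Q \<Longrightarrow> y \<in> Q \<Longrightarrow> norm (x - y) \<le> 4 / 3 * norm (A x - A y)"
    and onto: "\<And>y. y \<in> core \<Longrightarrow> \<exists>x\<in>Q. A x = y"
    and g0: "\<And>x. x \<in> Q \<Longrightarrow> \<bar>g x\<bar> \<le> \<epsilon>"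
    and dens: "\<And>\<alpha> \<beta> t N. (\<And>j. \<bar>\<alpha> $ j\<bar> < \<epsilon>) \<Longrightarrow> \<bar>\<beta>\<bar> < (real CARD('n) + 2) * \<epsilon> \<Longrightarrow> 0 < t \<Longrightarrow>
       \<exists>i\<ge>N. norm (a i - \<alpha>) < t \<and> \<bar>b i - \<beta>\<bar> < t"
    and B: "0 < B"
  shows "\<exists>p p' S. finite S \<and> (\<forall>(i, K)\<in>S. N \<le> i \<and> compact K \<and> K \<subseteq> core \<and>
        (\<forall>x\<in>Q. A x \<in> K \<longrightarrow> g x + p x = a i \<bullet> A x + b i)) \<and>
      measure lborel (core - \<Union>(snd ` S)) < (1 / 2) ^ N \<and>
      (\<forall>x\<in>Q. (p has_derivative p' x) (at x within Q) \<and> \<bar>p x\<bar> \<le> B \<and> (\<forall>v. \<bar>p' x v\<bar> \<le> B * norm v)) \<and>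
      (\<forall>v. continuous_on Q (\<lambda>x. p' x v))"
proof -
  define n where "n = real CARD('n)"
  have n1: "1 \<le> n" by (simp add: n_def)
  have e0: "0 < \<epsilon>" using \<gamma> by linarith
  \<comment> \<open>The relative width of the margins; it depends on \<open>N\<close> and
    \<open>n\<close> only and makes their total measure less than
    \<open>(1 / 2) ^ N\<close>.\<close>
  define \<kappa> where "\<kappa> = min (1 / 4) ((1 / 2) ^ N / (4 * n))"
  have k: "0 < \<kappa>" "\<kappa> < 1 / 2" using n1 by (auto simp: \<kappa>_def)
  have kN: "2 * n * \<kappa> < (1 / 2) ^ N"
  proof -
    have "2 * n * \<kappa> \<le> 2 * n * ((1 / 2) ^ N / (4 * n))" using n1 by (intro mult_left_mono) (auto simp: \<kappa>_def)
    also have "\<dots> = (1 / 2) ^ N / 2" using n1 by simp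
    also have "\<dots> < (1 / 2) ^ N" by simp
    finally show ?thesis .
  qed
  \<comment> \<open>\<open>Z\<close> collects the constants of the final bounds:
    \<open>2 * n + 1\<close> from \<open>p\<close> itself, 1 from the term with \<open>w'\<close>,
    and \<open>16 * n * (2 * n + 1) / \<kappa>\<close> from the derivative of the bump.\<close>
  define Z where "Z = 16 * n * (2 * n + 1) / \<kappa> + 1 + (2 * n + 1)"
  define \<tau> where "\<tau> = B / Z"
  have Z1: "0 < 16 * n * (2 * n + 1) / \<kappa>" using n1 k by simp
  then have Z0: "0 < Z" using n1 by (simp add: Z_def)
  have t0: "0 < \<tau>" using B Z0 by (simp add: \<tau>_def)
  have tZ: "\<tau> * Z = B" using Z0 by (simp add: \<tau>_def)
  define \<tau>1 where "\<tau>1 = \<tau> / (4 * (n * \<epsilon> + 1))"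
  have ne: "0 < n * \<epsilon> + 1" using n1 e0 by (simp add: add_pos_pos)
  then have t1: "0 < \<tau>1" using t0 by (simp add: \<tau>1_def)
  obtain \<theta> where \<theta>: "0 < \<theta>" "\<And>x x' v. x \<in> Q \<Longrightarrow> x' \<in> Q \<Longrightarrow> norm (x - x') < \<theta> \<Longrightarrow>
      norm (A' x v - A' x' v) \<le> \<tau>1 * norm v \<and> \<bar>g' x v - g' x' v\<bar> \<le> \<tau>1 * norm v"
    using uc[OF t1] by blast
  \<comment> \<open>Parameters over the same cell are then closer than \<open>\<theta>\<close>, so
    the derivatives hardly change there.\<close>
  obtain M :: nat where M: "2 * n / \<theta> < real M" using reals_Archimedean2 by blast
  have "0 < 2 * n / \<theta>" using n1 \<theta>(1) by simp
  then have M0: "0 < real M" using M by linarith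
  then have M1: "1 \<le> real M" by simp
  have M\<theta>: "2 * n / real M < \<theta>" using M M0 \<theta>(1) by (simp add: field_simps)
  define C where "C = {c :: 'n \<Rightarrow> nat. (\<forall>j. c j < M) \<and> (\<exists>y\<in>core. \<forall>j. real (c j) \<le> real M * y $ j \<and> real M * y $ j \<le> real (c j) + 1)}"
  have finC: "finite C" by (rule finite_subset[OF _ finite_grid[of M]]) (auto simp: C_def)
  define \<tau>2 where "\<tau>2 = \<tau> / (4 * real M * (n + 1))"
  have t2: "0 < \<tau>2" using t0 M0 n1 by (simp add: \<tau>2_def)
  have t2': "\<tau>2 * (n + 1) \<le> \<tau> / real M" "5 / 4 * \<tau>2 \<le> \<tau> / 2"
  proof -
    have "\<tau>2 * (n + 1) = \<tau> / (4 * real M)" using n1 by (simp add: \<tau>2_def)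
    also have "\<dots> \<le> \<tau> / real M" using t0 M0 by (intro divide_left_mono) auto
    finally show "\<tau>2 * (n + 1) \<le> \<tau> / real M" .
    have "\<tau>2 \<le> \<tau> / 4" unfolding \<tau>2_def
      using t0 M1 n1 mult_mono[of 1 "real M" 1 "n + 1"] by (intro divide_left_mono) auto
    then show "5 / 4 * \<tau>2 \<le> \<tau> / 2" using t0 by simp
  qed
  define w where "w = (\<lambda>i x. a i \<bullet> A x + b i - g x)"
  define w' where "w' = (\<lambda>i x v. a i \<bullet> A' x v - g' x v)"
  have dw: "(w i has_derivative w' i x) (at x within Q)" if "x \<in> Q" for i x
    unfolding w_def[abs_def] w'_def[abs_def]
    by (intro has_derivative_diff dg that) (auto intro!: derivative_eq_intros dA that)
  define Pr where "Pr = (\<lambda>c xc i. xc \<in> Q \<and> A xc \<in> core \<and> (\<forall>j. real (c j) \<le> real M * A xc $ j \<and> real M * A xc $ j \<le> real (c j) + 1)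
     \<and> N \<le> i \<and> \<bar>w i xc\<bar> \<le> \<tau> / real M \<and> (\<forall>x\<in>Q. norm (x - xc) < \<theta> \<longrightarrow> (\<forall>v. \<bar>w' i x v\<bar> \<le> \<tau> * norm v)))"
  have Pr_ex: "\<exists>xc i. Pr c xc i"
    if c: "c \<in> C" for c
  proof -
    obtain y where y: "y \<in> core" "\<forall>j. real (c j) \<le> real M * y $ j \<and> real M * y $ j \<le> real (c j) + 1"
      using c by (auto simp: C_def)
    obtain xc where xc: "xc \<in> Q" "A xc = y" using onto[OF y(1)] by blast
    obtain \<alpha> where \<alpha>: "\<And>v. \<alpha> \<bullet> A' xc v = g' xc v" "\<And>j. \<bar>\<alpha> $ j\<bar> \<le> 4 / 3 * \<gamma>"
      using exists_gradient[OF has_derivative_linear[OF dA[OF xc(1)]] has_derivative_linear[OF dg[OF xc(1)]] Ab[OF xc(1)] gb[OF xc(1)] \<gamma>(1)]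
      by blast
    have \<alpha>e: "\<bar>\<alpha> $ j\<bar> < \<epsilon>" for j using \<alpha>(2)[of j] \<gamma>(2) by linarith
    have sy: "(\<Sum>j\<in>UNIV. \<bar>y $ j\<bar>) \<le> n"
    proof -
      have "(\<Sum>j\<in>UNIV. \<bar>y $ j\<bar>) \<le> (\<Sum>j\<in>(UNIV::'n set). 1)"
      proof (rule sum_mono)
        fix j have "1 / 4 \<le> y $ j" "y $ j \<le> 3 / 4" using y(1) by (auto simp: mem_core)
        then show "\<bar>y $ j\<bar> \<le> 1" by simp
      qed
      then show ?thesis by (simp add: n_def)
    qed
    \<comment> \<open>The tangent plane at \<open>y\<close> has slopes below \<epsilon>, and
      \<open>core\<close> lies in a unit cube, so its constant term is at most
      \<open>\<epsilon> + n * \<epsilon>\<close>. The strictly larger bound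
      \<open>(n + 2) * \<epsilon>\<close> leaves room for approximation by the sequence.\<close>
    define \<beta> where "\<beta> = g xc - \<alpha> \<bullet> y"
    have "\<bar>\<alpha> \<bullet> y\<bar> \<le> \<epsilon> * (\<Sum>j\<in>UNIV. \<bar>y $ j\<bar>)"
      using l1_lipschitz_affine[of \<alpha> \<epsilon> y 0 0] \<alpha>e by (simp add: less_imp_le)
    also have "\<dots> \<le> \<epsilon> * n" using e0 by (intro mult_left_mono sy) auto
    finally have "\<bar>\<beta>\<bar> \<le> \<epsilon> + \<epsilon> * n" using g0[OF xc(1)] unfolding \<beta>_def by linarith
    also have "\<dots> < (real CARD('n) + 2) * \<epsilon>" using e0 by (simp add: n_def algebra_simps)
    finally have \<beta>: "\<bar>\<beta>\<bar> < (real CARD('n) + 2) * \<epsilon>" .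
    obtain i where i: "N \<le> i" "norm (a i - \<alpha>) < \<tau>2" "\<bar>b i - \<beta>\<bar> < \<tau>2" using dens[OF \<alpha>e \<beta> t2] by blast
    have ny: "norm y \<le> n" using norm_le_l1_cart[of y] sy by linarith
    have "w i xc = (a i - \<alpha>) \<bullet> y + (b i - \<beta>)" by (simp add: w_def xc \<beta>_def inner_diff_left)
    then have "\<bar>w i xc\<bar> \<le> \<bar>(a i - \<alpha>) \<bullet> y\<bar> + \<bar>b i - \<beta>\<bar>" by simp
    also have "\<dots> \<le> \<tau>2 * n + \<tau>2"
      using i ny t2 n1 by (intro add_mono order_trans[OF Cauchy_Schwarz_ineq2] mult_mono) auto
    also have "\<dots> \<le> \<tau> / real M" using t2'(1) by (simp add: algebra_simps)
    finally have wc: "\<bar>w i xc\<bar> \<le> \<tau> / real M" .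
    have "\<bar>w' i x v\<bar> \<le> \<tau> * norm v" if x: "x \<in> Q" "norm (x - xc) < \<theta>" for x v
    proof -
      note th = \<theta>(2)[OF x(1) xc(1) x(2), of v]
      have "norm (A' x v) \<le> norm v + norm (A' x v - v)" using norm_triangle_ineq[of v "A' x v - v"] by simp
      then have nA: "norm (A' x v) \<le> 5 / 4 * norm v" using Ab[OF x(1), of v] by linarith
      have n\<alpha>: "norm \<alpha> \<le> n * \<epsilon>"
      proof -
        have "norm \<alpha> \<le> (\<Sum>j\<in>UNIV. \<bar>\<alpha> $ j\<bar>)" by (rule norm_le_l1_cart)
        also have "\<dots> \<le> (\<Sum>j\<in>(UNIV::'n set). \<epsilon>)" by (intro sum_mono less_imp_le \<alpha>e)
        finally show ?thesis by (simp add: n_def)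
      qed
      have "w' i x v = (a i - \<alpha>) \<bullet> A' x v + \<alpha> \<bullet> (A' x v - A' xc v) - (g' x v - g' xc v)"
        by (simp add: w'_def inner_diff_left inner_diff_right \<alpha>(1))
      then have "\<bar>w' i x v\<bar> \<le> \<bar>(a i - \<alpha>) \<bullet> A' x v\<bar> + \<bar>\<alpha> \<bullet> (A' x v - A' xc v)\<bar> + \<bar>g' x v - g' xc v\<bar>" by linarith
      also have "\<dots> \<le> \<tau>2 * (5 / 4 * norm v) + (n * \<epsilon>) * (\<tau>1 * norm v) + \<tau>1 * norm v"
        using i(2) nA n\<alpha> th t2 n1 e0
        by (intro add_mono order_trans[OF Cauchy_Schwarz_ineq2] mult_mono) auto
      also have "\<dots> = (5 / 4 * \<tau>2) * norm v + (\<tau>1 * (n * \<epsilon> + 1)) * norm v" by (simp add: algebra_simps)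
      also have "\<tau>1 * (n * \<epsilon> + 1) = \<tau> / 4"
      proof -
        have "t / (4 * X) * X = t / 4" if "0 < X" for t X :: real using that by simp
        from this[OF ne] show ?thesis unfolding \<tau>1_def .
      qed
      also have "(5 / 4 * \<tau>2) * norm v + \<tau> / 4 * norm v \<le> \<tau> / 2 * norm v + \<tau> / 4 * norm v"
        using t2'(2) by (intro add_right_mono mult_right_mono) auto
      also have "\<dots> \<le> \<tau> * norm v" using t0 by (simp add: algebra_simps flip: distrib_right)
      finally show ?thesis .
    qed
    then show ?thesis using xc y i wc unfolding Pr_def by blast
  qed
  have "\<exists>u. Pr c (fst u) (snd u)" if c: "c \<in> C" for c
  proof -
    obtain x i where "Pr c x i" using Pr_ex[OF c] by blast
    then show ?thesis by (intro exI[of _ "(x, i)"]) simp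
  qed
  then have "\<forall>c\<in>C. \<exists>u. Pr c (fst u) (snd u)" by blast
  from bchoice[OF this] obtain z where z: "\<And>c. c \<in> C \<Longrightarrow> Pr c (fst (z c)) (snd (z c))" by blast
  obtain xc ic where xcQ: "\<And>c. c \<in> C \<Longrightarrow> xc c \<in> Q"
    and xcc: "\<And>c j. c \<in> C \<Longrightarrow> real (c j) \<le> real M * A (xc c) $ j \<and> real M * A (xc c) $ j \<le> real (c j) + 1"
    and ic: "\<And>c. c \<in> C \<Longrightarrow> N \<le> ic c" and wc: "\<And>c. c \<in> C \<Longrightarrow> \<bar>w (ic c) (xc c)\<bar> \<le> \<tau> / real M"
    and wc': "\<And>c x v. c \<in> C \<Longrightarrow> x \<in> Q \<Longrightarrow> norm (x - xc c) < \<theta> \<Longrightarrow> \<bar>w' (ic c) x v\<bar> \<le> \<tau> * norm v"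
  proof (rule that[of "\<lambda>c. fst (z c)" "\<lambda>c. snd (z c)"])
  qed (use z in \<open>auto simp: Pr_def\<close>)
  have close: "norm (x - xc c) \<le> 2 * n / real M \<and> \<bar>w (ic c) x\<bar> \<le> \<tau> * (2 * n + 1) / real M"
    if c: "c \<in> C" and x: "x \<in> Q" and wl: "wall \<kappa> (real M) c (A x) < 1" for c x
  proof -
    have comp: "\<bar>A x $ j - A (xc c) $ j\<bar> \<le> 1 / real M" for j
    proof -
      have "\<bar>real M * A x $ j - real M * A (xc c) $ j\<bar> \<le> 1"
        using wall_less_1[OF wl k(1), of j] xcc[OF c, of j] by linarith
      then have "real M * \<bar>A x $ j - A (xc c) $ j\<bar> \<le> 1" using M0 by (simp add: abs_mult flip: right_diff_distrib)
      then show ?thesis using M0 by (simp add: field_simps)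
    qed
    have "norm (A x - A (xc c)) \<le> (\<Sum>j\<in>UNIV. \<bar>(A x - A (xc c)) $ j\<bar>)" by (rule norm_le_l1_cart)
    also have "\<dots> \<le> (\<Sum>j\<in>(UNIV::'n set). 1 / real M)" using comp by (intro sum_mono) simp
    also have "\<dots> = n / real M" by (simp add: n_def)
    finally have "norm (x - xc c) \<le> 4 / 3 * (n / real M)" using ex[OF x xcQ[OF c]] by linarith
    also have "\<dots> = (4 / 3 * n) / real M" by simp
    also have "\<dots> \<le> 2 * n / real M" using n1 M0 by (intro divide_right_mono) auto
    finally have d: "norm (x - xc c) \<le> 2 * n / real M" .
    have "norm (w (ic c) x - w (ic c) (xc c)) \<le> \<tau> * norm (x - xc c)"
    proof (rule differentiable_bound[of "Q \<inter> ball (xc c) \<theta>" "w (ic c)" "w' (ic c)"])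
      show "convex (Q \<inter> ball (xc c) \<theta>)" unfolding Q_def by (intro convex_Int convex_unit_cube convex_ball)
      fix z assume z: "z \<in> Q \<inter> ball (xc c) \<theta>"
      show "(w (ic c) has_derivative w' (ic c) z) (at z within Q \<inter> ball (xc c) \<theta>)"
        using z by (intro has_derivative_subset[OF dw]) auto
      show "onorm (w' (ic c) z) \<le> \<tau>"
        using z wc'[OF c, of z] t0 by (intro onorm_bound) (auto simp: dist_norm norm_minus_commute)
    next
      show "x \<in> Q \<inter> ball (xc c) \<theta>" using x d M\<theta> by (simp add: dist_norm norm_minus_commute)
      show "xc c \<in> Q \<inter> ball (xc c) \<theta>" using xcQ[OF c] \<theta>(1) by simp
    qed
    also have "\<dots> \<le> \<tau> * (2 * n / real M)" using d t0 by (intro mult_left_mono) auto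
    finally have "\<bar>w (ic c) x\<bar> \<le> \<tau> * (2 * n / real M) + \<tau> / real M" using wc[OF c] by (simp add: abs_le_iff)
    also have "\<dots> = \<tau> * (2 * n + 1) / real M" by (simp add: distrib_left add_divide_distrib)
    finally show ?thesis using d by simp
  qed
  define p where "p = (\<lambda>x. \<Sum>c\<in>C. bump \<kappa> (real M) c (A x) * w (ic c) x)"
  define p' where "p' = (\<lambda>x v. \<Sum>c\<in>C. bump \<kappa> (real M) c (A x) * w' (ic c) x v
      + dbump \<kappa> (real M) c (A x) (A' x v) * w (ic c) x)"
  define K where "K = (\<lambda>c. core \<inter> {y :: real ^ 'n. \<forall>j. \<kappa> \<le> real M * y $ j - real (c j) \<and> real M * y $ j - real (c j) \<le> 1 - \<kappa>})"
  define S where "S = (\<lambda>c. (ic c, K c)) ` C"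
  have contA: "continuous_on Q A" using dA has_derivative_continuous_on by blast
  have contg: "continuous_on Q g" using dg has_derivative_continuous_on by blast
  \<comment> \<open>The bumps live in disjoint open cells, so at every point at most one summand
    survives.\<close>
  have sum1: "(\<Sum>c\<in>C. F c) = F c0" if c0: "c0 \<in> C" and w0: "wall \<kappa> (real M) c0 (A x) < 1"
      and z0: "\<And>c. 1 \<le> wall \<kappa> (real M) c (A x) \<Longrightarrow> F c = 0" for F :: "('n \<Rightarrow> nat) \<Rightarrow> real" and c0 x
  proof -
    have F0: "F c = 0" if c: "c \<in> C - {c0}" for c
    proof (cases "wall \<kappa> (real M) c (A x) < 1")
      case True
      then have "c = c0" by (rule wall_unique[OF _ w0 k(1)])
      then show ?thesis using c by simp
    next
      case False
      then show ?thesis using z0 by simp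
    qed
    then show ?thesis using c0 finC by (subst sum.remove[of _ c0]) (auto intro: sum.neutral)
  qed
  have "finite S" using finC by (simp add: S_def)
  moreover have "\<forall>(i, K)\<in>S. N \<le> i \<and> compact K \<and> K \<subseteq> core \<and>
        (\<forall>x\<in>Q. A x \<in> K \<longrightarrow> g x + p x = a i \<bullet> A x + b i)"
  proof -
    have "compact (K c)" for c
    proof -
      have "{y :: real ^ 'n. \<forall>j. \<kappa> \<le> real M * y $ j - real (c j) \<and> real M * y $ j - real (c j) \<le> 1 - \<kappa>}
        = (\<Inter>j. {y. \<kappa> \<le> real M * y $ j - real (c j)} \<inter> {y. real M * y $ j - real (c j) \<le> 1 - \<kappa>})" by auto
      moreover have "closed \<dots>" by (intro closed_INT ballI closed_Int closed_Collect_le continuous_intros)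
      ultimately show ?thesis unfolding K_def core_def by (intro compact_Int_closed compact_cbox) simp
    qed
    moreover have "g x + p x = a (ic c) \<bullet> A x + b (ic c)" if c: "c \<in> C" and x: "x \<in> Q" "A x \<in> K c" for c x
    proof -
      have w0: "wall \<kappa> (real M) c (A x) = 0" using x(2) by (intro wall_eq_0 k) (auto simp: K_def)
      have "p x = bump \<kappa> (real M) c (A x) * w (ic c) x"
        unfolding p_def using c w0 by (intro sum1[where x = x]) (auto simp: bump_eq_0)
      then show ?thesis by (simp add: bump_def w0 pos_sq_1 w_def)
    qed
    ultimately show ?thesis using ic by (auto simp: S_def K_def)
  qed
  moreover have "measure lborel (core - \<Union>(snd ` S)) < (1 / 2) ^ N"
  proof -
    have m: "(margin \<kappa> M :: (real ^ 'n) set) \<in> sets borel" "measure lborel (margin \<kappa> M :: (real ^ 'n) set) \<le> 2 * real CARD('n) * \<kappa>"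
      using measure_margin_le[OF k, of M, where 'n = 'n] M0 by auto
    have sub: "core - \<Union>(snd ` S) \<subseteq> margin \<kappa> M"
    proof
      fix y :: "real ^ 'n" assume y: "y \<in> core - \<Union>(snd ` S)"
      have "False" if c: "\<forall>j. c j < M" "\<forall>j. \<kappa> \<le> real M * y $ j - real (c j) \<and> real M * y $ j - real (c j) < 1 - \<kappa>" for c
      proof -
        have "\<forall>j. real (c j) \<le> real M * y $ j \<and> real M * y $ j \<le> real (c j) + 1"
        proof
          fix j show "real (c j) \<le> real M * y $ j \<and> real M * y $ j \<le> real (c j) + 1" using spec[OF c(2), of j] k by linarith
        qed
        then have "c \<in> C" using c(1) y by (auto simp: C_def)
        moreover have "y \<in> K c" using y c(2) by (auto simp: K_def less_imp_le)
        ultimately show False using y by (auto simp: S_def)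
      qed
      then show "y \<in> margin \<kappa> M" using y core_subset_hcube unfolding margin_def by blast
    qed
    have "measure lborel (core - \<Union>(snd ` S)) \<le> measure lborel (margin \<kappa> M :: (real ^ 'n) set)"
    proof (rule measure_mono_fmeasurable[OF sub])
      have "\<Union>(snd ` S) = (\<Union>x\<in>S. snd x)" by simp
      moreover have "closed (\<Union>x\<in>S. snd x)"
        using \<open>finite S\<close> \<open>\<forall>(i, K)\<in>S. _\<close> by (intro closed_UN) (auto intro!: compact_imp_closed)
      ultimately show "core - \<Union>(snd ` S) \<in> sets lborel" unfolding core_def by auto
      show "(margin \<kappa> M :: (real ^ 'n) set) \<in> fmeasurable lborel"
        by (rule fmeasurableI2[OF hcube_fmeasurable[of 0 1]]) (use m in \<open>auto simp: margin_def\<close>)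
    qed
    then show ?thesis using m(2) kN by (simp add: n_def)
  qed
  moreover have "(p has_derivative p' x) (at x within Q) \<and> \<bar>p x\<bar> \<le> B \<and> (\<forall>v. \<bar>p' x v\<bar> \<le> B * norm v)" if x: "x \<in> Q" for x
  proof (intro conjI allI)
    show "(p has_derivative p' x) (at x within Q)"
      unfolding p_def[abs_def] p'_def[abs_def]
    proof (intro has_derivative_sum has_derivative_mult dw x)
      fix c
      show "((\<lambda>x. bump \<kappa> (real M) c (A x)) has_derivative (\<lambda>v. dbump \<kappa> (real M) c (A x) (A' x v))) (at x within Q)"
        using has_derivative_compose[OF dA[OF x] bump_deriv[of \<kappa> "real M" c "A x"]] k(1) by simp
    qed
    have "\<bar>p x\<bar> \<le> \<tau> * (2 * n + 1) / real M"
    proof (cases "\<exists>c\<in>C. wall \<kappa> (real M) c (A x) < 1")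
      case True
      then obtain c where c: "c \<in> C" "wall \<kappa> (real M) c (A x) < 1" by blast
      have "p x = bump \<kappa> (real M) c (A x) * w (ic c) x"
        unfolding p_def by (rule sum1[OF c]) (simp add: bump_eq_0)
      then have "\<bar>p x\<bar> = bump \<kappa> (real M) c (A x) * \<bar>w (ic c) x\<bar>"
        using bump_bounds(1)[of \<kappa> "real M" c "A x"] by (simp add: abs_mult)
      also have "\<dots> \<le> 1 * (\<tau> * (2 * n + 1) / real M)"
        using close[OF c(1) x c(2)] by (intro mult_mono bump_bounds) auto
      finally show ?thesis by simp
    next
      case False
      then have "p x = 0" unfolding p_def by (intro sum.neutral) (auto simp: not_less bump_eq_0)
      then show ?thesis using t0 n1 by simp
    qed
    also have "\<dots> \<le> \<tau> * (2 * n + 1) / 1" using t0 n1 M1 by (intro divide_left_mono) auto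
    also have "\<dots> = \<tau> * (2 * n + 1)" by simp
    also have "\<dots> \<le> \<tau> * Z" using t0 Z1 by (intro mult_left_mono) (auto simp: Z_def)
    finally show "\<bar>p x\<bar> \<le> B" by (simp add: tZ)
    fix v
    have nA: "norm (A' x v) \<le> 2 * norm v"
    proof -
      have "norm (A' x v) \<le> norm v + norm (A' x v - v)" using norm_triangle_ineq[of v "A' x v - v"] by simp
      then show ?thesis using Ab[OF x, of v] norm_ge_zero[of v] by linarith
    qed
    show "\<bar>p' x v\<bar> \<le> B * norm v"
    proof (cases "\<exists>c\<in>C. wall \<kappa> (real M) c (A x) < 1")
      case True
      then obtain c where c: "c \<in> C" "wall \<kappa> (real M) c (A x) < 1" by blast
      note cl = close[OF c(1) x c(2)]
      have "norm (x - xc c) < \<theta>" using cl M\<theta> by linarith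
      note w'b = wc'[OF c(1) x this, of v]
      have "p' x v = bump \<kappa> (real M) c (A x) * w' (ic c) x v + dbump \<kappa> (real M) c (A x) (A' x v) * w (ic c) x"
        unfolding p'_def by (rule sum1[OF c]) (simp add: bump_eq_0 dbump_eq_0)
      then have "\<bar>p' x v\<bar> \<le> bump \<kappa> (real M) c (A x) * \<bar>w' (ic c) x v\<bar> + \<bar>dbump \<kappa> (real M) c (A x) (A' x v)\<bar> * \<bar>w (ic c) x\<bar>"
        using bump_bounds(1)[of \<kappa> "real M" c "A x"]
          abs_triangle_ineq[of "bump \<kappa> (real M) c (A x) * w' (ic c) x v" "dbump \<kappa> (real M) c (A x) (A' x v) * w (ic c) x"]
        by (simp add: abs_mult)
      also have "\<dots> \<le> 1 * (\<tau> * norm v) + (8 * n * real M / \<kappa> * (2 * norm v)) * (\<tau> * (2 * n + 1) / real M)"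
      proof (intro add_mono mult_mono w'b bump_bounds)
        have "\<bar>dbump \<kappa> (real M) c (A x) (A' x v)\<bar> \<le> 8 * n * real M / \<kappa> * norm (A' x v)"
          unfolding n_def by (rule dbump_bound[OF k(1)]) simp
        also have "\<dots> \<le> 8 * n * real M / \<kappa> * (2 * norm v)" using n1 k by (intro mult_left_mono nA) auto
        finally show "\<bar>dbump \<kappa> (real M) c (A x) (A' x v)\<bar> \<le> 8 * n * real M / \<kappa> * (2 * norm v)" .
      qed (use cl n1 k t0 in auto)
      \<comment> \<open>The factor \<open>real M\<close> in the slope of the bump cancels against
        the \<open>1 / real M\<close> in the bound for \<open>w\<close>.\<close>
      also have "\<dots> = \<tau> * (16 * n * (2 * n + 1) / \<kappa> + 1) * norm v"
      proof -
        have eq: "(8 * n * real M / \<kappa> * (2 * norm v)) * (\<tau> * (2 * n + 1) / real M) = \<tau> * (16 * n * (2 * n + 1) / \<kappa>) * norm v"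
          using M0 k(1) by (simp add: divide_simps)
        show ?thesis unfolding eq by (simp only: distrib_left distrib_right mult_1 mult_1_right add.commute)
      qed
      also have "\<dots> \<le> \<tau> * Z * norm v"
        using t0 n1 by (intro mult_right_mono mult_left_mono) (auto simp: Z_def)
      finally show ?thesis by (simp add: tZ)
    next
      case False
      then have "p' x v = 0" unfolding p'_def by (intro sum.neutral) (auto simp: not_less bump_eq_0 dbump_eq_0)
      then show ?thesis using B by simp
    qed
  qed
  moreover have "continuous_on Q (\<lambda>x. p' x v)" for v
    unfolding p'_def w'_def w_def
    by (intro continuous_intros continuous_on_bump continuous_on_dbump contA cA cg contg)
  ultimately show ?thesis
    by (intro exI[of _ p] exI[of _ p'] exI[of _ S] conjI ballI allI) (assumption | elim bspec | simp)+
qed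

subsection \<open>Dense open sets of surfaces\<close>

lemma C1_on_add_scaleR:
  fixes f :: "real ^ 'n \<Rightarrow> 'a::real_normed_vector"
  assumes f: "C1_on S f" and p: "\<And>x. x \<in> S \<Longrightarrow> (p has_derivative p' x) (at x within S)"
    and cp: "\<And>v. continuous_on S (\<lambda>x. p' x v)"
  shows "C1_on S (\<lambda>x. f x + p x *\<^sub>R u)"
proof -
  obtain f' where f': "\<And>x. x \<in> S \<Longrightarrow> (f has_derivative blinfun_apply (f' x)) (at x within S)" and cf: "continuous_on S f'"
    using f by (auto simp: C1_on_def)
  define F where "F = (\<lambda>x. f' x + Blinfun (\<lambda>v. p' x v *\<^sub>R u))"
  have bl: "bounded_linear (\<lambda>v. p' x v *\<^sub>R u)" if "x \<in> S" for x
    using bounded_linear_compose[OF bounded_linear_scaleR_left has_derivative_bounded_linear[OF p[OF that]]] .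
  have F: "blinfun_apply (F x) v = f' x v + p' x v *\<^sub>R u" if "x \<in> S" for x v
    by (simp add: F_def plus_blinfun.rep_eq bounded_linear_Blinfun_apply[OF bl[OF that]])
  have "((\<lambda>x. f x + p x *\<^sub>R u) has_derivative blinfun_apply (F x)) (at x within S)" if x: "x \<in> S" for x
  proof -
    have "((\<lambda>x. f x + p x *\<^sub>R u) has_derivative (\<lambda>v. f' x v + p' x v *\<^sub>R u)) (at x within S)"
      by (intro has_derivative_add f' x bounded_linear.has_derivative[OF bounded_linear_scaleR_left] p)
    moreover have "(\<lambda>v. f' x v + p' x v *\<^sub>R u) = blinfun_apply (F x)" using F[OF x] by auto
    ultimately show ?thesis by simp
  qed
  moreover have "continuous_on S F"
  proof (rule continuous_on_blinfun_componentwise)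
    fix i :: "real ^ 'n"
    have "continuous_on S (\<lambda>x. f' x i + p' x i *\<^sub>R u)" by (intro continuous_intros cf cp)
    then show "continuous_on S (\<lambda>x. blinfun_apply (F x) i)"
      by (rule continuous_on_cong[THEN iffD1, rotated -1]) (auto simp: F)
  qed
  ultimately show ?thesis unfolding C1_on_def by blast
qed

context coords
begin

lemma flat_deriv: "x \<in> unit_cube \<Longrightarrow> (flat has_derivative (\<lambda>v. \<Sum>j\<in>UNIV. v $ j *\<^sub>R e j)) (at x within unit_cube)"
proof (rule has_derivative_transform)
  have bl: "bounded_linear (\<lambda>x :: real ^ 'n. \<Sum>j\<in>UNIV. x $ j *\<^sub>R e j)"
    by (intro bounded_linear_sum bounded_linear_compose[OF bounded_linear_scaleR_left] bounded_linear_vec_nth)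
  then show "((\<lambda>x. \<Sum>j\<in>UNIV. x $ j *\<^sub>R e j) has_derivative (\<lambda>v. \<Sum>j\<in>UNIV. v $ j *\<^sub>R e j)) (at x within unit_cube)"
    using bounded_linear.has_derivative[OF bl has_derivative_ident] by simp
qed (auto simp: flat_def)

lemma near_deriv:
  assumes f: "f \<in> near \<epsilon>" and D: "(f has_derivative D) (at x within unit_cube)" and x: "x \<in> unit_cube"
  shows "norm (\<pi> (D v) - v) \<le> lip \<epsilon> * norm v" and "\<bar>\<tau> (D v)\<bar> \<le> lip \<epsilon> * norm v"
proof -
  let ?F = "\<lambda>v :: real ^ 'n. \<Sum>j\<in>UNIV. v $ j *\<^sub>R e j"
  have "C1_on unit_cube (\<lambda>x. f x - flat x)"
    using f flat_surface by (intro C1_on_diff) (auto simp: near_def surfaces_def)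
  from has_derivative_partial_bound[OF this has_derivative_diff[OF D flat_deriv[OF x]] x, of v]
  have "norm (D v - ?F v) \<le> real CARD('n) * C1_norm (\<lambda>x. f x - flat x) * norm v" .
  also have "\<dots> \<le> real CARD('n) * \<epsilon> * norm v"
    using f flat_surface by (intro mult_right_mono mult_left_mono) (auto simp: near_def C1_dist_def)
  finally have d: "L * norm (D v - ?F v) \<le> lip \<epsilon> * norm v" using L by (simp add: lip_def mult.assoc)
  have "\<pi> (?F v) = v"
    using bounded_linear.linear[OF pi] by (simp add: linear_sum linear_scale pi_e basis_expansion flip: scalar_mult_eq_scaleR)
  then show "norm (\<pi> (D v) - v) \<le> lip \<epsilon> * norm v" using piL[of "D v - ?F v"] d by (simp add: pi_diff)
  have "\<tau> (?F v) = 0" using bounded_linear.linear[OF tau] by (simp add: linear_sum linear_scale tau_e)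
  then show "\<bar>\<tau> (D v)\<bar> \<le> lip \<epsilon> * norm v" using tauL[of "D v - ?F v"] d by (simp add: tau_diff)
qed

text \<open>Being exactly affine on pieces would not be stable. Strict inequalities on finitely many
  compact pieces make an open condition, and the tolerance \<open>\<delta> i\<close> may depend on
  the affine function used.\<close>

definition good :: "real \<Rightarrow> (nat \<Rightarrow> real ^ 'n) \<Rightarrow> (nat \<Rightarrow> real) \<Rightarrow> (nat \<Rightarrow> real) \<Rightarrow> nat \<Rightarrow> (real ^ 'n \<Rightarrow> 'a) set" where
  "good \<epsilon> a b \<delta> N = {f \<in> near \<epsilon>. \<exists>S. finite S \<and> (\<forall>(i, K)\<in>S. N \<le> i \<and> compact K \<and> K \<subseteq> core \<and>
      (\<forall>y\<in>K. \<bar>hgt f y - (a i \<bullet> y + b i)\<bar> < \<delta> i)) \<and> measure lborel (core - \<Union>(snd ` S)) < (1 / 2) ^ N}"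

lemma goodI:
  assumes "f \<in> near \<epsilon>" "finite S"
    and "\<And>i K. (i, K) \<in> S \<Longrightarrow> N \<le> i \<and> compact K \<and> K \<subseteq> core \<and> (\<forall>y\<in>K. \<bar>hgt f y - (a i \<bullet> y + b i)\<bar> < \<delta> i)"
    and "measure lborel (core - \<Union>(snd ` S)) < (1 / 2) ^ N"
  shows "f \<in> good \<epsilon> a b \<delta> N"
  unfolding good_def
proof (intro CollectI conjI exI[of _ S] ballI)
  fix s assume s: "s \<in> S"
  obtain i K where iK: "s = (i, K)" by (cases s)
  from assms(3)[of i K] s show "case s of (i, K) \<Rightarrow> N \<le> i \<and> compact K \<and> K \<subseteq> core \<and> (\<forall>y\<in>K. \<bar>hgt f y - (a i \<bullet> y + b i)\<bar> < \<delta> i)"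
    unfolding iK prod.case by blast
qed (use assms in blast)+

lemma goodE:
  assumes "f \<in> good \<epsilon> a b \<delta> N"
  obtains S where "finite S"
    "\<And>i K. (i, K) \<in> S \<Longrightarrow> N \<le> i \<and> compact K \<and> K \<subseteq> core \<and> (\<forall>y\<in>K. \<bar>hgt f y - (a i \<bullet> y + b i)\<bar> < \<delta> i)"
    "measure lborel (core - \<Union>(snd ` S)) < (1 / 2) ^ N"
proof -
  from assms obtain S where S: "finite S" "\<forall>(i, K)\<in>S. N \<le> i \<and> compact K \<and> K \<subseteq> core \<and> (\<forall>y\<in>K. \<bar>hgt f y - (a i \<bullet> y + b i)\<bar> < \<delta> i)"
    "measure lborel (core - \<Union>(snd ` S)) < (1 / 2) ^ N"
    unfolding good_def by blast
  show ?thesis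
  proof (rule that[OF S(1) _ S(3)])
    fix i K assume "(i, K) \<in> S"
    from bspec[OF S(2) this] show "N \<le> i \<and> compact K \<and> K \<subseteq> core \<and> (\<forall>y\<in>K. \<bar>hgt f y - (a i \<bullet> y + b i)\<bar> < \<delta> i)"
      unfolding prod.case .
  qed
qed

text \<open>On a compact piece the strict inequality holds with positive slack; the least slack of
  the finitely many pieces is compared with the change of the height by
  \<open>hgt_dist\<close>.\<close>

lemma openin_good:
  assumes c: "lip \<epsilon> \<le> 1 / 4" "L * \<epsilon> \<le> 1 / 4" and d: "\<And>i. 0 < \<delta> i"
  shows "openin surface_topology (good \<epsilon> a b \<delta> N)"
proof -
  interpret Metric_space "surfaces :: (real ^ 'n \<Rightarrow> 'a) set" C1_dist by (rule Metric_space_surfaces)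
  have "\<exists>r>0. mball f r \<subseteq> good \<epsilon> a b \<delta> N" if f: "f \<in> good \<epsilon> a b \<delta> N" for f
  proof -
    have fn: "f \<in> near \<epsilon>" using f by (simp add: good_def)
    obtain S where S: "finite S"
      "\<And>i K. (i, K) \<in> S \<Longrightarrow> N \<le> i \<and> compact K \<and> K \<subseteq> core \<and> (\<forall>y\<in>K. \<bar>hgt f y - (a i \<bullet> y + b i)\<bar> < \<delta> i)"
      "measure lborel (core - \<Union>(snd ` S)) < (1 / 2) ^ N"
      by (rule goodE[OF f]) (rule that)
    have cont: "continuous_on core (hgt f)"
    proof (rule lipschitz_on_continuous_on)
      show "\<bar>4 / 3 * lip \<epsilon>\<bar>-lipschitz_on core (hgt f)"
      proof (rule lipschitz_onI)
        fix y z :: "real ^ 'n" assume "y \<in> core" "z \<in> core"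
        from hgt_lipschitz[OF fn c this]
        have "\<bar>hgt f y - hgt f z\<bar> \<le> 4 / 3 * lip \<epsilon> * norm (y - z)" .
        also have "\<dots> \<le> \<bar>4 / 3 * lip \<epsilon>\<bar> * norm (y - z)" by (intro mult_right_mono) auto
        finally show "dist (hgt f y) (hgt f z) \<le> \<bar>4 / 3 * lip \<epsilon>\<bar> * dist y z" by (simp add: dist_norm)
      qed simp
    qed
    have "\<exists>m>0. \<forall>y\<in>snd s. \<bar>hgt f y - (a (fst s) \<bullet> y + b (fst s))\<bar> + m \<le> \<delta> (fst s)" if s: "s \<in> S" for s
    proof (cases "snd s = {}")
      case True
      then show ?thesis by (intro exI[of _ 1]) auto
    next
      case False
      have K: "compact (snd s)" "snd s \<subseteq> core" "\<forall>y\<in>snd s. \<bar>hgt f y - (a (fst s) \<bullet> y + b (fst s))\<bar> < \<delta> (fst s)"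
        using S(2)[of "fst s" "snd s"] s by auto
      have "continuous_on (snd s) (\<lambda>y. \<bar>hgt f y - (a (fst s) \<bullet> y + b (fst s))\<bar>)"
        by (intro continuous_intros continuous_on_subset[OF cont K(2)])
      from continuous_attains_sup[OF K(1) False this] obtain y0 where y0: "y0 \<in> snd s"
        "\<And>y. y \<in> snd s \<Longrightarrow> \<bar>hgt f y - (a (fst s) \<bullet> y + b (fst s))\<bar> \<le> \<bar>hgt f y0 - (a (fst s) \<bullet> y0 + b (fst s))\<bar>" by blast
      show ?thesis
      proof (intro exI[of _ "\<delta> (fst s) - \<bar>hgt f y0 - (a (fst s) \<bullet> y0 + b (fst s))\<bar>"] conjI ballI)
        show "0 < \<delta> (fst s) - \<bar>hgt f y0 - (a (fst s) \<bullet> y0 + b (fst s))\<bar>" using K(3) y0(1) by simp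
        fix y assume "y \<in> snd s"
        from y0(2)[OF this] show "\<bar>hgt f y - (a (fst s) \<bullet> y + b (fst s))\<bar> + (\<delta> (fst s) - \<bar>hgt f y0 - (a (fst s) \<bullet> y0 + b (fst s))\<bar>) \<le> \<delta> (fst s)"
          by simp
      qed
    qed
    then obtain m where m: "\<And>s. s \<in> S \<Longrightarrow> 0 < m s" "\<And>s y. s \<in> S \<Longrightarrow> y \<in> snd s \<Longrightarrow> \<bar>hgt f y - (a (fst s) \<bullet> y + b (fst s))\<bar> + m s \<le> \<delta> (fst s)"
      by metis
    \<comment> \<open>The inserted 1 covers the case of an empty \<open>S\<close>.\<close>
    define m0 where "m0 = Min (insert 1 (m ` S))"
    have m0: "0 < m0" unfolding m0_def using S(1) m(1) by (subst Min_gr_iff) auto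
    have m0le: "m0 \<le> m s" if "s \<in> S" for s unfolding m0_def using S(1) that by (intro Min_le) auto
    obtain r1 where r1: "0 < r1" "mball f r1 \<subseteq> near \<epsilon>"
      using openin_near[of \<epsilon>] fn by (auto simp: surface_topology_def openin_mtopology)
    define r where "r = min r1 (m0 / (2 * L))"
    have "mball f r \<subseteq> good \<epsilon> a b \<delta> N"
    proof
      fix f' assume f': "f' \<in> mball f r"
      then have "f' \<in> mball f r1" by (auto simp: r_def)
      then have f'n: "f' \<in> near \<epsilon>" using r1(2) by blast
      have "C1_dist f f' < m0 / (2 * L)" using f' by (auto simp: r_def)
      then have dd: "2 * L * C1_dist f f' < m0" using L by (simp add: field_simps)
      have "N \<le> i \<and> compact K \<and> K \<subseteq> core \<and> (\<forall>y\<in>K. \<bar>hgt f' y - (a i \<bullet> y + b i)\<bar> < \<delta> i)" if s: "(i, K) \<in> S" for i K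
      proof (intro conjI ballI)
        fix y assume y: "y \<in> K"
        then have yc: "y \<in> core" using S(2)[OF s] by blast
        have "\<bar>hgt f y - hgt f' y\<bar> < m0" using hgt_dist[OF fn f'n c yc] dd by linarith
        moreover have "\<bar>hgt f y - (a i \<bullet> y + b i)\<bar> + m (i, K) \<le> \<delta> i" using m(2)[OF s] y by simp
        ultimately show "\<bar>hgt f' y - (a i \<bullet> y + b i)\<bar> < \<delta> i" using m0le[OF s] by linarith
      qed (use S(2)[OF s] in auto)
      then show "f' \<in> good \<epsilon> a b \<delta> N" by (rule goodI[OF f'n S(1) _ S(3)])
    qed
    moreover have "0 < r" using r1(1) m0 L by (simp add: r_def)
    ultimately show ?thesis by blast
  qed
  moreover have "good \<epsilon> a b \<delta> N \<subseteq> surfaces" by (auto simp: good_def near_def)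
  ultimately show ?thesis by (simp add: surface_topology_def openin_mtopology)
qed

text \<open>The surface is perturbed in the direction \<open>e0\<close> only. This leaves all base
  points where they are, so on the pieces the new height is exactly the affine function, within
  every tolerance.\<close>

lemma dense_good:
  assumes c: "lip \<epsilon>' \<le> 1 / 4" "L * \<epsilon>' \<le> 1 / 4" "4 / 3 * lip \<epsilon>' < \<epsilon>" "L * \<epsilon>' \<le> \<epsilon>" "0 < \<epsilon>'" and d: "\<And>i. 0 < \<delta> i"
    and dens: "\<And>\<alpha> \<beta> t N. (\<And>j. \<bar>\<alpha> $ j\<bar> < \<epsilon>) \<Longrightarrow> \<bar>\<beta>\<bar> < (real CARD('n) + 2) * \<epsilon> \<Longrightarrow> 0 < t \<Longrightarrow>
       \<exists>i\<ge>N. norm (a i - \<alpha>) < t \<and> \<bar>b i - \<beta>\<bar> < t"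
    and f: "f \<in> near \<epsilon>'" and \<eta>: "0 < \<eta>"
  shows "\<exists>f'\<in>good \<epsilon>' a b \<delta> N. C1_dist f f' < \<eta>"
proof -
  interpret Metric_space "surfaces :: (real ^ 'n \<Rightarrow> 'a) set" C1_dist by (rule Metric_space_surfaces)
  let ?Q = "unit_cube :: (real ^ 'n) set"
  have fs: "f \<in> surfaces" and fe: "C1_dist f flat < \<epsilon>'" using f by (auto simp: near_def)
  have C1f: "C1_on ?Q f" using fs by (simp add: surfaces_def)
  then obtain f' where f': "\<And>x. x \<in> ?Q \<Longrightarrow> (f has_derivative blinfun_apply (f' x)) (at x within ?Q)" and cf': "continuous_on ?Q f'"
    by (auto simp: C1_on_def)
  define A where "A = (\<lambda>x. \<pi> (f x))"
  define g where "g = (\<lambda>x. \<tau> (f x))"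
  define A' where "A' = (\<lambda>x v. \<pi> (blinfun_apply (f' x) v))"
  define g' where "g' = (\<lambda>x v. \<tau> (blinfun_apply (f' x) v))"
  \<comment> \<open>The second term keeps the perturbed surface in
    \<open>near \<epsilon>'\<close>.\<close>
  define \<eta>' where "\<eta>' = min \<eta> (\<epsilon>' - C1_dist f flat)"
  have \<eta>': "0 < \<eta>'" using \<eta> fe by (simp add: \<eta>'_def)
  define B where "B = \<eta>' / (norm e0 + 1) / 2"
  have e1: "0 < norm e0 + 1" by (simp add: add_nonneg_pos)
  have B: "0 < B" using \<eta>' e1 by (simp add: B_def)
  have Be: "B * norm e0 < \<eta>'"
  proof -
    have "B * norm e0 \<le> B * (norm e0 + 1)" using B by (intro mult_left_mono) auto
    also have "\<dots> = \<eta>' / 2"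
    proof -
      have "t / X / 2 * X = t / 2" if "0 < X" for t X :: real using that by simp
      from this[OF e1] show ?thesis unfolding B_def .
    qed
    finally show ?thesis using \<eta>' by linarith
  qed
  have l0: "0 \<le> lip \<epsilon>'" using L c(5) by (simp add: lip_def)
  have "\<exists>p p' S. finite S \<and> (\<forall>(i, K)\<in>S. N \<le> i \<and> compact K \<and> K \<subseteq> core \<and>
        (\<forall>x\<in>?Q. A x \<in> K \<longrightarrow> g x + p x = a i \<bullet> A x + b i)) \<and>
      measure lborel (core - \<Union>(snd ` S)) < (1 / 2) ^ N \<and>
      (\<forall>x\<in>?Q. (p has_derivative p' x) (at x within ?Q) \<and> \<bar>p x\<bar> \<le> B \<and> (\<forall>v. \<bar>p' x v\<bar> \<le> B * norm v)) \<and>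
      (\<forall>v. continuous_on ?Q (\<lambda>x. p' x v))" (is "\<exists>p p' S. ?P p p' S")
  proof (rule local_affine_perturbation[where \<gamma> = "lip \<epsilon>'" and \<epsilon> = \<epsilon>, OF _ _ _ _ _ _ _ l0 c(3) _ _ _ _ B])
    show "(A has_derivative A' x) (at x within ?Q)" if "x \<in> ?Q" for x
      unfolding A_def A'_def by (rule bounded_linear.has_derivative[OF pi f'[OF that]])
    show "(g has_derivative g' x) (at x within ?Q)" if "x \<in> ?Q" for x
      unfolding g_def g'_def by (rule bounded_linear.has_derivative[OF tau f'[OF that]])
    show "continuous_on ?Q (\<lambda>x. A' x v)" for v
      unfolding A'_def by (intro bounded_linear.continuous_on[OF pi] continuous_intros cf')
    show "continuous_on ?Q (\<lambda>x. g' x v)" for v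
      unfolding g'_def by (intro bounded_linear.continuous_on[OF tau] continuous_intros cf')
    show "\<exists>\<theta>>0. \<forall>x\<in>?Q. \<forall>x'\<in>?Q. norm (x - x') < \<theta> \<longrightarrow>
       (\<forall>v. norm (A' x v - A' x' v) \<le> t * norm v \<and> \<bar>g' x v - g' x' v\<bar> \<le> t * norm v)" if t: "0 < t" for t
    proof -
      have "uniformly_continuous_on ?Q f'" by (rule compact_uniformly_continuous[OF cf' compact_unit_cube])
      moreover have "0 < t / L" using t L by simp
      ultimately obtain \<theta> where \<theta>: "0 < \<theta>" "\<And>x x'. x \<in> ?Q \<Longrightarrow> x' \<in> ?Q \<Longrightarrow> dist x' x < \<theta> \<Longrightarrow> dist (f' x') (f' x) < t / L"
        unfolding uniformly_continuous_on_def by metis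
      show ?thesis
      proof (intro exI[of _ \<theta>] conjI ballI impI allI)
        fix x x' :: "real ^ 'n" and v :: "real ^ 'n" assume x: "x \<in> ?Q" "x' \<in> ?Q" "norm (x - x') < \<theta>"
        have "norm (f' x - f' x') < t / L" using \<theta>(2)[of x' x] x by (simp add: dist_norm)
        then have "norm (blinfun_apply (f' x - f' x') v) \<le> t / L * norm v"
          by (intro order_trans[OF norm_blinfun] mult_right_mono) auto
        then have l: "L * norm (blinfun_apply (f' x - f' x') v) \<le> t * norm v" using L by (simp add: field_simps)
        show "norm (A' x v - A' x' v) \<le> t * norm v"
          using piL[of "blinfun_apply (f' x - f' x') v"] l by (simp add: A'_def blinfun.diff_left pi_diff)
        show "\<bar>g' x v - g' x' v\<bar> \<le> t * norm v"
          using tauL[of "blinfun_apply (f' x - f' x') v"] l by (simp add: g'_def blinfun.diff_left tau_diff)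
      qed (rule \<theta>(1))
    qed
    show "norm (A' x v - v) \<le> 1 / 4 * norm v" if "x \<in> ?Q" for x v
      using near_deriv(1)[OF f f'[OF that] that, of v] c(1) unfolding A'_def
      by (meson mult_right_mono norm_ge_zero order_trans)
    show "\<bar>g' x v\<bar> \<le> lip \<epsilon>' * norm v" if "x \<in> ?Q" for x v
      unfolding g'_def by (rule near_deriv(2)[OF f f'[OF that] that])
    show "norm (x - y) \<le> 4 / 3 * norm (A x - A y)" if "x \<in> ?Q" "y \<in> ?Q" for x y
      unfolding A_def by (rule near_expand[OF f that c(1)])
    show "\<exists>x\<in>?Q. A x = y" if "y \<in> core" for y
      unfolding A_def using cinv[OF f c(1,2) that] by blast
    show "\<bar>g x\<bar> \<le> \<epsilon>" if "x \<in> ?Q" for x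
      unfolding g_def using near_tau[OF f that] c(4) by linarith
    show "\<exists>i\<ge>N. norm (a i - \<alpha>) < t \<and> \<bar>b i - \<beta>\<bar> < t"
      if "\<And>j. \<bar>\<alpha> $ j\<bar> < \<epsilon>" "\<bar>\<beta>\<bar> < (real CARD('n) + 2) * \<epsilon>" "0 < t" for \<alpha> \<beta> t N
      by (rule dens[OF that])
  qed
  then obtain p p' S where H: "?P p p' S" by (elim exE)
  note S0 = conjunct1[OF H] conjunct1[OF conjunct2[OF H]] conjunct1[OF conjunct2[OF conjunct2[OF H]]]
  note p0 = conjunct1[OF conjunct2[OF conjunct2[OF conjunct2[OF H]]]]
  note p4 = spec[OF conjunct2[OF conjunct2[OF conjunct2[OF conjunct2[OF H]]]]]
  have S2: "N \<le> i \<and> compact K \<and> K \<subseteq> core \<and> (\<forall>x\<in>?Q. A x \<in> K \<longrightarrow> g x + p x = a i \<bullet> A x + b i)"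
    if "(i, K) \<in> S" for i K
    using bspec[OF S0(2) that] unfolding prod.case by assumption
  note S = S0(1) S2 S0(3)
  have p: "\<And>x. x \<in> ?Q \<Longrightarrow> (p has_derivative p' x) (at x within ?Q)" "\<And>x. x \<in> ?Q \<Longrightarrow> \<bar>p x\<bar> \<le> B"
      "\<And>x v. x \<in> ?Q \<Longrightarrow> \<bar>p' x v\<bar> \<le> B * norm v"
    using p0 by auto
  note p = p p4
  define F where "F = restrict (\<lambda>x. f x + p x *\<^sub>R e0) ?Q"
  have C1F0: "C1_on ?Q (\<lambda>x. f x + p x *\<^sub>R e0)" by (rule C1_on_add_scaleR[OF C1f p(1,4)])
  have C1F: "C1_on ?Q F"
  proof -
    obtain G where G: "\<forall>x\<in>?Q. ((\<lambda>x. f x + p x *\<^sub>R e0) has_derivative blinfun_apply (G x)) (at x within ?Q)" "continuous_on ?Q G"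
      using C1F0 by (auto simp: C1_on_def)
    then have "\<forall>x\<in>?Q. (F has_derivative blinfun_apply (G x)) (at x within ?Q)"
      by (auto simp: F_def intro: has_derivative_transform)
    then show ?thesis using G(2) by (auto simp: C1_on_def)
  qed
  have FS: "F \<in> surfaces" using C1F by (simp add: surfaces_def F_def)
  have "C1_norm (\<lambda>x. f x - F x) \<le> B * norm e0"
  proof (rule C1_norm_least; rule sup_norm_least)
    fix x assume x: "x \<in> ?Q"
    show "norm (f x - F x) \<le> B * norm e0" using p(2)[OF x] x by (simp add: F_def mult_right_mono)
    fix j
    have "((\<lambda>x. f x - F x) has_derivative (\<lambda>v. - (p' x v *\<^sub>R e0))) (at x within ?Q)"
    proof (rule has_derivative_transform[OF x])
      show "((\<lambda>x. - (p x *\<^sub>R e0)) has_derivative (\<lambda>v. - (p' x v *\<^sub>R e0))) (at x within ?Q)"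
        by (intro has_derivative_minus bounded_linear.has_derivative[OF bounded_linear_scaleR_left] p(1) x)
    qed (simp add: F_def)
    from partial_eq[OF this x, of j]
    have "norm (partial j (\<lambda>x. f x - F x) x) = \<bar>p' x (axis j 1)\<bar> * norm e0" by simp
    also have "\<dots> \<le> B * norm e0" using p(3)[OF x, of "axis j 1"] by (intro mult_right_mono) auto
    finally show "norm (partial j (\<lambda>x. f x - F x) x) \<le> B * norm e0" .
  qed
  then have dF: "C1_dist f F < \<eta>'" using fs FS Be by (simp add: C1_dist_def)
  have Fn: "F \<in> near \<epsilon>'"
  proof -
    have "C1_dist F flat \<le> C1_dist F f + C1_dist f flat" by (rule triangle[OF FS fs flat_surface])
    also have "C1_dist F f = C1_dist f F" by (rule commute)
    finally show ?thesis using dF FS unfolding near_def \<eta>'_def by simp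
  qed
  have "N \<le> i \<and> compact K \<and> K \<subseteq> core \<and> (\<forall>y\<in>K. \<bar>hgt F y - (a i \<bullet> y + b i)\<bar> < \<delta> i)" if s: "(i, K) \<in> S" for i K
  proof (intro conjI ballI)
    fix y assume y: "y \<in> K"
    then have yc: "y \<in> core" using S(2)[OF s] by blast
    note ci = cinv[OF Fn c(1,2) yc]
    let ?x = "cinv F y"
    have x: "?x \<in> ?Q" using ci by blast
    have Fx: "F ?x = f ?x + p ?x *\<^sub>R e0" using x by (simp add: F_def)
    have "\<pi> (F ?x) = A ?x" using bounded_linear.linear[OF pi] by (simp add: Fx A_def linear_add linear_scale pi_e0)
    then have Ay: "A ?x = y" using ci by simp
    have "hgt F y = g ?x + p ?x"
      using bounded_linear.linear[OF tau] by (simp add: hgt_def Fx g_def linear_add linear_scale tau_e0)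
    also have "\<dots> = a i \<bullet> y + b i" using S(2)[OF s] x Ay y by auto
    finally show "\<bar>hgt F y - (a i \<bullet> y + b i)\<bar> < \<delta> i" using d by simp
  qed (use S(2)[OF s] in auto)
  then have "F \<in> good \<epsilon>' a b \<delta> N" by (rule goodI[OF Fn S(1) _ S(3)])
  moreover have "C1_dist f F < \<eta>" using dF by (simp add: \<eta>'_def)
  ultimately show ?thesis by blast
qed

end

subsection \<open>The porous set\<close>

lemma fmeasurable_lborel_imp_lmeasurable: "A \<in> fmeasurable lborel \<Longrightarrow> A \<in> lmeasurable"
  by (auto simp: fmeasurable_def)

text \<open>Each covering set is mapped into a cube of side \<open>2 * L\<close> times its diameter.
  Covers of small \<open>n\<close>-th power sum thus turn into covers by cubes of small total
  volume.\<close>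

lemma hausdorff_null_imp_negligible:
  fixes \<pi> :: "'a::real_normed_vector \<Rightarrow> real ^ 'n"
  assumes H: "hausdorff_measure CARD('n) E = 0"
    and lip: "\<And>u v. norm (\<pi> u - \<pi> v) \<le> L * norm (u - v)" and L: "0 \<le> L"
  shows "negligible (\<pi> ` E)"
proof (rule negligible_outer_le[THEN iffD2], intro allI impI)
  fix \<eta> :: real assume \<eta>: "0 < \<eta>"
  let ?n = "CARD('n)"
  \<comment> \<open>The summand 1 makes \<open>c\<close> positive also for
    \<open>L = 0\<close>.\<close>
  define c where "c = (2 * L) ^ ?n + 1"
  have c0: "0 < c" using L by (simp add: c_def add_nonneg_pos)
  have "hausdorff_premeasure ?n 1 E \<le> hausdorff_measure ?n E"
    unfolding hausdorff_measure_def by (rule SUP_upper) simp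
  then have "hausdorff_premeasure ?n 1 E < ennreal (\<eta> / c)" using H \<eta> c0 by simp
  then obtain X :: "nat \<Rightarrow> 'a set" where X: "E \<subseteq> (\<Union>i. X i)" "\<And>i. bounded (X i)"
      "(\<Sum>i. if X i = {} then 0 else ennreal (diameter (X i) ^ ?n)) < ennreal (\<eta> / c)"
    unfolding hausdorff_premeasure_def INF_less_iff by auto
  define u where "u = (\<lambda>i. SOME v. v \<in> X i)"
  have u: "u i \<in> X i" if "X i \<noteq> {}" for i unfolding u_def using that by (simp add: some_in_eq)
  define s where "s = (\<lambda>i. L * diameter (X i))"
  have s0: "0 \<le> s i" for i using L diameter_ge_0[OF X(2)] by (simp add: s_def)
  define C where "C = (\<lambda>i. if X i = {} then {} else cbox (\<pi> (u i) - (\<chi> j. s i)) (\<pi> (u i) - (\<chi> j. s i) + (\<chi> j. 2 * s i)))"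
  have XC: "\<pi> ` X i \<subseteq> C i" for i
  proof
    fix y assume "y \<in> \<pi> ` X i"
    then obtain v where v: "v \<in> X i" "y = \<pi> v" by blast
    then have ne: "X i \<noteq> {}" by blast
    have "norm (v - u i) \<le> diameter (X i)"
      using diameter_bounded_bound[OF X(2) v(1) u[OF ne]] by (simp add: dist_norm)
    then have "norm (\<pi> v - \<pi> (u i)) \<le> s i"
      unfolding s_def using lip[of v "u i"] L by (meson mult_left_mono order_trans)
    then have "\<bar>(\<pi> v - \<pi> (u i)) $ j\<bar> \<le> s i" for j
      using component_le_norm_cart[of "\<pi> v - \<pi> (u i)" j] by linarith
    then have b: "\<bar>y $ j - \<pi> (u i) $ j\<bar> \<le> s i" for j using v(2) by simp
    have "\<pi> (u i) $ j - s i \<le> y $ j \<and> y $ j \<le> \<pi> (u i) $ j - s i + 2 * s i" for j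
      using b[of j] by linarith
    then show "y \<in> C i" using ne by (simp add: C_def mem_box_cart)
  qed
  have Cm: "emeasure lborel (C i) \<le> ennreal c * (if X i = {} then 0 else ennreal (diameter (X i) ^ ?n))" for i
  proof (cases "X i = {}")
    case False
    have "emeasure lborel (C i) = ennreal (measure lborel (C i))"
      using False by (intro emeasure_eq_ennreal_measure) (simp add: C_def emeasure_lborel_cbox_eq)
    also have "measure lborel (C i) = (2 * s i) ^ ?n"
      using False s0[of i] measure_cbox_cube[of "2 * s i" "\<pi> (u i) - (\<chi> j. s i)"] by (simp add: C_def)
    also have "\<dots> = (2 * L) ^ ?n * diameter (X i) ^ ?n" by (simp add: s_def power_mult_distrib)
    also have "\<dots> \<le> c * diameter (X i) ^ ?n"
      using diameter_ge_0[OF X(2)] by (intro mult_right_mono) (auto simp: c_def)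
    also have "ennreal (c * diameter (X i) ^ ?n) = ennreal c * ennreal (diameter (X i) ^ ?n)"
      using c0 diameter_ge_0[OF X(2)] by (intro ennreal_mult) auto
    finally show ?thesis using False by (simp add: ennreal_leI)
  qed (simp add: C_def)
  have Cs: "C i \<in> sets lborel" for i by (simp add: C_def)
  have "emeasure lborel (\<Union>i. C i) \<le> (\<Sum>i. emeasure lborel (C i))"
    using Cs by (intro emeasure_subadditive_countably) auto
  also have "\<dots> \<le> (\<Sum>i. ennreal c * (if X i = {} then 0 else ennreal (diameter (X i) ^ ?n)))"
    by (intro suminf_le Cm) auto
  also have "\<dots> = ennreal c * (\<Sum>i. if X i = {} then 0 else ennreal (diameter (X i) ^ ?n))"
    by (rule ennreal_suminf_cmult)
  also have "\<dots> \<le> ennreal c * ennreal (\<eta> / c)" using X(3) by (intro mult_left_mono) auto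
  also have "\<dots> = ennreal \<eta>" using c0 \<eta> by (simp flip: ennreal_mult)
  finally have em: "emeasure lborel (\<Union>i. C i) \<le> ennreal \<eta>" .
  have Us: "(\<Union>i. C i) \<in> sets lborel" using Cs by auto
  have fm: "(\<Union>i. C i) \<in> fmeasurable lborel"
    using Us em by (intro fmeasurableI) (auto simp: ennreal_less_top intro: le_less_trans)
  show "\<exists>T. \<pi> ` E \<subseteq> T \<and> T \<in> lmeasurable \<and> measure lebesgue T \<le> \<eta>"
  proof (intro exI[of _ "\<Union>i. C i"] conjI)
    show "\<pi> ` E \<subseteq> (\<Union>i. C i)" using X(1) XC by blast
    show "(\<Union>i. C i) \<in> lmeasurable" using fm by (rule fmeasurable_lborel_imp_lmeasurable)
    have "measure lebesgue (\<Union>i. C i) = measure lborel (\<Union>i. C i)" using Us by (simp add: measure_completion)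
    also have "\<dots> \<le> \<eta>" unfolding measure_def using em \<eta> by (intro enn2real_leI) auto
    finally show "measure lebesgue (\<Union>i. C i) \<le> \<eta>" .
  qed
qed

text \<open>Approximations are needed at arbitrarily late indices, that is, at arbitrarily fine
  levels, so every member of a countable dense set is repeated infinitely often.\<close>

lemma dense_affine_sequence:
  fixes \<epsilon> :: real
  assumes "0 < \<epsilon>"
  obtains a :: "nat \<Rightarrow> real ^ 'n" and b :: "nat \<Rightarrow> real" where
    "\<And>i j. \<bar>a i $ j\<bar> \<le> \<epsilon>" "\<And>i. \<bar>b i\<bar> \<le> (real CARD('n) + 2) * \<epsilon>"
    "\<forall>\<alpha> \<beta> t N. (\<forall>j. \<bar>\<alpha> $ j\<bar> < \<epsilon>) \<longrightarrow> \<bar>\<beta>\<bar> < (real CARD('n) + 2) * \<epsilon> \<longrightarrow> 0 < t \<longrightarrow>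
       (\<exists>i\<ge>N. norm (a i - \<alpha>) < t \<and> \<bar>b i - \<beta>\<bar> < t)"
proof -
  let ?m = "(real CARD('n) + 2) * \<epsilon>"
  obtain D :: "((real ^ 'n) \<times> real) set" where D: "countable D" "\<And>X. open X \<Longrightarrow> X \<noteq> {} \<Longrightarrow> \<exists>d\<in>D. d \<in> X"
    using countable_dense_setE by blast
  have Dne: "D \<noteq> {}" using D(2)[of UNIV] by auto
  define ok where "ok = (\<lambda>z :: (real ^ 'n) \<times> real. (\<forall>j. \<bar>fst z $ j\<bar> \<le> \<epsilon>) \<and> \<bar>snd z\<bar> \<le> ?m)"
  \<comment> \<open>The second component of the pair is a dummy that produces the repetitions; pairs
    violating the bounds are replaced by 0.\<close>
  define z where "z = (\<lambda>i. let y = from_nat_into D (fst (prod_decode i)) in if ok y then y else 0)"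
  have okz: "ok (z i)" for i using assms by (auto simp: z_def Let_def ok_def)
  show ?thesis
  proof (rule that[of "\<lambda>i. fst (z i)" "\<lambda>i. snd (z i)"])
    show "\<bar>fst (z i) $ j\<bar> \<le> \<epsilon>" for i j using okz[of i] by (simp add: ok_def)
    show "\<bar>snd (z i)\<bar> \<le> ?m" for i using okz[of i] by (simp add: ok_def)
    show "\<forall>\<alpha> \<beta> t N. (\<forall>j. \<bar>\<alpha> $ j\<bar> < \<epsilon>) \<longrightarrow> \<bar>\<beta>\<bar> < ?m \<longrightarrow> 0 < t \<longrightarrow>
       (\<exists>i\<ge>N. norm (fst (z i) - \<alpha>) < t \<and> \<bar>snd (z i) - \<beta>\<bar> < t)"
    proof (intro allI impI)
      fix \<alpha> :: "real ^ 'n" and \<beta> t :: real and N :: nat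
      assume \<alpha>: "\<forall>j. \<bar>\<alpha> $ j\<bar> < \<epsilon>" and \<beta>: "\<bar>\<beta>\<bar> < ?m" and t: "0 < t"
      define X where "X = (ball \<alpha> t \<inter> (\<Inter>j. {x. \<bar>x $ j\<bar> < \<epsilon>})) \<times> (ball \<beta> t \<inter> {x. \<bar>x\<bar> < ?m})"
      have "open X" unfolding X_def
        by (intro open_Times open_Int open_ball open_INT ballI open_Collect_less continuous_intros) auto
      moreover have "(\<alpha>, \<beta>) \<in> X" using \<alpha> \<beta> t by (simp add: X_def)
      ultimately obtain d where d: "d \<in> D" "d \<in> X" using D(2) by blast
      obtain k where k: "from_nat_into D k = d" using from_nat_into_surj[OF D(1) d(1)] by blast
      have "ok d" using d(2) by (auto simp: X_def ok_def less_imp_le)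
      then have zk: "z (prod_encode (k, N)) = d" by (simp add: z_def k)
      show "\<exists>i\<ge>N. norm (fst (z i) - \<alpha>) < t \<and> \<bar>snd (z i) - \<beta>\<bar> < t"
      proof (intro exI[of _ "prod_encode (k, N)"] conjI)
        show "N \<le> prod_encode (k, N)" by (rule le_prod_encode_2)
        have "fst d \<in> ball \<alpha> t" "snd d \<in> ball \<beta> t" using d(2) by (auto simp: X_def)
        then show "norm (fst (z (prod_encode (k, N))) - \<alpha>) < t" "\<bar>snd (z (prod_encode (k, N))) - \<beta>\<bar> < t"
          unfolding zk by (simp_all add: dist_norm norm_minus_commute abs_minus_commute)
      qed
    qed
  qed
qed

lemma rad_antimono: "k \<le> k' \<Longrightarrow> rad p q k' \<le> rad p q k"
  by (simp add: rad_def frac_le)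

lemma level_holes_cong: "g y = g' y \<Longrightarrow> y \<in> level_holes p q m g \<longleftrightarrow> y \<in> level_holes p q m g'"
  by (simp add: level_holes_def holes_def)

lemma sum_half_powers_le:
  assumes "finite F" "\<And>i. i \<in> F \<Longrightarrow> N \<le> i"
  shows "(\<Sum>i\<in>F. (1 / 2 :: real) ^ i) \<le> 2 * (1 / 2) ^ N"
proof -
  obtain M where M: "\<And>i. i \<in> F \<Longrightarrow> i < N + M"
  proof (rule that[of "Suc (Max (insert 0 F))"])
    fix i assume "i \<in> F"
    then have "i \<le> Max (insert 0 F)" using assms(1) by (intro Max_ge) auto
    then show "i < N + Suc (Max (insert 0 F))" by simp
  qed
  have "(\<Sum>i\<in>F. (1 / 2 :: real) ^ i) \<le> (\<Sum>i\<in>{N..<N + M}. (1 / 2) ^ i)"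
    using assms M by (intro sum_mono2) auto
  also have "\<dots> = (\<Sum>i<M. (1 / 2) ^ (i + N))"
    by (rule sum.reindex_bij_witness[of _ "\<lambda>i. i + N" "\<lambda>i. i - N"]) auto
  also have "\<dots> = (1 / 2) ^ N * (\<Sum>i<M. (1 / 2) ^ i)" by (simp add: power_add sum_distrib_left mult.commute)
  also have "\<dots> \<le> (1 / 2) ^ N * 2" by (intro mult_left_mono) (auto simp: sum_gp_strict)
  finally show ?thesis by simp
qed

context coords
begin

text \<open>The function under \<open>level_holes\<close> is evaluated at \<open>\<pi> v\<close>
  only, so the last condition says that \<open>v\<close> lies in no hole of level \<open>i\<close>.
  In this form it is directly comparable with the holes met by a graph, see
  \<open>level_holes_cong\<close>.\<close>

definition porous_set :: "(nat \<Rightarrow> nat) \<Rightarrow> (nat \<Rightarrow> nat) \<Rightarrow> (nat \<Rightarrow> nat) \<Rightarrow> (nat \<Rightarrow> real ^ 'n) \<Rightarrow> (nat \<Rightarrow> real) \<Rightarrow> 'a set" where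
  "porous_set p q m a b = {v. (\<forall>N. \<exists>i\<ge>N. \<pi> v \<in> seen (p i) (q i) (m i) \<and> \<bar>\<tau> v - (a i \<bullet> \<pi> v + b i)\<bar> < rad (p i) (q i) (m i)) \<and>
     (\<forall>i. \<pi> v \<notin> level_holes (p i) (q i) (m i) (\<lambda>y. \<tau> v - (a i \<bullet> y + b i)))}"

text \<open>The points \<open>u\<close> near \<open>x + (5 / 2 * r) *\<^sub>R e0\<close>, with
  \<open>r\<close> the radius of scale \<open>k\<close>, have base points moved by at most
  \<open>r / 16\<close> from the middle third, and heights within
  \<open>r / 4 + r / 16 + r / 16 < r / 2\<close> of the middle height \<open>5 / 2 * r\<close> of
  the hole.\<close>

lemma hole_contains_ball:
  assumes k: "k < m" and q: "2 \<le> q" and e: "\<epsilon> * (6 * real CARD('n)) \<le> 1" and a: "\<And>j. \<bar>\<alpha> $ j\<bar> \<le> \<epsilon>"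
    and s: "\<forall>j. 2 ^ q * rad p q k * real (c j) + rad p q k \<le> \<pi> x $ j \<and> \<pi> x $ j < 2 ^ q * rad p q k * real (c j) + 2 * rad p q k"
    and t: "\<bar>\<tau> x - (\<alpha> \<bullet> \<pi> x + \<beta>)\<bar> < rad p q m"
    and u: "L * norm (u - (x + (5 / 2 * rad p q k) *\<^sub>R e0)) \<le> rad p q k / 16"
  shows "\<pi> u \<in> level_holes p q m (\<lambda>y. \<tau> u - (\<alpha> \<bullet> y + \<beta>))"
proof -
  define r where "r = rad p q k"
  have r0: "0 < r" by (simp add: r_def rad_pos)
  define d where "d = u - (x + (5 / 2 * r) *\<^sub>R e0)"
  have Ld: "L * norm d \<le> r / 16" using u by (simp add: d_def r_def)
  have ud: "u = x + (5 / 2 * r) *\<^sub>R e0 + d" by (simp add: d_def)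
  have pu: "\<pi> u = \<pi> x + \<pi> d"
    unfolding ud using bounded_linear.linear[OF pi] by (simp add: linear_add linear_scale pi_e0)
  have tu: "\<tau> u = \<tau> x + 5 / 2 * r + \<tau> d"
    unfolding ud using bounded_linear.linear[OF tau] by (simp add: linear_add linear_scale tau_e0)
  have pd: "\<bar>\<pi> d $ j\<bar> \<le> r / 16" for j
    using component_le_norm_cart[of "\<pi> d" j] piL[of d] Ld by linarith
  have td: "\<bar>\<tau> d\<bar> \<le> r / 16" using tauL[of d] Ld by linarith
  have e0': "0 \<le> \<epsilon>" using a[of undefined] abs_ge_zero order_trans by blast
  have ad: "\<bar>\<alpha> \<bullet> \<pi> d\<bar> \<le> r / 16"
  proof -
    have "\<bar>\<alpha> \<bullet> \<pi> d\<bar> \<le> \<epsilon> * (\<Sum>j\<in>UNIV. \<bar>\<pi> d $ j\<bar>)"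
      using l1_lipschitz_affine[of \<alpha> \<epsilon> "\<pi> d" 0 0, OF a] by simp
    also have "\<dots> \<le> \<epsilon> * (\<Sum>j\<in>(UNIV::'n set). r / 16)" by (intro mult_left_mono sum_mono pd e0')
    also have "\<dots> = (\<epsilon> * real CARD('n)) * (r / 16)" by simp
    also have "\<dots> \<le> 1 * (r / 16)"
    proof (rule mult_right_mono)
      have "0 \<le> \<epsilon> * real CARD('n)" using e0' by simp
      then show "\<epsilon> * real CARD('n) \<le> 1" using e by linarith
    qed (use r0 in simp)
    finally show ?thesis by simp
  qed
  have "rad p q m \<le> rad p q (Suc k)" using k by (intro rad_antimono) simp
  then have "4 * rad p q m \<le> r" using rad_Suc_le[OF q, of p k] by (simp add: r_def)
  then have t': "\<bar>\<tau> x - (\<alpha> \<bullet> \<pi> x + \<beta>)\<bar> < r / 4" using t by linarith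
  have g: "\<tau> u - (\<alpha> \<bullet> \<pi> u + \<beta>) = (\<tau> x - (\<alpha> \<bullet> \<pi> x + \<beta>)) + 5 / 2 * r + \<tau> d - \<alpha> \<bullet> \<pi> d"
    by (simp add: pu tu inner_add_right)
  have "2 * r < \<tau> u - (\<alpha> \<bullet> \<pi> u + \<beta>) \<and> \<tau> u - (\<alpha> \<bullet> \<pi> u + \<beta>) < 3 * r"
    unfolding g using t' td ad r0 by linarith
  moreover have "2 ^ q * r * real (c j) < \<pi> u $ j \<and> \<pi> u $ j < 2 ^ q * r * real (c j) + 3 * r" for j
  proof -
    have "2 ^ q * r * real (c j) + r \<le> \<pi> x $ j \<and> \<pi> x $ j < 2 ^ q * r * real (c j) + 2 * r"
      using s by (simp add: r_def)
    then show ?thesis unfolding pu vector_add_component using pd[of j] r0 by linarith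
  qed
  ultimately show ?thesis using k unfolding level_holes_def holes_def r_def by blast
qed

lemma directionally_porous_porous_set:
  assumes q: "\<And>i. 2 \<le> q i" and p: "\<And>i. i \<le> p i" and e: "\<epsilon> * (6 * real CARD('n)) \<le> 1" and a: "\<And>i j. \<bar>a i $ j\<bar> \<le> \<epsilon>"
  shows "directionally_porous (porous_set p q m a b)"
  unfolding directionally_porous_def
proof (intro exI[of _ "1 / (40 * L * norm e0 + 2)"] conjI ballI)
  \<comment> \<open>For the displacement \<open>t = 5 / 2 * r * norm e0\<close> the ball of radius
    \<open>?\<rho> * t\<close> must be mapped by the coordinates into distance
    \<open>r / 16\<close>; this needs \<open>40 * L * norm e0\<close> in the denominator, and the 2
    ensures \<open>?\<rho> < 1\<close>. Neither \<open>?\<rho>\<close> nor the direction depends on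
    the point.\<close>
  let ?\<rho> = "1 / (40 * L * norm e0 + 2)"
  have pos: "0 < 40 * L * norm e0 + 2" using L by (simp add: add_nonneg_pos)
  then show "0 < ?\<rho>" by simp
  have "1 < 40 * L * norm e0 + 2" using L by (simp add: add_nonneg_pos add_strict_increasing2)
  then show "?\<rho> < 1" by simp
  have e0: "e0 \<noteq> 0" using tau_e0 bounded_linear.linear[OF tau] linear_0 by force
  fix x assume x: "x \<in> porous_set p q m a b"
  show "\<exists>v. norm v = 1 \<and> (\<forall>\<delta>>0. \<exists>t. 0 < \<bar>t\<bar> \<and> \<bar>t\<bar> < \<delta> \<and> ball (x + t *\<^sub>R v) (?\<rho> * \<bar>t\<bar>) \<inter> porous_set p q m a b = {})"
  proof (intro exI[of _ "e0 /\<^sub>R norm e0"] conjI allI impI)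
    show "norm (e0 /\<^sub>R norm e0) = 1" using e0 by simp
    fix \<delta> :: real assume d: "0 < \<delta>"
    have "0 < \<delta> / (5 / 2 * norm e0)" using d e0 by simp
    then obtain N where N: "(1 / 2) ^ N < \<delta> / (5 / 2 * norm e0)" using real_arch_pow_inv[of "\<delta> / (5 / 2 * norm e0)" "1 / 2"] by auto
    obtain i where i: "N \<le> i" "\<pi> x \<in> seen (p i) (q i) (m i)" "\<bar>\<tau> x - (a i \<bullet> \<pi> x + b i)\<bar> < rad (p i) (q i) (m i)"
      using x by (auto simp: porous_set_def)
    obtain k c where k: "k < m i" and c: "\<forall>j. 2 ^ q i * rad (p i) (q i) k * real (c j) + rad (p i) (q i) k \<le> \<pi> x $ j
        \<and> \<pi> x $ j < 2 ^ q i * rad (p i) (q i) k * real (c j) + 2 * rad (p i) (q i) k"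
      using i(2) unfolding seen_def by blast
    define r where "r = rad (p i) (q i) k"
    have r0: "0 < r" by (simp add: r_def rad_pos)
    \<comment> \<open>As \<open>N \<le> i \<le> p i\<close>, holes of late levels are small at every
      scale, so \<open>t\<close> falls below any given bound.\<close>
    have "r \<le> (1 / 2) ^ N"
    proof -
      have "N \<le> p i + q i * k" using i(1) p[of i] by simp
      then have "(2::real) ^ N \<le> 2 ^ (p i + q i * k)" by (intro power_increasing) auto
      then show ?thesis by (simp add: r_def rad_def power_divide frac_le)
    qed
    then have "r < \<delta> / (5 / 2 * norm e0)" using N by linarith
    then have r1: "5 / 2 * r * norm e0 < \<delta>" using e0 by (simp add: field_simps)
    let ?t = "5 / 2 * r * norm e0"
    have t0: "0 < ?t" using r0 e0 by simp
    show "\<exists>t. 0 < \<bar>t\<bar> \<and> \<bar>t\<bar> < \<delta> \<and> ball (x + t *\<^sub>R (e0 /\<^sub>R norm e0)) (?\<rho> * \<bar>t\<bar>) \<inter> porous_set p q m a b = {}"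
    proof (intro exI[of _ ?t] conjI)
      show "0 < \<bar>?t\<bar>" "\<bar>?t\<bar> < \<delta>" using t0 r1 by auto
      have "u \<notin> porous_set p q m a b" if u: "u \<in> ball (x + ?t *\<^sub>R (e0 /\<^sub>R norm e0)) (?\<rho> * \<bar>?t\<bar>)" for u
      proof -
        have "?t *\<^sub>R (e0 /\<^sub>R norm e0) = (5 / 2 * r) *\<^sub>R e0" using e0 by simp
        from u have "norm ((x + (5 / 2 * r) *\<^sub>R e0) - u) < ?\<rho> * ?t"
          unfolding \<open>?t *\<^sub>R (e0 /\<^sub>R norm e0) = (5 / 2 * r) *\<^sub>R e0\<close> mem_ball dist_norm abs_of_pos[OF t0] .
        then have "norm (u - (x + (5 / 2 * r) *\<^sub>R e0)) < ?\<rho> * ?t"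
          by (simp only: norm_minus_commute)
        then have "L * norm (u - (x + (5 / 2 * r) *\<^sub>R e0)) \<le> L * (?\<rho> * ?t)"
          using L by (intro mult_left_mono) auto
        also have "\<dots> \<le> r / 16"
        proof -
          have "L * (?\<rho> * ?t) = r / 16 * ((40 * L * norm e0) / (40 * L * norm e0 + 2))" by simp
          also have "\<dots> \<le> r / 16 * 1" using r0 pos by (intro mult_left_mono) (auto simp: divide_le_eq)
          finally show ?thesis by simp
        qed
        finally have "\<pi> u \<in> level_holes (p i) (q i) (m i) (\<lambda>y. \<tau> u - (a i \<bullet> y + b i))"
          using i(3) by (intro hole_contains_ball[OF k q e a c]) (simp_all add: r_def)
        then show ?thesis by (auto simp: porous_set_def)
      qed
      then show "ball (x + ?t *\<^sub>R (e0 /\<^sub>R norm e0)) (?\<rho> * \<bar>?t\<bar>) \<inter> porous_set p q m a b = {}" by blast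
    qed
  qed
qed

text \<open>\<open>core\<close> has measure \<open>(1 / 2) ^ n\<close>. The holes remove less than
  this, and the points that are seen with small error only finitely often form a null set. Over all
  remaining base points the surface is in the set.\<close>

lemma good_surface_meets_porous_set:
  assumes n: "3 \<le> CARD('n)" and eps: "0 < \<epsilon>" "4 * \<epsilon> * (6 * real CARD('n)) \<le> 1" "loss_const \<epsilon> q0 CARD('n) < (1 / 2) ^ CARD('n)"
    and c: "lip \<epsilon>' \<le> 1 / 4" "L * \<epsilon>' \<le> 1 / 4" "4 / 3 * lip \<epsilon>' < \<epsilon>" "L * \<epsilon>' \<le> \<epsilon>"
    and a: "\<And>i j. \<bar>a i $ j\<bar> \<le> \<epsilon>" and b: "\<And>i. \<bar>b i\<bar> \<le> (real CARD('n) + 2) * \<epsilon>"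
    and q: "\<And>i. 2 \<le> q i \<and> q0 + i \<le> q i \<and> q i \<le> p i" and m: "\<And>i. 1 \<le> m i"
    and sep: "\<And>i k. i < k \<Longrightarrow> 2 + 2 * k + p i + q i * m i \<le> p k"
    and uns: "\<And>i. measure lborel (hcube 0 1 - seen (p i) (q i) (m i) :: (real ^ 'n) set) \<le> (1 / 2) ^ i"
    and f: "\<And>N. f \<in> good \<epsilon>' a b (\<lambda>i. rad (p i) (q i) (m i)) N"
  shows "\<not> negligible (\<pi> ` (f ` unit_cube \<inter> porous_set p q m a b))" (is "\<not> negligible ?Y")
proof
  assume Y: "negligible ?Y"
  have fn: "f \<in> near \<epsilon>'" using f[of 0] by (simp add: good_def)
  have "\<exists>Lo\<in>sets lborel. measure lborel Lo \<le> loss_const \<epsilon> q0 CARD('n) \<and> emeasure lborel Lo < \<infinity> \<and>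
     {y \<in> core. \<exists>i. y \<in> level_holes (p i) (q i) (m i) (\<lambda>y. hgt f y - (a i \<bullet> y + b i))} \<subseteq> Lo"
  proof (rule loss_core[OF n eps(1,2)])
    fix x y :: "real ^ 'n" assume xy: "x \<in> core" "y \<in> core"
    have "\<bar>hgt f x - hgt f y\<bar> \<le> 4 / 3 * lip \<epsilon>' * norm (x - y)" by (rule hgt_lipschitz[OF fn c(1,2) xy])
    also have "\<dots> \<le> \<epsilon> * norm (x - y)" using c(3) by (intro mult_right_mono) auto
    also have "\<dots> \<le> \<epsilon> * (\<Sum>j\<in>UNIV. \<bar>x $ j - y $ j\<bar>)"
      using eps(1) norm_le_l1_cart[of "x - y"] by (intro mult_left_mono) auto
    finally show "\<bar>hgt f x - hgt f y\<bar> \<le> \<epsilon> * (\<Sum>j\<in>UNIV. \<bar>x $ j - y $ j\<bar>)" .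
  next
    fix x :: "real ^ 'n" assume "x \<in> core"
    then show "\<bar>hgt f x\<bar> \<le> \<epsilon>" using hgt_bound[OF fn c(1,2)] c(4) by fastforce
  qed (use a b q m sep in auto)
  then obtain Lo where Lo: "Lo \<in> sets lborel" "measure lborel Lo \<le> loss_const \<epsilon> q0 CARD('n)" "emeasure lborel Lo < \<infinity>"
    "{y \<in> core. \<exists>i. y \<in> level_holes (p i) (q i) (m i) (\<lambda>y. hgt f y - (a i \<bullet> y + b i))} \<subseteq> Lo" by blast
  define Z where "Z = {y \<in> core. \<exists>N. \<forall>i\<ge>N. \<not> (y \<in> seen (p i) (q i) (m i) \<and> \<bar>hgt f y - (a i \<bullet> y + b i)\<bar> < rad (p i) (q i) (m i))}"
  have ZN: "negligible {y \<in> core. \<forall>i\<ge>N0. \<not> (y \<in> seen (p i) (q i) (m i) \<and> \<bar>hgt f y - (a i \<bullet> y + b i)\<bar> < rad (p i) (q i) (m i))}" (is "negligible ?Z0") for N0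
  proof (rule negligible_outer_le[THEN iffD2], intro allI impI)
    fix \<eta> :: real assume \<eta>: "0 < \<eta>"
    then obtain N1 where N1: "(1 / 2) ^ N1 < \<eta> / 3" using real_arch_pow_inv[of "\<eta> / 3" "1 / 2"] by auto
    define N where "N = max N0 N1"
    have N: "3 * (1 / 2) ^ N < \<eta>"
    proof -
      have "(1 / 2 :: real) ^ N \<le> (1 / 2) ^ N1" by (intro power_decreasing) (auto simp: N_def)
      then show ?thesis using N1 by linarith
    qed
    obtain S where S0: "finite S"
      and S2: "\<And>i K. (i, K) \<in> S \<Longrightarrow> N \<le> i \<and> compact K \<and> K \<subseteq> core \<and> (\<forall>y\<in>K. \<bar>hgt f y - (a i \<bullet> y + b i)\<bar> < rad (p i) (q i) (m i))"
      and S3: "measure lborel (core - \<Union>(snd ` S)) < (1 / 2) ^ N"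
      by (rule goodE[OF f[of N]]) (rule that)
    let ?A = "core - \<Union>(snd ` S) :: (real ^ 'n) set"
    let ?B = "\<lambda>i. hcube 0 1 - seen (p i) (q i) (m i) :: (real ^ 'n) set"
    \<comment> \<open>A point of \<open>core\<close> outside \<open>?T\<close> lies in a piece with
      some index \<open>i \<ge> N\<close> and is seen at that level. The two parts of
      \<open>?T\<close> have measure at most \<open>(1 / 2) ^ N\<close> and
      \<open>2 * (1 / 2) ^ N\<close>.\<close>
    let ?T = "?A \<union> (\<Union>i\<in>fst ` S. ?B i)"
    have Aset: "?A \<in> sets borel"
    proof -
      have "closed (\<Union>x\<in>S. snd x)"
        using S0 S2 by (intro closed_UN) (auto intro!: compact_imp_closed)
      then show ?thesis by (auto simp: core_def)
    qed
    have Bset: "?B i \<in> sets borel" for i by (intro sets.Diff hcube_borel seen_borel)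
    have fA: "?A \<in> fmeasurable lborel"
      by (rule fmeasurableI2[OF hcube_fmeasurable[of 0 1]]) (use Aset core_subset_hcube in auto)
    have fB: "?B i \<in> fmeasurable lborel" for i
      by (rule fmeasurableI2[OF hcube_fmeasurable[of 0 1]]) (use Bset in auto)
    have fU: "(\<Union>i\<in>fst ` S. ?B i) \<in> fmeasurable lborel" using S0 fB by (intro fmeasurable.finite_UN) auto
    have "measure lborel ?T \<le> measure lborel ?A + measure lborel (\<Union>i\<in>fst ` S. ?B i)"
      using fA fU by (intro measure_Un_le) auto
    also have "measure lborel (\<Union>i\<in>fst ` S. ?B i) \<le> (\<Sum>i\<in>fst ` S. measure lborel (?B i))"
      using S0 Bset by (intro measure_UNION_le) auto
    also have "\<dots> \<le> (\<Sum>i\<in>fst ` S. (1 / 2) ^ i)" by (intro sum_mono uns)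
    also have "\<dots> \<le> 2 * (1 / 2) ^ N" using S0 S2 by (intro sum_half_powers_le) auto
    finally have mT: "measure lborel ?T \<le> \<eta>" using S3 N by linarith
    have fT: "?T \<in> fmeasurable lborel" using fA fU by (rule fmeasurable.Un)
    show "\<exists>T. ?Z0 \<subseteq> T \<and> T \<in> lmeasurable \<and> measure lebesgue T \<le> \<eta>"
    proof (intro exI[of _ ?T] conjI)
      show "?Z0 \<subseteq> ?T"
      proof
        fix y assume y: "y \<in> ?Z0"
        show "y \<in> ?T"
        proof (rule ccontr)
          assume nT: "y \<notin> ?T"
          then obtain i K where iK: "(i, K) \<in> S" "y \<in> K" using y by auto
          then have "y \<in> seen (p i) (q i) (m i)" using nT y core_subset_hcube by fastforce
          moreover have "\<bar>hgt f y - (a i \<bullet> y + b i)\<bar> < rad (p i) (q i) (m i)" "N0 \<le> i"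
            using S2[OF iK(1)] iK(2) by (auto simp: N_def)
          ultimately show False using y by blast
        qed
      qed
      show "?T \<in> lmeasurable" using fT by (rule fmeasurable_lborel_imp_lmeasurable)
      show "measure lebesgue ?T \<le> \<eta>" using mT fmeasurableD[OF fT] by (simp add: measure_completion)
    qed
  qed
  have "Z = (\<Union>N. {y \<in> core. \<forall>i\<ge>N. \<not> (y \<in> seen (p i) (q i) (m i) \<and> \<bar>hgt f y - (a i \<bullet> y + b i)\<bar> < rad (p i) (q i) (m i))})"
    by (auto simp: Z_def)
  then have Z: "negligible Z" using ZN by (auto intro!: negligible_countable_Union[of "range _"])
  have cover: "core - Lo \<subseteq> Z \<union> ?Y"
  proof
    fix y assume y: "y \<in> core - Lo"
    then have yc: "y \<in> core" by simp
    note ci = cinv[OF fn c(1,2) yc]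
    let ?v = "f (cinv f y)"
    have v: "\<pi> ?v = y" "\<tau> ?v = hgt f y" using ci by (auto simp: hgt_def)
    show "y \<in> Z \<union> ?Y"
    proof (cases "y \<in> Z")
      case False
      then have seen: "\<forall>N. \<exists>i\<ge>N. y \<in> seen (p i) (q i) (m i) \<and> \<bar>hgt f y - (a i \<bullet> y + b i)\<bar> < rad (p i) (q i) (m i)"
        using yc by (auto simp: Z_def)
      have "y \<notin> level_holes (p i) (q i) (m i) (\<lambda>y. hgt f y - (a i \<bullet> y + b i))" for i
        using y Lo(4) by blast
      then have "y \<notin> level_holes (p i) (q i) (m i) (\<lambda>z. hgt f y - (a i \<bullet> z + b i))" for i
        by (subst level_holes_cong[where g' = "\<lambda>y. hgt f y - (a i \<bullet> y + b i)"]) simp_all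
      then have "?v \<in> porous_set p q m a b" using seen by (simp add: porous_set_def v)
      then have "y \<in> ?Y" using ci v(1) by (intro image_eqI[of _ _ ?v]) auto
      then show ?thesis by simp
    qed simp
  qed
  have "negligible (core - Lo)" by (rule negligible_subset[OF negligible_Un[OF Z Y] cover])
  then have null: "measure lebesgue (core - Lo) = 0" by (simp add: negligible_imp_measure0)
  have cs: "(core :: (real ^ 'n) set) \<in> sets lborel" by (simp add: core_def)
  have fmL: "Lo \<in> fmeasurable lborel" using Lo(1,3) by (simp add: fmeasurableI)
  have fmc: "core - Lo \<in> fmeasurable lborel"
    by (rule fmeasurableI2[OF hcube_fmeasurable[of 0 1]]) (use core_subset_hcube cs Lo(1) in auto)
  have "measure lborel (core :: (real ^ 'n) set) \<le> measure lborel (Lo \<union> (core - Lo))"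
    using cs by (intro measure_mono_fmeasurable fmeasurable.Un fmL fmc) auto
  also have "\<dots> \<le> measure lborel Lo + measure lborel (core - Lo)"
    using fmL fmc by (intro measure_Un_le) auto
  also have "measure lborel (core - Lo) = 0" using null fmeasurableD[OF fmc] by (simp add: measure_completion)
  finally show False using Lo(2) eps(3) by (simp add: measure_core)
qed

end

theorem theorem1p4:
  assumes "2 < CARD('n::finite)"
    and "enat CARD('n) < vdim TYPE('a::banach)"
  shows "\<exists>P :: 'a set. directionally_porous P \<and> \<not> Gamma_null TYPE('n) P"
proof -
  have n: "3 \<le> CARD('n)" using assms(1) by simp
  obtain e :: "'n \<Rightarrow> 'a" and e0 \<pi> \<tau> L where "coords e e0 \<pi> \<tau> L" by (rule coords_exist[OF assms(2)])
  then interpret coords e e0 \<pi> \<tau> L .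
  obtain \<epsilon> q0 where eps: "0 < \<epsilon>" "4 * \<epsilon> * (6 * real CARD('n)) \<le> 1" "loss_const \<epsilon> q0 CARD('n) < (1 / 2) ^ CARD('n)"
    by (rule loss_const_small)
  obtain p q m :: "nat \<Rightarrow> nat" where q: "\<And>i. 2 \<le> q i \<and> q0 + i \<le> q i \<and> q i \<le> p i" and m: "\<And>i. 1 \<le> m i"
    and sep: "\<And>i k. i < k \<Longrightarrow> 2 + 2 * k + p i + q i * m i \<le> p k"
    and uns: "\<And>i. measure lborel (hcube 0 1 - seen (p i) (q i) (m i) :: (real ^ 'n) set) \<le> (1 / 2) ^ i"
    by (rule scales_exist[where 'n = 'n, of q0]) (rule that)
  obtain a :: "nat \<Rightarrow> real ^ 'n" and b :: "nat \<Rightarrow> real" where a: "\<And>i j. \<bar>a i $ j\<bar> \<le> \<epsilon>" and b: "\<And>i. \<bar>b i\<bar> \<le> (real CARD('n) + 2) * \<epsilon>"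
    and dens0: "\<forall>\<alpha> \<beta> t N. (\<forall>j. \<bar>\<alpha> $ j\<bar> < \<epsilon>) \<longrightarrow> \<bar>\<beta>\<bar> < (real CARD('n) + 2) * \<epsilon> \<longrightarrow> 0 < t \<longrightarrow>
       (\<exists>i\<ge>N. norm (a i - \<alpha>) < t \<and> \<bar>b i - \<beta>\<bar> < t)"
    by (rule dense_affine_sequence[where 'n = 'n, OF eps(1)]) (rule that)
  have dens: "\<exists>i\<ge>N. norm (a i - \<alpha>) < t \<and> \<bar>b i - \<beta>\<bar> < t"
    if "\<And>j. \<bar>\<alpha> $ j\<bar> < \<epsilon>" "\<bar>\<beta>\<bar> < (real CARD('n) + 2) * \<epsilon>" "0 < t" for \<alpha> \<beta> t N
    using dens0 that by blast
  define P where "P = porous_set p q m a b"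
  \<comment> \<open>Chosen so that \<open>lip \<epsilon>'\<close> is the minimum of
    \<open>1 / 4\<close>, for the inversion of the base map, and \<open>\<epsilon> / 2\<close>, for
    which \<open>4 / 3 * lip \<epsilon>'\<close> is still below \<epsilon>.\<close>
  define \<epsilon>' where "\<epsilon>' = min (1 / 4) (\<epsilon> / 2) / (L * real CARD('n))"
  have \<epsilon>': "0 < \<epsilon>'" using eps(1) L by (simp add: \<epsilon>'_def)
  have lipe: "lip \<epsilon>' = min (1 / 4) (\<epsilon> / 2)" using L by (simp add: lip_def \<epsilon>'_def)
  have Le: "L * \<epsilon>' \<le> lip \<epsilon>'"
  proof -
    have "1 * \<epsilon>' \<le> real CARD('n) * \<epsilon>'" using \<epsilon>' n by (intro mult_right_mono) auto
    then show ?thesis using L unfolding lip_def by (intro mult_left_mono) auto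
  qed
  have c: "lip \<epsilon>' \<le> 1 / 4" "L * \<epsilon>' \<le> 1 / 4" "4 / 3 * lip \<epsilon>' < \<epsilon>" "L * \<epsilon>' \<le> \<epsilon>"
    using Le eps(1) unfolding lipe by (auto simp: min_def split: if_splits)
  have "directionally_porous P"
    unfolding P_def
  proof (rule directionally_porous_porous_set[OF _ _ _ a])
    show "2 \<le> q i" for i using q by blast
    show "i \<le> p i" for i using q[of i] by linarith
    have "0 \<le> \<epsilon> * (6 * real CARD('n))" using eps(1) by simp
    then show "\<epsilon> * (6 * real CARD('n)) \<le> 1" using eps(2) by linarith
  qed
  moreover have "\<not> Gamma_null TYPE('n) P"
  proof
    assume "Gamma_null TYPE('n) P"
    then have R: "residual_in surface_topology {f \<in> surfaces. hausdorff_measure CARD('n) (f ` (unit_cube :: (real ^ 'n) set) \<inter> P) = 0}"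
      by (simp add: Gamma_null_def)
    interpret Metric_space "surfaces :: (real ^ 'n \<Rightarrow> 'a) set" C1_dist by (rule Metric_space_surfaces)
    have "flat \<in> near \<epsilon>'" using flat_surface \<epsilon>' by (simp add: near_def)
    then have ne: "near \<epsilon>' \<noteq> {}" by blast
    have rad: "\<And>i. 0 < rad (p i) (q i) (m i)" by (rule rad_pos)
    \<comment> \<open>The \<open>good\<close> sets are open and dense only inside the ball
      \<open>near \<epsilon>'\<close>; this is enough, since a residual set meets every nonempty
      open set.\<close>
    have "\<exists>f. f \<in> near \<epsilon>' \<and> f \<in> {f \<in> surfaces. hausdorff_measure CARD('n) (f ` (unit_cube :: (real ^ 'n) set) \<inter> P) = 0}
        \<and> (\<forall>N. f \<in> good \<epsilon>' a b (\<lambda>i. rad (p i) (q i) (m i)) N)"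
    proof (rule residual_meets[OF R openin_near ne])
      show "openin surface_topology (good \<epsilon>' a b (\<lambda>i. rad (p i) (q i) (m i)) N)" for N
        by (rule openin_good[OF c(1,2) rad])
      fix N f and \<eta> :: real assume f: "f \<in> near \<epsilon>'" and \<eta>: "0 < \<eta>"
      show "\<exists>f'\<in>good \<epsilon>' a b (\<lambda>i. rad (p i) (q i) (m i)) N. C1_dist f f' < \<eta>"
        by (rule dense_good[OF c \<epsilon>' rad _ f \<eta>]) (rule dens)
    qed
    then obtain f where f: "f \<in> {f \<in> surfaces. hausdorff_measure CARD('n) (f ` (unit_cube :: (real ^ 'n) set) \<inter> P) = 0}"
      "\<And>N. f \<in> good \<epsilon>' a b (\<lambda>i. rad (p i) (q i) (m i)) N"
      by blast
    have "negligible (\<pi> ` (f ` unit_cube \<inter> P))"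
    proof (rule hausdorff_null_imp_negligible)
      show "hausdorff_measure CARD('n) (f ` unit_cube \<inter> P) = 0" using f(1) by simp
      show "norm (\<pi> u - \<pi> v) \<le> L * norm (u - v)" for u v using piL[of "u - v"] by (simp add: pi_diff)
    qed (use L in simp)
    moreover have "\<not> negligible (\<pi> ` (f ` unit_cube \<inter> P))"
      unfolding P_def by (rule good_surface_meets_porous_set[OF n eps c a b q m sep uns f(2)])
    ultimately show False by contradiction
  qed
  ultimately show ?thesis by blast
qed

end
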